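(* Let $q$ be a complex-valued function on $\mathbb{R}$ with $q\in L_1[0,1]$, $\int_0^1 q(x)\,dx=0$, $q(x+1)=q(x)$ and $\overline{q(-x)}=q(x)$, and suppose $q\in W_1^s[0,1]$ for some integer $s\ge 0$. For $n\in\mathbb{Z}$ let $$q_n=\int_0^1 q(x)e^{-i2\pi nx}dx,\quad Q(x)=\int_0^x q(t)\,dt,\quad S(x)=Q^2(x),$$ $$Q_n=\int_0^1 Q(x)e^{-i2\pi nx}dx,\quad S_n=\int_0^1 S(x)e^{-i2\pi nx}dx,$$ $$P_n=q_nq_{-n}-q_n\left(S_{-n}-2Q_0Q_{-n}\right)-q_{-n}\left(S_n-2Q_0Q_n\right).$$ If there exist positive constants $m$ and $\alpha$ such that $$P_n<-\alpha n^{-2s-2}$$ for all $n>m$, then $q$ is a finite-zone potential.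
   Context: $L(q)$ is the operator generated in $L_2(-\infty,\infty)$ by the expression $-y''(x)+q(x)y(x)$, and $\sigma(L(q))$ is its spectrum. The real part of the spectrum is $\operatorname{Re}(\sigma(L(q))):=\sigma(L(q))\cap\mathbb{R}$. The potential $q$ is called finite-zone if $\operatorname{Re}(\sigma(L(q)))$ contains a half-line $[R,\infty)$ for some number $R$ (which implies that the number of gaps in $\operatorname{Re}(\sigma(L(q)))$ is finite). For a $1$-periodic function $u$ on $\mathbb{R}$ and an integer $s\ge0$, $u\in W_1^s[0,1]$ means that (as a periodic function on $\mathbb{R}$) $u,u',\dots,u^{(s-1)}$ are locally absolutely continuous and $u^{(s)}$ is integrable on $[0,1]$; $W_1^0[0,1]=L_1[0,1]$. Under the stated assumptions on $q$ all the numbers $P_n$ are real. *)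

theory Defs
  imports "HOL-Analysis.Analysis"
begin

definition abs_continuous_on :: "real \<Rightarrow> real \<Rightarrow> (real \<Rightarrow> complex) \<Rightarrow> bool" where
  "abs_continuous_on a b f \<longleftrightarrow>
    (\<forall>\<epsilon>>0. \<exists>\<delta>>0. \<forall>(N::nat) c d.
       (\<forall>k<N. a \<le> c k \<and> c k \<le> d k \<and> d k \<le> b) \<and>
       disjoint_family_on (\<lambda>k. {c k<..<d k}) {..<N} \<and>
       (\<Sum>k<N. d k - c k) < \<delta> \<longrightarrow>
       (\<Sum>k<N. cmod (f (d k) - f (c k))) < \<epsilon>)"

definition locally_abs_continuous :: "(real \<Rightarrow> complex) \<Rightarrow> bool" where
  "locally_abs_continuous f \<longleftrightarrow> (\<forall>a b. abs_continuous_on a b f)"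

text \<open>Sobolev regularity of order \<open>s\<close> in the \<open>L\<^sub>1\<close> scale for a 1-periodic function. The witness
  \<open>v\<close> is the derivative of \<open>u\<close>: it is unique up to a null set, and if it is itself locally
  absolutely continuous then it is the derivative of \<open>u\<close> at every point.\<close>

primrec sobolev_W1 :: "nat \<Rightarrow> (real \<Rightarrow> complex) \<Rightarrow> bool" where
  "sobolev_W1 0 u \<longleftrightarrow> u absolutely_integrable_on {0..1}"
| "sobolev_W1 (Suc s) u \<longleftrightarrow>
     locally_abs_continuous u \<and>
     (\<exists>v. (AE x in lebesgue. (u has_vector_derivative v x) (at x)) \<and> sobolev_W1 s v)"

definition L2_fun :: "(real \<Rightarrow> complex) set" where
  "L2_fun = {f. f \<in> borel_measurable lebesgue \<and> integrable lebesgue (\<lambda>x. (cmod (f x))\<^sup>2)}"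

definition L2_norm :: "(real \<Rightarrow> complex) \<Rightarrow> real" where
  "L2_norm f = sqrt (LINT x|lebesgue. (cmod (f x))\<^sup>2)"

text \<open>The graph of the maximal operator generated by \<open>- y'' + q y\<close>. Elements of \<open>L\<^sub>2\<close> are
  represented by functions; a class in the domain is represented by its unique continuous member,
  and the image is determined up to a null set.\<close>

definition schroedinger_op ::
    "(real \<Rightarrow> complex) \<Rightarrow> ((real \<Rightarrow> complex) \<times> (real \<Rightarrow> complex)) set" where
  "schroedinger_op q = {(y, f). y \<in> L2_fun \<and> f \<in> L2_fun \<and>
     locally_abs_continuous y \<and>
     (\<exists>y' y''. (\<forall>x. (y has_vector_derivative y' x) (at x)) \<and>
        locally_abs_continuous y' \<and>
        (AE x in lebesgue. (y' has_vector_derivative y'' x) (at x)) \<and>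
        (AE x in lebesgue. f x = - y'' x + q x * y x))}"

text \<open>For an operator in \<open>L\<^sub>2\<close> given by its graph \<open>T\<close>: \<open>T - \<mu>\<close> is onto, is one-to-one modulo null
  functions, and has a bounded inverse. The last clause contains injectivity, since it makes the
  norm of \<open>y\<close> vanish whenever \<open>f - \<mu> y\<close> is null.\<close>

definition resolvent_set ::
    "((real \<Rightarrow> complex) \<times> (real \<Rightarrow> complex)) set \<Rightarrow> complex set" where
  "resolvent_set T = {\<mu>.
     (\<forall>h\<in>L2_fun. \<exists>(y, f)\<in>T. AE x in lebesgue. f x - \<mu> * y x = h x) \<and>
     (\<exists>C. \<forall>(y, f)\<in>T. L2_norm y \<le> C * L2_norm (\<lambda>x. f x - \<mu> * y x))}"

definition op_spectrum ::
    "((real \<Rightarrow> complex) \<times> (real \<Rightarrow> complex)) set \<Rightarrow> complex set" where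
  "op_spectrum T = - resolvent_set T"

definition real_spectrum :: "(real \<Rightarrow> complex) \<Rightarrow> complex set" where
  "real_spectrum q = op_spectrum (schroedinger_op q) \<inter> \<real>"

definition finite_zone :: "(real \<Rightarrow> complex) \<Rightarrow> bool" where
  "finite_zone q \<longleftrightarrow> (\<exists>R::real. complex_of_real ` {R..} \<subseteq> real_spectrum q)"

definition fourier_coeff :: "(real \<Rightarrow> complex) \<Rightarrow> int \<Rightarrow> complex" where
  "fourier_coeff f n = integral {0..1} (\<lambda>x. f x * exp (- (\<i> * 2 * of_real pi * of_int n * of_real x)))"

definition primitive :: "(real \<Rightarrow> complex) \<Rightarrow> real \<Rightarrow> complex" where
  "primitive q x = (if 0 \<le> x then integral {0..x} q else - integral {x..0} q)"

definition P_coeff :: "(real \<Rightarrow> complex) \<Rightarrow> int \<Rightarrow> complex" where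
  "P_coeff q n =
    (let qc = fourier_coeff q;
         Q = fourier_coeff (primitive q);
         S = fourier_coeff (\<lambda>x. (primitive q x)\<^sup>2)
     in qc n * qc (- n)
        - qc n * (S (- n) - 2 * Q 0 * Q (- n))
        - qc (- n) * (S n - 2 * Q 0 * Q n))"

end

theory Submission
  imports Defs
begin

text \<open>A real \<open>k\<^sup>2\<close> lies in the spectrum as soon as the Hill discriminant \<open>F(k)\<close> lies in
  \<open>[-2, 2]\<close>, because a Bloch solution with multiplier on the unit circle, damped by
  \<open>1 / (1 + (\<epsilon> x)\<^sup>2)\<close>, is a Weyl sequence. The symmetry \<open>cnj (q (- x)) = q x\<close> makes \<open>F\<close> real,
  and \<open>F(k) = 2 cos k + O(1/k)\<close>, so by continuity it suffices that \<open>F(k) = \<plusminus> 2\<close> has no large solution;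
  such a \<open>k\<close> is close to some \<open>\<pi> n\<close>, with an (anti)periodic eigenfunction at \<open>k\<^sup>2 = (\<pi> n)\<^sup>2 + z\<close>.

  Removing the phase \<open>exp (- i \<pi> n x)\<close> turns that eigenfunction into a 1-periodic solution of
  \<open>u = b + a e\<^sub>n + T (q - z) u\<close>, where \<open>T\<close> inverts \<open>D\<^sup>2 - 2 \<pi> i n D\<close> off the two resonant modes
  and maps \<open>L\<^sub>1\<close> to \<open>L\<^sub>\<infinity>\<close> with norm \<open>O(1/n)\<close>. Iterating this equation \<open>2 s + 3\<close> times in the two
  solvability conditions gives \<open>d\<^sup>2 = \<beta>(n) \<beta>(-n) + O(n\<^bsup>-2s-3\<^esup>)\<close> with \<open>d\<close> real. Integrating by parts
  \<open>s\<close> times and using a uniform Riemann-Lebesgue lemma, the term of \<open>\<beta>(n)\<close> with \<open>k\<close> factors \<open>T\<close> is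
  \<open>o(n\<^bsup>-s-k\<^esup>)\<close>, and the terms \<open>k = 0, 1\<close> are explicit, so \<open>\<beta>(n) \<beta>(-n) = P\<^sub>n + o(n\<^bsup>-2s-2\<^esup>)\<close>. Since
  \<open>P\<^sub>n\<close> is negative this contradicts \<open>d\<^sup>2 \<ge> 0\<close>.\<close>

section \<open>Absolutely continuous functions\<close>

text \<open>The potential is merely integrable, so derivatives, integration by parts and the
  differential equation itself are all expressed through primitives; absolute continuity is what
  makes the product rule available. The number \<open>d\<close> is the same in both solvability
  conditions because transposing \<open>T\<close> replaces \<open>n\<close> by \<open>- n\<close>
  and reverses a product of equal factors; it is real because the reflection symmetry of
  \<open>q\<close> passes to every iterate. The conditions form the system
  \<open>b d + a beta(-n) = small\<close>, \<open>b beta(n) + a d = small\<close> for a nonzero pair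
  \<open>(b, a)\<close>, hence the determinant is small. One iteration more than the order
  \<open>2 s + 2\<close> of the lower bound puts this error below the bound, and the positive
  \<open>\<alpha>\<close> absorbs the errors \<open>o(n^(-2s-2))\<close>. The shift \<open>z\<close>
  is unknown and changes with \<open>n\<close>. It is bounded independently of \<open>n\<close>, and
  its contribution to \<open>beta(n)\<close> is of the order of the discarded terms, which is why
  the explicit leading part does not contain it.\<close>

lemma abs_continuous_onE:
  assumes "abs_continuous_on a b f" "\<epsilon> > 0"
  obtains \<delta> where "\<delta> > 0"
    "\<And>(N::nat) c d. (\<forall>k<N. a \<le> c k \<and> c k \<le> d k \<and> d k \<le> b) \<and>
       disjoint_family_on (\<lambda>k. {c k<..<d k}) {..<N} \<and> (\<Sum>k<N. d k - c k) < \<delta> \<Longrightarrow>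
       (\<Sum>k<N. cmod (f (d k) - f (c k))) < \<epsilon>"
proof -
  from assms(1)[unfolded abs_continuous_on_def, THEN spec, THEN mp, OF assms(2)]
  obtain \<delta> where 1: "\<delta> > 0" and 2: "\<forall>(N::nat) c d. (\<forall>k<N. a \<le> c k \<and> c k \<le> d k \<and> d k \<le> b) \<and>
       disjoint_family_on (\<lambda>k. {c k<..<d k}) {..<N} \<and> (\<Sum>k<N. d k - c k) < \<delta> \<longrightarrow>
       (\<Sum>k<N. cmod (f (d k) - f (c k))) < \<epsilon>"
    by (elim exE conjE)
  show thesis
    by (rule that[OF 1 2[THEN spec, THEN spec, THEN spec, THEN mp]])
qed

text \<open>Pieces of a tagged division carry no numbering, so the condition is transported from
  initial segments of the naturals to arbitrary finite index sets.\<close>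

lemma abs_continuous_on_finite:
  assumes "abs_continuous_on a b f" "\<epsilon> > 0"
  obtains \<delta> where "\<delta> > 0"
    "\<And>I c d. finite I \<Longrightarrow> (\<And>i. i \<in> I \<Longrightarrow> a \<le> c i \<and> c i \<le> d i \<and> d i \<le> b) \<Longrightarrow>
       disjoint_family_on (\<lambda>i. {c i<..<d i}) I \<Longrightarrow> (\<Sum>i\<in>I. d i - c i) < \<delta> \<Longrightarrow>
       (\<Sum>i\<in>I. cmod (f (d i) - f (c i))) < \<epsilon>"
proof -
  obtain \<delta> where \<delta>: "\<delta> > 0" "\<And>(N::nat) c d. (\<forall>k<N. a \<le> c k \<and> c k \<le> d k \<and> d k \<le> b) \<and>
       disjoint_family_on (\<lambda>k. {c k<..<d k}) {..<N} \<and> (\<Sum>k<N. d k - c k) < \<delta> \<Longrightarrow>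
       (\<Sum>k<N. cmod (f (d k) - f (c k))) < \<epsilon>"
    by (rule abs_continuous_onE[OF assms]) (rule that)
  show thesis
  proof (rule that[OF \<delta>(1)])
    fix I :: "'c set" and c d
    assume I: "finite I" "\<And>i. i \<in> I \<Longrightarrow> a \<le> c i \<and> c i \<le> d i \<and> d i \<le> b"
       "disjoint_family_on (\<lambda>i. {c i<..<d i}) I" "(\<Sum>i\<in>I. d i - c i) < \<delta>"
    obtain h where h: "bij_betw h {..<card I} I"
      using ex_bij_betw_nat_finite[OF I(1)] by (auto simp: atLeast0LessThan)
    have dis: "disjoint_family_on (\<lambda>k. {c (h k)<..<d (h k)}) {..<card I}"
      using I(3) h unfolding disjoint_family_on_def bij_betw_def inj_on_def
      by (metis imageI)
    have "(\<Sum>k<card I. d (h k) - c (h k)) = (\<Sum>i\<in>I. d i - c i)"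
      by (rule sum.reindex_bij_betw[OF h])
    then have "(\<Sum>k<card I. cmod (f (d (h k)) - f (c (h k)))) < \<epsilon>"
      using I h dis by (intro \<delta>(2)) (auto simp: bij_betw_def)
    also have "(\<Sum>k<card I. cmod (f (d (h k)) - f (c (h k)))) = (\<Sum>i\<in>I. cmod (f (d i) - f (c i)))"
      by (rule sum.reindex_bij_betw[OF h])
    finally show "(\<Sum>i\<in>I. cmod (f (d i) - f (c i))) < \<epsilon>" .
  qed
qed

lemma abs_continuous_on_imp_continuous_on:
  assumes "abs_continuous_on a b f"
  shows "continuous_on {a..b} f"
  unfolding continuous_on_iff
proof (intro ballI allI impI)
  fix x e :: real assume x: "x \<in> {a..b}" and e: "e > 0"
  obtain \<delta> where \<delta>: "\<delta> > 0" "\<And>(N::nat) c d. (\<forall>k<N. a \<le> c k \<and> c k \<le> d k \<and> d k \<le> b) \<and>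
       disjoint_family_on (\<lambda>k. {c k<..<d k}) {..<N} \<and> (\<Sum>k<N. d k - c k) < \<delta> \<Longrightarrow>
       (\<Sum>k<N. cmod (f (d k) - f (c k))) < e"
    by (rule abs_continuous_onE[OF assms e]) (rule that)
  show "\<exists>d>0. \<forall>x'\<in>{a..b}. dist x' x < d \<longrightarrow> dist (f x') (f x) < e"
  proof (intro exI[of _ \<delta>] conjI ballI impI \<delta>(1))
    fix y assume y: "y \<in> {a..b}" "dist y x < \<delta>"
    have "(\<Sum>i<Suc 0. cmod (f (max x y) - f (min x y))) < e"
      using x y by (intro \<delta>(2)) (auto simp: disjoint_family_on_def dist_real_def)
    then show "dist (f y) (f x) < e"
      by (cases "x \<le> y") (auto simp: dist_norm max_def min_def norm_minus_commute)
  qed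
qed

text \<open>One comparison principle serves sums (\<open>B = 1\<close>), products (\<open>B\<close>
  a common bound of both factors) and restrictions: in each case the increments of \<open>f\<close>
  and \<open>g\<close> control those of \<open>h\<close>.\<close>

lemma abs_continuous_on_dominated:
  assumes f: "abs_continuous_on a b f" and g: "abs_continuous_on a b g"
    and sub: "a \<le> a'" "b' \<le> b"
    and h: "\<And>x y. a' \<le> x \<Longrightarrow> x \<le> y \<Longrightarrow> y \<le> b' \<Longrightarrow>
      cmod (h y - h x) \<le> B * (cmod (f y - f x) + cmod (g y - g x))"
  shows "abs_continuous_on a' b' h"
  unfolding abs_continuous_on_def
proof (intro allI impI)
  fix \<epsilon> :: real assume \<epsilon>: "\<epsilon> > 0"
  \<comment> \<open>Raising \<open>B\<close> to at least 1 makes the division in \<open>e\<close>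
    legitimate when \<open>B\<close> is zero or negative.\<close>
  define B' where "B' = max B 1"
  define e where "e = \<epsilon> / (2 * B')"
  have B': "B' > 0" "B \<le> B'" by (auto simp: B'_def)
  have e: "e > 0" using \<epsilon> B' by (auto simp: e_def)
  obtain \<delta>1 where 1: "\<delta>1 > 0" "\<And>(N::nat) c d. (\<forall>k<N. a \<le> c k \<and> c k \<le> d k \<and> d k \<le> b) \<and>
       disjoint_family_on (\<lambda>k. {c k<..<d k}) {..<N} \<and> (\<Sum>k<N. d k - c k) < \<delta>1 \<Longrightarrow>
       (\<Sum>k<N. cmod (f (d k) - f (c k))) < e"
    by (rule abs_continuous_onE[OF f e]) (rule that)
  obtain \<delta>2 where 2: "\<delta>2 > 0" "\<And>(N::nat) c d. (\<forall>k<N. a \<le> c k \<and> c k \<le> d k \<and> d k \<le> b) \<and>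
       disjoint_family_on (\<lambda>k. {c k<..<d k}) {..<N} \<and> (\<Sum>k<N. d k - c k) < \<delta>2 \<Longrightarrow>
       (\<Sum>k<N. cmod (g (d k) - g (c k))) < e"
    by (rule abs_continuous_onE[OF g e]) (rule that)
  show "\<exists>\<delta>>0. \<forall>(N::nat) c d. (\<forall>k<N. a' \<le> c k \<and> c k \<le> d k \<and> d k \<le> b') \<and>
       disjoint_family_on (\<lambda>k. {c k<..<d k}) {..<N} \<and> (\<Sum>k<N. d k - c k) < \<delta> \<longrightarrow>
       (\<Sum>k<N. cmod (h (d k) - h (c k))) < \<epsilon>"
  proof (intro exI[of _ "min \<delta>1 \<delta>2"] conjI allI impI)
    fix N :: nat and c d
    assume A: "(\<forall>k<N. a' \<le> c k \<and> c k \<le> d k \<and> d k \<le> b') \<and>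
       disjoint_family_on (\<lambda>k. {c k<..<d k}) {..<N} \<and> (\<Sum>k<N. d k - c k) < min \<delta>1 \<delta>2"
    have cd: "a' \<le> c k" "c k \<le> d k" "d k \<le> b'" "a \<le> c k" "d k \<le> b" if "k < N" for k
    proof -
      show *: "a' \<le> c k" "c k \<le> d k" "d k \<le> b'" using A that by auto
      show "a \<le> c k" "d k \<le> b" using * sub by auto
    qed
    have "(\<Sum>k<N. cmod (h (d k) - h (c k))) \<le>
        (\<Sum>k<N. B' * (cmod (f (d k) - f (c k)) + cmod (g (d k) - g (c k))))"
    proof (rule sum_mono)
      fix k assume "k \<in> {..<N}"
      then have "cmod (h (d k) - h (c k)) \<le> B * (cmod (f (d k) - f (c k)) + cmod (g (d k) - g (c k)))"
        using cd by (intro h) auto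
      also have "\<dots> \<le> B' * (cmod (f (d k) - f (c k)) + cmod (g (d k) - g (c k)))"
        using B' by (intro mult_right_mono) auto
      finally show "cmod (h (d k) - h (c k)) \<le> \<dots>" .
    qed
    also have "\<dots> = B' * ((\<Sum>k<N. cmod (f (d k) - f (c k))) + (\<Sum>k<N. cmod (g (d k) - g (c k))))"
      by (simp only: sum.distrib flip: sum_distrib_left)
    also have "\<dots> < B' * (e + e)"
      using A B' cd 1(2)[of N c d] 2(2)[of N c d] by (intro mult_strict_left_mono add_strict_mono) auto
    also have "\<dots> = \<epsilon>" using B' by (simp add: e_def)
    finally show "(\<Sum>k<N. cmod (h (d k) - h (c k))) < \<epsilon>" .
  qed (use 1 2 in auto)
qed

lemma abs_continuous_on_add:
  assumes f: "abs_continuous_on a b f" and g: "abs_continuous_on a b g"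
  shows "abs_continuous_on a b (\<lambda>x. f x + g x)"
  by (rule abs_continuous_on_dominated[OF f g order_refl order_refl, where B = 1])
    (simp add: norm_diff_triangle_ineq)

lemma abs_continuous_on_cong_subset:
  assumes f: "abs_continuous_on a b f" and "a \<le> a'" "b' \<le> b"
    and fg: "\<And>x. a' \<le> x \<Longrightarrow> x \<le> b' \<Longrightarrow> f x = g x"
  shows "abs_continuous_on a' b' g"
  by (rule abs_continuous_on_dominated[OF f f assms(2,3), where B = 1]) (simp flip: fg)

lemma abs_continuous_on_mult:
  assumes f: "abs_continuous_on a b f" and g: "abs_continuous_on a b g"
  shows "abs_continuous_on a b (\<lambda>x. f x * g x)"
proof -
  have "bounded (f ` {a..b})" "bounded (g ` {a..b})"
    using f g by (auto intro!: compact_imp_bounded compact_continuous_image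
        abs_continuous_on_imp_continuous_on)
  then obtain B1 B2 where B: "\<forall>x\<in>{a..b}. cmod (f x) \<le> B1" "\<forall>x\<in>{a..b}. cmod (g x) \<le> B2"
    unfolding bounded_iff by auto
  show ?thesis
  proof (rule abs_continuous_on_dominated[OF f g order_refl order_refl, where B = "max B1 B2"])
    fix x y assume xy: "a \<le> x" "x \<le> y" "y \<le> b"
    have eq: "f y * g y - f x * g x = (f y - f x) * g x + f y * (g y - g x)"
      by (simp add: algebra_simps)
    have "cmod (g x) \<le> max B1 B2" "cmod (f y) \<le> max B1 B2"
      using B xy by (auto simp: le_max_iff_disj)
    then show "cmod (f y * g y - f x * g x) \<le> max B1 B2 * (cmod (f y - f x) + cmod (g y - g x))"
      unfolding eq distrib_left
      by (intro order_trans[OF norm_triangle_ineq] add_mono)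
        (auto simp: norm_mult mult.commute intro: mult_right_mono)
  qed
qed

section \<open>Integrals of integrable functions: approximation, absolute continuity,
  differentiation\<close>

lemma sum_integral_disjoint_le:
  fixes g :: "real \<Rightarrow> real"
  assumes g: "g integrable_on {a..b}" "\<And>x. x \<in> {a..b} \<Longrightarrow> 0 \<le> g x"
    and I: "finite I" "\<And>i. i \<in> I \<Longrightarrow> a \<le> c i \<and> c i \<le> d i \<and> d i \<le> b"
       "disjoint_family_on (\<lambda>i. {c i<..<d i}) I"
  shows "(\<Sum>i\<in>I. integral {c i..d i} g) \<le> integral {a..b} g"
proof -
  have int: "g integrable_on {c i<..<d i}" if "i \<in> I" for i
    using integrable_subinterval_real[OF g(1), of "c i" "d i"] I(2)[OF that]
    by (simp add: integrable_on_Icc_iff_Ioo)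
  have "(\<Sum>i\<in>I. integral {c i..d i} g) = (\<Sum>i\<in>I. integral {c i<..<d i} g)"
    by (intro sum.cong refl) (simp add: integral_open_interval_real)
  also have "\<dots> = integral (\<Union>i\<in>I. {c i<..<d i}) g"
  proof (rule integral_unique[symmetric, OF has_integral_UN])
    show "pairwise (\<lambda>i i'. negligible ({c i<..<d i} \<inter> {c i'<..<d i'})) I"
      using I(3) by (auto simp: pairwise_def disjoint_family_on_def)
  qed (use I int in \<open>auto intro: integrable_integral\<close>)
  also have "\<dots> \<le> integral {a..b} g"
  proof (rule integral_subset_le)
    show "(\<Union>i\<in>I. {c i<..<d i}) \<subseteq> {a..b}"
      using I(2) by fastforce
    show "g integrable_on (\<Union>i\<in>I. {c i<..<d i})"
      using int I(1,3)
      by (intro has_integral_integrable[OF has_integral_UN])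
        (auto simp: pairwise_def disjoint_family_on_def intro: integrable_integral)
  qed (use g in auto)
  finally show ?thesis .
qed

text \<open>Measurability supplies continuous functions converging almost everywhere, but with no
  common bound. Truncating the values restores one: truncation is continuous, so truncated
  approximants stay continuous and still converge. Dominated convergence then applies twice, to the
  truncation level and to the approximants.\<close>

lemma absolutely_integrable_approx_continuous:
  fixes f :: "real \<Rightarrow> complex"
  assumes f: "f absolutely_integrable_on {a..b}" and e: "e > 0"
  obtains g where "continuous_on UNIV g" "integral {a..b} (\<lambda>x. cmod (f x - g x)) < e"
proof -
  \<comment> \<open>For positive \<open>M\<close> this is the radial retraction onto the disc of
    radius \<open>M\<close>: it fixes the disc and never increases the modulus.\<close>
  define clip where "clip M w = w / of_real (max 1 (cmod w / M))" for M :: real and w :: complex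
  have clip_M: "cmod (clip M w) \<le> M" and clip_w: "cmod (clip M w) \<le> cmod w" if "M > 0" for M w
    using that by (auto simp: clip_def norm_divide max_def field_simps)
  have clip_id: "clip M w = w" if "M \<ge> cmod w" "M > 0" for M w
    using that by (auto simp: clip_def max_def field_simps)
  have clip_cont: "isCont (clip M) w" if "M > 0" for M w
    unfolding clip_def using that by (intro continuous_intros) (auto simp: max_def)
  have mf: "f \<in> borel_measurable (lebesgue_on {a..b})"
    using f absolutely_integrable_measurable[of "{a..b}" f] by auto
  then have "f measurable_on {a..b}"
    by (simp add: measurable_on_iff_borel_measurable)
  then obtain N h where N: "negligible N" and h: "\<And>n. continuous_on UNIV (h n)"
      "\<And>x. x \<notin> N \<Longrightarrow> (\<lambda>n. h n x) \<longlonglongrightarrow> (if x \<in> {a..b} then f x else 0)"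
    unfolding measurable_on_def by metis
  have cm: "clip M \<in> borel_measurable borel" if "M > 0" for M
    by (intro borel_measurable_continuous_onI continuous_at_imp_continuous_on ballI clip_cont that)
  have mc: "(\<lambda>x. clip M (f x)) \<in> borel_measurable (lebesgue_on {a..b})" if "M > 0" for M
    using measurable_compose[OF mf cm[OF that]] .
  have nfi: "(\<lambda>x. cmod (f x)) integrable_on {a..b}"
    using f absolutely_integrable_on_def by blast
  have ac: "(\<lambda>x. clip M (f x)) absolutely_integrable_on {a..b}" if "M > 0" for M
    using mc[OF that] nfi clip_w[OF that]
    by (intro measurable_bounded_by_integrable_imp_absolutely_integrable[where g = "\<lambda>x. cmod (f x)"]) auto
  have ac1: "(\<lambda>x. cmod (f x - clip M (f x))) integrable_on {a..b}" if "M > 0" for M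
    using set_integral_diff(1)[OF f ac[OF that]] by (simp add: absolutely_integrable_on_def)
  have "(\<lambda>M. integral {a..b} (\<lambda>x. cmod (f x - clip (real (Suc M)) (f x)))) \<longlonglongrightarrow> integral {a..b} (\<lambda>x. 0::real)"
  proof (rule dominated_convergence(2)[where h = "\<lambda>x. 2 * cmod (f x)"])
    show "norm (cmod (f x - clip (real (Suc k)) (f x))) \<le> 2 * cmod (f x)" for k x
      using norm_triangle_ineq4[of "f x" "clip (real (Suc k)) (f x)"] clip_w[of "real (Suc k)" "f x"]
      by auto
    fix x
    obtain K :: nat where "cmod (f x) \<le> real K"
      using real_arch_simple by blast
    then have "\<forall>k\<ge>K. cmod (f x - clip (real (Suc k)) (f x)) = 0"
      using clip_id[of "f x"] by force
    then show "(\<lambda>k. cmod (f x - clip (real (Suc k)) (f x))) \<longlonglongrightarrow> 0"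
      by (metis (mono_tags, lifting) eventually_sequentially tendsto_eventually)
  qed (use ac1 nfi in auto)
  then have "\<forall>\<^sub>F M in sequentially. integral {a..b} (\<lambda>x. cmod (f x - clip (real (Suc M)) (f x))) < e / 2"
    using e by (intro order_tendstoD(2)) auto
  then obtain M0 :: nat where M0: "integral {a..b} (\<lambda>x. cmod (f x - clip (real (Suc M0)) (f x))) < e / 2"
    by (auto simp: eventually_sequentially)
  define M where "M = real (Suc M0)"
  have M: "M > 0" by (simp add: M_def)
  have hc: "continuous_on UNIV (\<lambda>x. clip M (h n x))" for n
  proof (rule continuous_on_compose2[of UNIV "clip M"])
    show "continuous_on UNIV (clip M)"
      by (intro continuous_at_imp_continuous_on ballI clip_cont[OF M])
  qed (use h(1) in auto)
  have ach: "(\<lambda>x. clip M (h n x)) absolutely_integrable_on {a..b}" for n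
    by (intro absolutely_integrable_continuous_real continuous_on_subset[OF hc]) auto
  have ac2: "(\<lambda>x. cmod (clip M (f x) - clip M (h n x))) integrable_on {a..b}" for n
    using set_integral_diff(1)[OF ac[OF M] ach] by (simp add: absolutely_integrable_on_def)
  have sp: "integral ({a..b} - N) F = integral {a..b} F" for F :: "real \<Rightarrow> real"
    by (rule integral_spike_set) (auto intro: negligible_subset[OF N])
  have spi: "F integrable_on ({a..b} - N)" if "F integrable_on {a..b}" for F :: "real \<Rightarrow> real"
    by (rule integrable_spike_set[OF that]) (auto intro: negligible_subset[OF N])
  have "(\<lambda>n. integral ({a..b} - N) (\<lambda>x. cmod (clip M (f x) - clip M (h n x)))) \<longlonglongrightarrow> integral ({a..b} - N) (\<lambda>x. 0::real)"
  proof (rule dominated_convergence(2)[where h = "\<lambda>x. 2 * M"])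
    show "norm (cmod (clip M (f x) - clip M (h k x))) \<le> 2 * M" for k x
      using norm_triangle_ineq4[of "clip M (f x)" "clip M (h k x)"] clip_M[OF M, of "f x"] clip_M[OF M, of "h k x"]
      by auto
    fix x assume "x \<in> {a..b} - N"
    then have "(\<lambda>n. h n x) \<longlonglongrightarrow> f x"
      using h(2)[of x] by auto
    then have "(\<lambda>n. clip M (h n x)) \<longlonglongrightarrow> clip M (f x)"
      by (rule isCont_tendsto_compose[OF clip_cont[OF M]])
    from tendsto_diff[OF tendsto_const[of "clip M (f x)"] this]
    show "(\<lambda>k. cmod (clip M (f x) - clip M (h k x))) \<longlonglongrightarrow> 0"
      by (simp add: tendsto_norm_zero_iff)
  next
    show "(\<lambda>x. 2 * M) integrable_on {a..b} - N"
      by (rule spi[OF integrable_const_ivl])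
  qed (rule spi[OF ac2])
  then have "\<forall>\<^sub>F n in sequentially. integral {a..b} (\<lambda>x. cmod (clip M (f x) - clip M (h n x))) < e / 2"
    unfolding sp using e by (intro order_tendstoD(2)) auto
  then obtain n where n: "integral {a..b} (\<lambda>x. cmod (clip M (f x) - clip M (h n x))) < e / 2"
    by (auto simp: eventually_sequentially)
  show thesis
  proof (rule that[OF hc[of n]])
    have "integral {a..b} (\<lambda>x. cmod (f x - clip M (h n x))) \<le>
       integral {a..b} (\<lambda>x. cmod (f x - clip M (f x)) + cmod (clip M (f x) - clip M (h n x)))"
    proof (rule integral_le)
      show "(\<lambda>x. cmod (f x - clip M (h n x))) integrable_on {a..b}"
        using set_integral_diff(1)[OF f ach] by (simp add: absolutely_integrable_on_def)
      show "cmod (f x - clip M (h n x)) \<le> cmod (f x - clip M (f x)) + cmod (clip M (f x) - clip M (h n x))" for x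
        using norm_triangle_ineq[of "f x - clip M (f x)" "clip M (f x) - clip M (h n x)"] by simp
    qed (use ac1[OF M] ac2 in \<open>auto intro: integrable_add\<close>)
    also have "\<dots> = integral {a..b} (\<lambda>x. cmod (f x - clip M (f x))) + integral {a..b} (\<lambda>x. cmod (clip M (f x) - clip M (h n x)))"
      using ac1[OF M] ac2 by (intro integral_add) auto
    also have "\<dots> < e"
      using n M0 by (simp add: M_def)
    finally show "integral {a..b} (\<lambda>x. cmod (f x - clip M (h n x))) < e" .
  qed
qed

text \<open>Splitting \<open>f\<close> into a continuous part bounded by \<open>B\<close> and a part
  of integral below \<open>\<epsilon> / 2\<close> bounds the total increment by \<open>B\<close>
  times the total length plus \<open>\<epsilon> / 2\<close>, whence the threshold
  \<open>\<epsilon> / (2 * B)\<close>.\<close>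

lemma abs_continuous_on_integral:
  assumes f: "f absolutely_integrable_on {a..b}"
    and F: "\<And>x y. a \<le> x \<Longrightarrow> x \<le> y \<Longrightarrow> y \<le> b \<Longrightarrow> F y - F x = integral {x..y} f"
  shows "abs_continuous_on a b F"
  unfolding abs_continuous_on_def
proof (intro allI impI)
  fix \<epsilon> :: real assume \<epsilon>: "\<epsilon> > 0"
  obtain g where g: "continuous_on UNIV g" "integral {a..b} (\<lambda>x. cmod (f x - g x)) < \<epsilon> / 2"
    using absolutely_integrable_approx_continuous[OF f, of "\<epsilon> / 2"] \<epsilon> by auto
  have "bounded (g ` {a..b})"
    using g(1) by (intro compact_imp_bounded compact_continuous_image) (auto intro: continuous_on_subset)
  then obtain B where B: "B > 0" "\<And>x. x \<in> {a..b} \<Longrightarrow> cmod (g x) \<le> B"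
    unfolding bounded_pos by auto
  have gab: "g absolutely_integrable_on {a..b}"
    by (intro absolutely_integrable_continuous_real continuous_on_subset[OF g(1)]) auto
  have fg: "(\<lambda>x. cmod (f x - g x)) integrable_on {a..b}"
    using set_integral_diff(1)[OF f gab] by (simp add: absolutely_integrable_on_def)
  show "\<exists>\<delta>>0. \<forall>(N::nat) c d. (\<forall>k<N. a \<le> c k \<and> c k \<le> d k \<and> d k \<le> b) \<and>
       disjoint_family_on (\<lambda>k. {c k<..<d k}) {..<N} \<and> (\<Sum>k<N. d k - c k) < \<delta> \<longrightarrow>
       (\<Sum>k<N. cmod (F (d k) - F (c k))) < \<epsilon>"
  proof (intro exI[of _ "\<epsilon> / (2 * B)"] conjI allI impI)
    show "\<epsilon> / (2 * B) > 0" using \<epsilon> B by simp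
    fix N :: nat and c d
    assume A: "(\<forall>k<N. a \<le> c k \<and> c k \<le> d k \<and> d k \<le> b) \<and>
       disjoint_family_on (\<lambda>k. {c k<..<d k}) {..<N} \<and> (\<Sum>k<N. d k - c k) < \<epsilon> / (2 * B)"
    have "(\<Sum>k<N. cmod (F (d k) - F (c k))) \<le>
        (\<Sum>k<N. B * (d k - c k) + integral {c k..d k} (\<lambda>x. cmod (f x - g x)))"
    proof (rule sum_mono)
      fix k assume k: "k \<in> {..<N}"
      then have cd: "a \<le> c k" "c k \<le> d k" "d k \<le> b" using A by auto
      have sub: "h integrable_on {c k..d k}" if "h integrable_on {a..b}" for h :: "real \<Rightarrow> 'z::banach"
        using integrable_subinterval_real[OF that] cd by auto
      have "cmod (F (d k) - F (c k)) = cmod (integral {c k..d k} f)"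
        using F cd by auto
      also have "\<dots> \<le> integral {c k..d k} (\<lambda>x. B + cmod (f x - g x))"
      proof (rule integral_norm_bound_integral)
        show "f integrable_on {c k..d k}"
          using f by (intro sub) (simp add: absolutely_integrable_on_def)
        show "cmod (f x) \<le> B + cmod (f x - g x)" if "x \<in> {c k..d k}" for x
          using B(2)[of x] that cd norm_triangle_ineq[of "g x" "f x - g x"] by auto
      qed (auto intro!: sub fg integrable_add)
      also have "\<dots> = B * (d k - c k) + integral {c k..d k} (\<lambda>x. cmod (f x - g x))"
        using cd sub[OF fg] by (subst integral_add) (auto simp: content_real)
      finally show "cmod (F (d k) - F (c k)) \<le> \<dots>" .
    qed
    also have "\<dots> = B * (\<Sum>k<N. d k - c k) + (\<Sum>k<N. integral {c k..d k} (\<lambda>x. cmod (f x - g x)))"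
      by (simp add: sum.distrib sum_distrib_left)
    also have "\<dots> < B * (\<epsilon> / (2 * B)) + \<epsilon> / 2"
    proof (rule add_less_le_mono)
      show "B * (\<Sum>k<N. d k - c k) < B * (\<epsilon> / (2 * B))"
        using A B(1) by (intro mult_strict_left_mono) auto
      have "(\<Sum>k<N. integral {c k..d k} (\<lambda>x. cmod (f x - g x))) \<le> integral {a..b} (\<lambda>x. cmod (f x - g x))"
        using A fg by (intro sum_integral_disjoint_le) auto
      then show "(\<Sum>k<N. integral {c k..d k} (\<lambda>x. cmod (f x - g x))) \<le> \<epsilon> / 2"
        using g(2) by simp
    qed
    also have "\<dots> = \<epsilon>" using B by simp
    finally show "(\<Sum>k<N. cmod (F (d k) - F (c k))) < \<epsilon>" .
  qed
qed

text \<open>Lebesgue differentiation is applied in a form that yields the right-hand derivative. The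
  left-hand one is the right-hand derivative of \<open>- F (- x)\<close>, which integrates
  \<open>f (- x)\<close>; its exceptional set is reflected back.\<close>

lemma indefinite_integral_has_vector_derivative_AE:
  fixes F f :: "real \<Rightarrow> complex"
  assumes f: "\<And>a b. f integrable_on {a..b}"
    and F: "\<And>x y. x \<le> y \<Longrightarrow> F y - F x = integral {x..y} f"
  shows "AE x in lebesgue. (F has_vector_derivative f x) (at x)"
proof -
  have right: "\<exists>N. negligible N \<and> (\<forall>x e. x \<notin> N \<longrightarrow> 0 < e \<longrightarrow>
      (\<exists>d>0. \<forall>h. 0 < h \<and> h < d \<longrightarrow> cmod ((G (x + h) - G x) /\<^sub>R h - g x) < e))"
    if g: "\<And>a b. g integrable_on {a..b}"
    and G: "\<And>x y. x \<le> y \<Longrightarrow> G y - G x = integral {x..y} g" for G g :: "real \<Rightarrow> complex"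
  proof -
    have "g integrable_on cbox a b" for a b
      using g by simp
    then obtain N where N: "negligible N"
       "\<And>x e. \<lbrakk>x \<notin> N; 0 < e\<rbrakk> \<Longrightarrow>
               \<exists>d>0. \<forall>h. 0 < h \<and> h < d \<longrightarrow>
                         norm(integral (cbox x (x + h *\<^sub>R One)) g /\<^sub>R h ^ DIM(real) - g x) < e"
      by (rule integrable_ccontinuous_explicit) blast
    show ?thesis
    proof (intro exI[of _ N] conjI allI impI N(1))
      fix x e :: real assume "x \<notin> N" "0 < e"
      from N(2)[OF this] obtain d where d: "d > 0"
        "\<forall>h. 0 < h \<and> h < d \<longrightarrow> norm(integral (cbox x (x + h *\<^sub>R One)) g /\<^sub>R h ^ DIM(real) - g x) < e"
        by auto
      show "\<exists>d>0. \<forall>h. 0 < h \<and> h < d \<longrightarrow> cmod ((G (x + h) - G x) /\<^sub>R h - g x) < e"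
        using d G[of x "x + _"] by (intro exI[of _ d]) (auto simp: less_imp_le)
    qed
  qed
  obtain N1 where N1: "negligible N1" "\<And>x e. x \<notin> N1 \<Longrightarrow> 0 < e \<Longrightarrow>
      (\<exists>d>0. \<forall>h. 0 < h \<and> h < d \<longrightarrow> cmod ((F (x + h) - F x) /\<^sub>R h - f x) < e)"
    using right[OF f F] by blast
  have "\<exists>N. negligible N \<and> (\<forall>x e. x \<notin> N \<longrightarrow> 0 < e \<longrightarrow>
      (\<exists>d>0. \<forall>h. 0 < h \<and> h < d \<longrightarrow> cmod ((- F (- (x + h)) - - F (- x)) /\<^sub>R h - f (- x)) < e))"
  proof (rule right)
    show "(\<lambda>x. f (- x)) integrable_on {a..b}" for a b
      using f[of "- b" "- a"] Henstock_Kurzweil_Integration.integrable_reflect_real[where f = f and a = "- b" and b = "- a"]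
      by (simp only: minus_minus)
    show "- F (- y) - - F (- x) = integral {x..y} (\<lambda>x. f (- x))" if "x \<le> y" for x y
      using F[of "-y" "-x"] that Henstock_Kurzweil_Integration.integral_reflect_real[where f = f and a = "- y" and b = "- x"] by simp
  qed
  then obtain N2 where N2: "negligible N2" "\<And>x e. x \<notin> N2 \<Longrightarrow> 0 < e \<Longrightarrow>
      (\<exists>d>0. \<forall>h. 0 < h \<and> h < d \<longrightarrow> cmod ((- F (- (x + h)) - - F (- x)) /\<^sub>R h - f (- x)) < e)"
    by blast
  have "negligible (uminus ` N2)"
    by (rule negligible_differentiable_image_negligible[OF _ N2(1)]) (auto intro!: derivative_intros simp: differentiable_on_def)
  then have neg: "negligible (N1 \<union> uminus ` N2)"
    using N1(1) by (simp add: negligible_Un)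
  have der: "(F has_vector_derivative f x) (at x)" if x: "x \<notin> N1 \<union> uminus ` N2" for x
    unfolding has_vector_derivative_def has_derivative_at_alt
  proof (intro conjI allI impI)
    show "bounded_linear (\<lambda>y. y *\<^sub>R f x)"
      by (rule bounded_linear_scaleR_left)
    fix e :: real assume e: "e > 0"
    have x1: "x \<notin> N1" and x2: "- x \<notin> N2"
      using x by (auto simp: image_iff)
    obtain d1 where d1: "d1 > 0" "\<And>h. 0 < h \<and> h < d1 \<Longrightarrow> cmod ((F (x + h) - F x) /\<^sub>R h - f x) < e"
      using N1(2)[OF x1 e] by auto
    obtain d2 where d2: "d2 > 0" "\<And>h. 0 < h \<and> h < d2 \<Longrightarrow> cmod ((- F (- (- x + h)) - - F x) /\<^sub>R h - f x) < e"
      using N2(2)[OF x2 e] by auto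
    have "cmod (F y - F x - (y - x) *\<^sub>R f x) \<le> e * norm (y - x)" if y: "norm (y - x) < min d1 d2" for y
    proof (cases "y = x")
      case False
      then consider "y > x" | "y < x" by linarith
      then show ?thesis
      proof cases
        case 1
        have "F y - F x - (y - x) *\<^sub>R f x = (y - x) *\<^sub>R ((F (x + (y - x)) - F x) /\<^sub>R (y - x) - f x)"
          using 1 by (simp add: scaleR_right_diff_distrib)
        moreover have "cmod ((F (x + (y - x)) - F x) /\<^sub>R (y - x) - f x) < e"
          using 1 y by (intro d1(2)) auto
        ultimately show ?thesis
          using 1 by (simp add: mult.commute[of e] mult_left_mono less_imp_le)
      next
        case 2
        have "F y - F x - (y - x) *\<^sub>R f x = (x - y) *\<^sub>R (f x - (- F (- (- x + (x - y))) - - F x) /\<^sub>R (x - y))"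
        proof -
          have "- F (- (- x + (x - y))) - - F x = F x - F y" by simp
          then show ?thesis
            using 2 by (simp only: scaleR_right_diff_distrib scaleR_scaleR) (simp add: scaleR_left_diff_distrib)
        qed
        moreover have "cmod ((- F (- (- x + (x - y))) - - F x) /\<^sub>R (x - y) - f x) < e"
          using 2 y by (intro d2(2)) auto
        ultimately show ?thesis
          using 2 by (simp add: mult.commute[of e] mult_left_mono less_imp_le norm_minus_commute)
      qed
    qed auto
    then show "\<exists>d>0. \<forall>y. norm (y - x) < d \<longrightarrow> cmod (F y - F x - (y - x) *\<^sub>R f x) \<le> e * norm (y - x)"
      using d1(1) d2(1) by (intro exI[of _ "min d1 d2"]) auto
  qed
  show ?thesis
    by (rule AE_I'[of "N1 \<union> uminus ` N2"]) (use neg der in \<open>auto simp: negligible_iff_null_sets\<close>)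
qed

text \<open>The gauge is built directly. At tags where the derivative exists, each term is small
  relative to its length; intervals tagged in the null set \<open>E\<close> lie in an open set of
  small measure, so absolute continuity makes their increments small in total.\<close>

theorem fundamental_theorem_abs_continuous:
  assumes ab: "a \<le> b" and F: "abs_continuous_on a b F"
    and der: "AE x in lebesgue. (F has_vector_derivative v x) (at x)"
  shows "(v has_integral (F b - F a)) {a..b}"
proof -
  define E where "E = {x. \<not> (F has_vector_derivative v x) (at x)}"
  \<comment> \<open>A zero integrand on the null set \<open>E\<close> removes those tags from the
    Riemann sum without changing the integral.\<close>
  define v' where "v' x = (if x \<in> E then 0 else v x)" for x
  have E: "negligible E"
    using der by (simp add: E_def eventually_ae_filter_negligible) (metis (mono_tags, lifting) Collect_mono_iff negligible_subset mem_Collect_eq subsetI)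
  have "(v' has_integral (F b - F a)) (cbox a b)"
    unfolding has_integral_factor_content
  proof (intro allI impI)
    fix e :: real assume e: "e > 0"
    show "\<exists>\<gamma>. gauge \<gamma> \<and> (\<forall>p. p tagged_division_of cbox a b \<and> \<gamma> fine p \<longrightarrow>
       norm ((\<Sum>(x, k)\<in>p. measure lborel k *\<^sub>R v' x) - (F b - F a)) \<le> e * measure lborel (cbox a b))"
    proof (cases "a = b")
      case True
      then show ?thesis
        by (intro exI[of _ "\<lambda>x. ball x 1"]) (auto intro!: gauge_ball sum_content_null[where a = b and b = b])
    next
      case False
      then have "a < b" using ab by simp
      \<comment> \<open>The error budget \<open>e * (b - a)\<close> is shared equally between the
        tags outside \<open>E\<close> and those inside.\<close>
      define \<epsilon> where "\<epsilon> = e / 2 * (b - a)"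
      have \<epsilon>: "\<epsilon> > 0" using e \<open>a < b\<close> by (simp add: \<epsilon>_def)
      obtain \<delta> where \<delta>: "\<delta> > 0" "\<And>I c d. finite I \<Longrightarrow> (\<And>i::real \<times> real set. i \<in> I \<Longrightarrow> a \<le> c i \<and> c i \<le> d i \<and> d i \<le> b) \<Longrightarrow>
       disjoint_family_on (\<lambda>i. {c i<..<d i}) I \<Longrightarrow> (\<Sum>i\<in>I. d i - c i) < \<delta> \<Longrightarrow>
       (\<Sum>i\<in>I. cmod (F (d i) - F (c i))) < \<epsilon>"
        by (rule abs_continuous_on_finite[OF F \<epsilon>]) (rule that, assumption, blast)
      obtain T where T: "open T" "E \<subseteq> T" "T - E \<in> lmeasurable" "emeasure lebesgue (T - E) < ennreal \<delta>"
        using sets_lebesgue_outer_open[of E \<delta>] E \<delta>(1) by (auto simp: negligible_iff_null_sets)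
      have Tl: "T \<in> lmeasurable" and Tm: "measure lebesgue T < \<delta>"
      proof -
        have "emeasure lebesgue T = emeasure lebesgue (T - E)"
          using T E by (intro emeasure_Diff_null_set[symmetric]) (auto simp: negligible_iff_null_sets)
        then have em: "emeasure lebesgue T < ennreal \<delta>" using T(4) by simp
        then show "T \<in> lmeasurable"
          using T(1) by (intro fmeasurableI) (auto simp: less_top[symmetric] intro: order.strict_trans)
        then show "measure lebesgue T < \<delta>"
          using em by (simp add: emeasure_eq_measure2 ennreal_less_iff)
      qed
      have "\<forall>x. \<exists>d>0. x \<in> E \<and> ball x d \<subseteq> T \<or> x \<notin> E \<and>
          (\<forall>y. norm (y - x) < d \<longrightarrow> norm (F y - F x - (y - x) *\<^sub>R v x) \<le> (e/2) * norm (y - x))"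
      proof
        fix x show "\<exists>d>0. x \<in> E \<and> ball x d \<subseteq> T \<or> x \<notin> E \<and>
          (\<forall>y. norm (y - x) < d \<longrightarrow> norm (F y - F x - (y - x) *\<^sub>R v x) \<le> (e/2) * norm (y - x))"
        proof (cases "x \<in> E")
          case True
          then show ?thesis using T(1,2) open_contains_ball by blast
        next
          case False
          then have "(F has_vector_derivative v x) (at x)" by (simp add: E_def)
          then show ?thesis
            using False e half_gt_zero[OF e] unfolding has_vector_derivative_def has_derivative_at_alt by blast
        qed
      qed
      then obtain d where d0: "\<And>x. d x > 0" and d: "\<And>x. x \<in> E \<and> ball x (d x) \<subseteq> T \<or> x \<notin> E \<and>
          (\<forall>y. norm (y - x) < d x \<longrightarrow> norm (F y - F x - (y - x) *\<^sub>R v x) \<le> (e/2) * norm (y - x))"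
        by metis
      show ?thesis
      proof (intro exI[of _ "\<lambda>x. ball x (d x)"] conjI allI impI)
        show "gauge (\<lambda>x. ball x (d x))"
          using d0 gauge_ball_dependent by blast
        fix p assume p: "p tagged_division_of cbox a b \<and> (\<lambda>x. ball x (d x)) fine p"
        have fin: "finite p" using p by blast
        have K: "\<exists>u w. K = {u..w} \<and> a \<le> u \<and> u \<le> x \<and> x \<le> w \<and> w \<le> b \<and> {u..w} \<subseteq> ball x (d x)
            \<and> Inf K = u \<and> Sup K = w \<and> measure lborel K = w - u" if xK: "(x, K) \<in> p" for x K
        proof -
          obtain u w where uw: "K = cbox u w" using p xK by blast
          have x: "x \<in> K" and s: "K \<subseteq> cbox a b" "K \<subseteq> ball x (d x)"
            using p xK by (auto simp: fine_def)
          have "u \<le> x" "x \<le> w" "a \<le> u" "w \<le> b" using x s uw by auto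
          then show ?thesis using uw s by (intro exI[of _ u] exI[of _ w]) auto
        qed
        have K': "a \<le> Inf (snd i)" "Inf (snd i) \<le> Sup (snd i)" "Sup (snd i) \<le> b"
            "interior (snd i) = {Inf (snd i)<..<Sup (snd i)}"
            "{Inf (snd i)<..<Sup (snd i)} \<subseteq> ball (fst i) (d (fst i))" if ip: "i \<in> p" for i
        proof -
          obtain u w where uw: "snd i = {u..w}" "a \<le> u" "u \<le> w" "w \<le> b" "{u..w} \<subseteq> ball (fst i) (d (fst i))"
            "Inf (snd i) = u" "Sup (snd i) = w"
          proof -
            from ip have "(fst i, snd i) \<in> p" by simp
            from K[OF this] obtain u w where "snd i = {u..w}" "a \<le> u" "u \<le> fst i" "fst i \<le> w" "w \<le> b"
              "{u..w} \<subseteq> ball (fst i) (d (fst i))" "Inf (snd i) = u" "Sup (snd i) = w" by blast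
            then show thesis by (intro that) auto
          qed
          have "{u<..<w} \<subseteq> {u..w}" by auto
          then have "{u<..<w} \<subseteq> ball (fst i) (d (fst i))" using uw(5) by (rule subset_trans)
          then show "a \<le> Inf (snd i)" "Inf (snd i) \<le> Sup (snd i)" "Sup (snd i) \<le> b"
            "interior (snd i) = {Inf (snd i)<..<Sup (snd i)}"
            "{Inf (snd i)<..<Sup (snd i)} \<subseteq> ball (fst i) (d (fst i))"
            unfolding uw(6,7) by (simp_all add: uw(1-4))
        qed
        have Fsum: "F b - F a = (\<Sum>(x,K)\<in>p. F (Sup K) - F (Inf K))"
          and ba: "b - a = (\<Sum>(x,K)\<in>p. Sup K - Inf K)"
          using additive_tagged_division_1[of a b p F] additive_tagged_division_1[of a b p "\<lambda>x. x"] ab p by auto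
        have "(\<Sum>(x, k)\<in>p. measure lborel k *\<^sub>R v' x) - (F b - F a) =
            (\<Sum>(x, K)\<in>p. measure lborel K *\<^sub>R v' x - (F (Sup K) - F (Inf K)))"
          unfolding Fsum by (simp add: case_prod_unfold sum_subtractf)
        also have "norm \<dots> \<le> (\<Sum>i\<in>p. norm (case i of (x, K) \<Rightarrow> measure lborel K *\<^sub>R v' x - (F (Sup K) - F (Inf K))))"
          by (rule norm_sum)
        also have "\<dots> = (\<Sum>i\<in>p. case i of (x, K) \<Rightarrow> norm (measure lborel K *\<^sub>R v' x - (F (Sup K) - F (Inf K))))"
          by (intro sum.cong) auto
        also have "\<dots> \<le> (\<Sum>i\<in>p. (case i of (x, K) \<Rightarrow> (e/2) * (Sup K - Inf K)) +
            (if fst i \<in> E then cmod (F (Sup (snd i)) - F (Inf (snd i))) else 0))"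
        proof (rule sum_mono)
          fix i assume i: "i \<in> p"
          obtain x K where xK: "i = (x, K)" by (cases i)
          obtain u w where uw: "K = {u..w}" "a \<le> u" "u \<le> x" "x \<le> w" "w \<le> b" "{u..w} \<subseteq> ball x (d x)"
            "Inf K = u" "Sup K = w" "measure lborel K = w - u"
            using K[of x K] i xK by blast
          show "(case i of (x, K) \<Rightarrow> norm (measure lborel K *\<^sub>R v' x - (F (Sup K) - F (Inf K)))) \<le>
             (case i of (x, K) \<Rightarrow> (e/2) * (Sup K - Inf K)) +
            (if fst i \<in> E then cmod (F (Sup (snd i)) - F (Inf (snd i))) else 0)"
          proof (cases "x \<in> E")
            case True
            then show ?thesis
              using uw e by (simp add: xK v'_def norm_minus_commute)
          next
            case False
            \<comment> \<open>Straddle estimate: the tag lies between the endpoints, so the linear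
              errors at \<open>u\<close> and \<open>w\<close> add up to at most \<open>e / 2\<close>
              times the length \<open>w - u\<close>.\<close>
            have "norm (u - x) < d x" "norm (w - x) < d x"
              using uw(3,4) subsetD[OF uw(6), of u] subsetD[OF uw(6), of w] by (auto simp: dist_real_def)
            then have "norm (F u - F x - (u - x) *\<^sub>R v x) \<le> (e/2) * norm (u - x)"
              "norm (F w - F x - (w - x) *\<^sub>R v x) \<le> (e/2) * norm (w - x)"
              using d[of x] False by auto
            moreover have "(w - u) *\<^sub>R v x - (F w - F u) =
                (F u - F x - (u - x) *\<^sub>R v x) - (F w - F x - (w - x) *\<^sub>R v x)"
              by (simp add: algebra_simps)
            moreover have "(e/2) * norm (u - x) + (e/2) * norm (w - x) = (e/2) * (w - u)"
              using uw(3,4) by (simp add: algebra_simps flip: add_divide_distrib)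
            ultimately have "norm ((w - u) *\<^sub>R v x - (F w - F u)) \<le> (e/2) * (w - u)"
              by (smt (verit) norm_triangle_ineq4)
            then show ?thesis
              using uw False by (simp add: xK v'_def)
          qed
        qed
        also have "\<dots> = (e/2) * (b - a) + (\<Sum>i\<in>p. if fst i \<in> E then cmod (F (Sup (snd i)) - F (Inf (snd i))) else 0)"
          unfolding ba by (simp add: sum.distrib sum_distrib_left case_prod_unfold)
        also have "(\<Sum>i\<in>p. if fst i \<in> E then cmod (F (Sup (snd i)) - F (Inf (snd i))) else 0) =
          (\<Sum>i\<in>{i\<in>p. fst i \<in> E}. cmod (F (Sup (snd i)) - F (Inf (snd i))))"
          using fin by (simp add: sum.inter_filter)
        also have "\<dots> < \<epsilon>"
        proof (rule \<delta>(2))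
          show fin': "finite {i\<in>p. fst i \<in> E}" using fin by simp
          show "a \<le> Inf (snd i) \<and> Inf (snd i) \<le> Sup (snd i) \<and> Sup (snd i) \<le> b" if "i \<in> {i\<in>p. fst i \<in> E}" for i
            using K'[of i] that by simp
          show dis: "disjoint_family_on (\<lambda>i. {Inf (snd i)<..<Sup (snd i)}) {i\<in>p. fst i \<in> E}"
            unfolding disjoint_family_on_def
          proof (intro ballI impI)
            fix i j assume ij: "i \<in> {i\<in>p. fst i \<in> E}" "j \<in> {i\<in>p. fst i \<in> E}" "i \<noteq> j"
            then have "interior (snd i) \<inter> interior (snd j) = {}"
              using p tagged_division_ofD(5)[of p "cbox a b" "fst i" "snd i" "fst j" "snd j"]
              by (auto simp: prod_eq_iff)
            moreover have "interior (snd i) = {Inf (snd i)<..<Sup (snd i)}" "interior (snd j) = {Inf (snd j)<..<Sup (snd j)}"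
              using K'(4)[of i] K'(4)[of j] ij by simp_all
            ultimately show "{Inf (snd i)<..<Sup (snd i)} \<inter> {Inf (snd j)<..<Sup (snd j)} = {}" by simp
          qed
          have "(\<Sum>i\<in>{i\<in>p. fst i \<in> E}. Sup (snd i) - Inf (snd i)) =
              (\<Sum>i\<in>{i\<in>p. fst i \<in> E}. measure lebesgue {Inf (snd i)<..<Sup (snd i)})"
            by (intro sum.cong refl) (use K'(2) in simp)
          also have "\<dots> = measure lebesgue (\<Union>i\<in>{i\<in>p. fst i \<in> E}. {Inf (snd i)<..<Sup (snd i)})"
            by (rule measure_finite_Union[symmetric, OF fin' _ dis]) (auto simp: image_subset_iff dest!: K'(2))
          also have "\<dots> \<le> measure lebesgue T"
          proof (rule measure_mono_fmeasurable[OF _ _ Tl])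
            show "(\<Union>i\<in>{i\<in>p. fst i \<in> E}. {Inf (snd i)<..<Sup (snd i)}) \<subseteq> T"
            proof (rule UN_least)
              fix i assume i: "i \<in> {i\<in>p. fst i \<in> E}"
              then have "ball (fst i) (d (fst i)) \<subseteq> T" using d[of "fst i"] by auto
              then show "{Inf (snd i)<..<Sup (snd i)} \<subseteq> T"
                using K'(5)[of i] i by (auto intro: subset_trans)
            qed
          next
            show "(\<Union>i\<in>{i\<in>p. fst i \<in> E}. {Inf (snd i)<..<Sup (snd i)}) \<in> sets lebesgue"
              using fin' by (intro sets.finite_UN) auto
          qed
          finally show "(\<Sum>i\<in>{i\<in>p. fst i \<in> E}. Sup (snd i) - Inf (snd i)) < \<delta>" using Tm by simp
        qed
        finally show "norm ((\<Sum>(x, k)\<in>p. measure lborel k *\<^sub>R v' x) - (F b - F a)) \<le> e * measure lborel (cbox a b)"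
          using ab by (simp add: \<epsilon>_def field_simps)
      qed
    qed
  qed
  then show ?thesis
    using has_integral_spike_eq[OF E, of "{a..b}" v v'] by (auto simp: v'_def)
qed

section \<open>Primitives of integrable functions on the unit interval\<close>

lemma primitive_diff:
  assumes f: "\<And>a b. f integrable_on {a..b}" and xy: "x \<le> y"
  shows "primitive f y - primitive f x = integral {x..y} f"
proof -
  have c: "integral {a..b} f + integral {b..c} f = integral {a..c} f" if "a \<le> b" "b \<le> c" for a b c
    using Henstock_Kurzweil_Integration.integral_combine[OF that f] .
  show ?thesis
  proof (cases "0 \<le> x")
    case True
    then show ?thesis using c[of 0 x y] xy by (simp add: primitive_def algebra_simps)
  next
    case False
    show ?thesis
    proof (cases "0 \<le> y")
      case True
      then show ?thesis using c[of x 0 y] False by (simp add: primitive_def algebra_simps)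
    next
      case F: False
      then show ?thesis using c[of x y 0] xy False by (simp add: primitive_def algebra_simps)
    qed
  qed
qed

definition L1 :: "(real \<Rightarrow> complex) \<Rightarrow> bool" where
  "L1 f \<longleftrightarrow> f absolutely_integrable_on {0..1}"

definition norm1 :: "(real \<Rightarrow> complex) \<Rightarrow> real" where
  "norm1 f = integral {0..1} (\<lambda>x. cmod (f x))"

definition mean :: "(real \<Rightarrow> complex) \<Rightarrow> complex" where
  "mean f = integral {0..1} f"

text \<open>This says that \<open>F\<close> is absolutely continuous with derivative
  \<open>f\<close>, through its integrals because \<open>q\<close> is only integrable. The value
  \<open>F 0\<close> is free, and nothing is asserted outside \<open>{0..1}\<close>.\<close>

definition prim :: "(real \<Rightarrow> complex) \<Rightarrow> (real \<Rightarrow> complex) \<Rightarrow> bool" where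
  "prim f F \<longleftrightarrow> L1 f \<and> (\<forall>x\<in>{0..1}. integral {0..x} f = F x - F 0)"

lemma L1_integrable: "L1 f \<Longrightarrow> f integrable_on {0..1}"
  unfolding L1_def absolutely_integrable_on_def by blast

lemma L1_norm_integrable: "L1 f \<Longrightarrow> (\<lambda>x. cmod (f x)) integrable_on {0..1}"
  unfolding L1_def absolutely_integrable_on_def by blast

lemma L1_subinterval: "L1 f \<Longrightarrow> {a..b} \<subseteq> {0..1} \<Longrightarrow> f integrable_on {a..b}"
  using L1_integrable integrable_subinterval_real by blast

lemma L1_I: "f integrable_on {0..1} \<Longrightarrow> (\<lambda>x. cmod (f x)) integrable_on {0..1} \<Longrightarrow> L1 f"
  unfolding L1_def absolutely_integrable_on_def by blast

lemma L1_cong: "(\<And>x. x \<in> {0..1} \<Longrightarrow> f x = g x) \<Longrightarrow> L1 f \<longleftrightarrow> L1 g"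
  unfolding L1_def absolutely_integrable_on_def
  by (intro arg_cong2[where f = "(\<and>)"] integrable_cong) auto

lemma L1_add: "L1 f \<Longrightarrow> L1 g \<Longrightarrow> L1 (\<lambda>x. f x + g x)"
  unfolding L1_def by (rule set_integral_add(1))

lemma L1_diff: "L1 f \<Longrightarrow> L1 g \<Longrightarrow> L1 (\<lambda>x. f x - g x)"
  unfolding L1_def by (rule set_integral_diff(1))

lemma L1_continuous: "continuous_on {0..1} f \<Longrightarrow> L1 f"
  unfolding L1_def by (rule absolutely_integrable_continuous_real)

lemma L1_mult_continuous:
  assumes f: "L1 f" and g: "continuous_on {0..1} g"
  shows "L1 (\<lambda>x. f x * g x)"
proof -
  show ?thesis
    unfolding L1_def
  proof (rule absolutely_integrable_bounded_measurable_product[where f = g and g = f and h = "\<lambda>a b. b * a"])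
    show "bilinear (\<lambda>(a::complex) b. b * a)"
      by (auto simp: bilinear_def algebra_simps intro!: linearI)
    show "g \<in> borel_measurable (lebesgue_on {0..1})"
      by (intro continuous_imp_measurable_on_sets_lebesgue g) auto
    show "bounded (g ` {0..1})"
      by (intro compact_imp_bounded compact_continuous_image g) auto
  qed (use f in \<open>auto simp: L1_def\<close>)
qed

lemma L1_continuous_mult:
  "continuous_on {0..1} g \<Longrightarrow> L1 f \<Longrightarrow> L1 (\<lambda>x. g x * f x)"
  using L1_mult_continuous[of f g] by (simp add: mult.commute)

lemma L1_cmult: "L1 f \<Longrightarrow> L1 (\<lambda>x. c * f x)"
  by (rule L1_continuous_mult) auto

lemma L1_const: "L1 (\<lambda>x. c)"
  by (rule L1_continuous) auto

lemma norm1_nonneg: "0 \<le> norm1 f"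
  \<comment> \<open>For a non-integrable modulus the integral has the default value 0.\<close>
  unfolding norm1_def by (cases "(\<lambda>x. cmod (f x)) integrable_on {0..1}")
    (auto intro: integral_nonneg simp: not_integrable_integral)

lemma norm_integral_le_norm1:
  assumes "L1 f" "{a..b} \<subseteq> {0..1}"
  shows "cmod (integral {a..b} f) \<le> norm1 f"
proof -
  have i: "(\<lambda>x. cmod (f x)) integrable_on {a..b}"
    by (rule integrable_subinterval_real[OF L1_norm_integrable[OF assms(1)] assms(2)])
  have "cmod (integral {a..b} f) \<le> integral {a..b} (\<lambda>x. cmod (f x))"
    by (rule integral_norm_bound_integral[OF L1_subinterval[OF assms] i]) auto
  also have "\<dots> \<le> norm1 f"
    unfolding norm1_def by (rule integral_subset_le[OF assms(2) i L1_norm_integrable[OF assms(1)]]) auto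
  finally show ?thesis .
qed

lemma norm_mean_le: "L1 f \<Longrightarrow> cmod (mean f) \<le> norm1 f"
  unfolding mean_def by (rule norm_integral_le_norm1) auto

lemma norm1_mult_le:
  assumes "L1 f" "continuous_on {0..1} g" "\<And>x. x \<in> {0..1} \<Longrightarrow> cmod (g x) \<le> B"
  shows "norm1 (\<lambda>x. f x * g x) \<le> B * norm1 f"
proof -
  have "norm1 (\<lambda>x. f x * g x) \<le> integral {0..1} (\<lambda>x. B * cmod (f x))"
    unfolding norm1_def
  proof (rule integral_le[OF L1_norm_integrable[OF L1_mult_continuous[OF assms(1,2)]]])
    show "(\<lambda>x. B * cmod (f x)) integrable_on {0..1}"
      using integrable_on_cmult_left[OF L1_norm_integrable[OF assms(1)], of B] by simp
    show "cmod (f x * g x) \<le> B * cmod (f x)" if "x \<in> {0..1}" for x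
      using mult_right_mono[OF assms(3)[OF that], of "cmod (f x)"] by (simp add: norm_mult mult.commute)
  qed
  then show ?thesis by (simp add: norm1_def)
qed

lemma norm1_add_le:
  assumes "L1 f" "L1 g"
  shows "norm1 (\<lambda>x. f x + g x) \<le> norm1 f + norm1 g"
proof -
  have "norm1 (\<lambda>x. f x + g x) \<le> integral {0..1} (\<lambda>x. cmod (f x) + cmod (g x))"
    unfolding norm1_def
    by (intro integral_le L1_norm_integrable L1_add integrable_add assms norm_triangle_ineq)
  also have "\<dots> = norm1 f + norm1 g"
    unfolding norm1_def by (intro integral_add L1_norm_integrable assms)
  finally show ?thesis .
qed

lemma norm1_cmult: "norm1 (\<lambda>x. c * f x) = cmod c * norm1 f"
  unfolding norm1_def norm_mult by simp

lemma norm1_const: "norm1 (\<lambda>x. c) = cmod c"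
  by (simp add: norm1_def)

lemma mean_cong: "(\<And>x. x \<in> {0..1} \<Longrightarrow> f x = g x) \<Longrightarrow> mean f = mean g"
  unfolding mean_def by (rule integral_cong) auto

lemma mean_add: "L1 f \<Longrightarrow> L1 g \<Longrightarrow> mean (\<lambda>x. f x + g x) = mean f + mean g"
  unfolding mean_def by (intro integral_add L1_integrable)

lemma mean_diff: "L1 f \<Longrightarrow> L1 g \<Longrightarrow> mean (\<lambda>x. f x - g x) = mean f - mean g"
  unfolding mean_def by (intro integral_diff L1_integrable)

lemma mean_cmult: "mean (\<lambda>x. c * f x) = c * mean f"
  unfolding mean_def by simp

lemma mean_const: "mean (\<lambda>x. c) = c"
  by (simp add: mean_def)

lemma prim_L1: "prim f F \<Longrightarrow> L1 f"
  by (simp add: prim_def)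

lemma prim_1: "prim f F \<Longrightarrow> F 1 = F 0 + mean f"
  by (simp add: prim_def mean_def)

lemma prim_cong:
  assumes "prim f F" "\<And>x. x \<in> {0..1} \<Longrightarrow> f x = g x" "\<And>x. x \<in> {0..1} \<Longrightarrow> F x = G x"
  shows "prim g G"
proof -
  have "integral {0..x} f = integral {0..x} g" if "x \<in> {0..1}" for x
    using that assms(2) by (intro integral_cong) auto
  then show ?thesis
    using assms L1_cong[of f g] by (auto simp: prim_def)
qed

lemma prim_continuous_on: "prim f F \<Longrightarrow> continuous_on {0..1} F"
  using continuous_on_add[OF continuous_on_const[of "{0..1}" "F 0"] indefinite_integral_continuous_1[OF L1_integrable[of f]]]
  by (subst continuous_on_cong[OF refl, of _ _ "\<lambda>x. F 0 + integral {0..x} f"]) (auto simp: prim_def)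

lemma prim_add: "prim f F \<Longrightarrow> prim g G \<Longrightarrow> prim (\<lambda>x. f x + g x) (\<lambda>x. F x + G x)"
  by (auto simp: prim_def L1_add integral_add L1_subinterval)

lemma prim_diff: "prim f F \<Longrightarrow> prim g G \<Longrightarrow> prim (\<lambda>x. f x - g x) (\<lambda>x. F x - G x)"
  by (auto simp: prim_def L1_diff integral_diff L1_subinterval)

lemma prim_cmult: "prim f F \<Longrightarrow> prim (\<lambda>x. c * f x) (\<lambda>x. c * F x)"
  by (auto simp: prim_def L1_cmult right_diff_distrib)

lemma prim_const: "prim (\<lambda>x. 0) (\<lambda>x. c)"
  by (auto simp: prim_def L1_const)

lemma prim_integral: "L1 f \<Longrightarrow> prim f (\<lambda>x. c + integral {0..x} f)"
  by (auto simp: prim_def)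

lemma prim_vector_derivative:
  assumes "\<And>x. x \<in> {0..1} \<Longrightarrow> (F has_vector_derivative f x) (at x within {0..1})" "continuous_on {0..1} f"
  shows "prim f F"
  unfolding prim_def
proof (intro conjI ballI L1_continuous assms(2))
  fix x :: real assume x: "x \<in> {0..1}"
  have "(f has_integral F x - F 0) {0..x}"
    using x by (intro fundamental_theorem_of_calculus has_vector_derivative_within_subset[OF assms(1)]) auto
  then show "integral {0..x} f = F x - F 0" by (simp add: integral_unique)
qed

lemma prim_integral_diff:
  assumes "prim f F" "0 \<le> x" "x \<le> y" "y \<le> 1"
  shows "F y - F x = integral {x..y} f"
proof -
  have "integral {0..x} f + integral {x..y} f = integral {0..y} f"
    using assms by (intro Henstock_Kurzweil_Integration.integral_combine L1_subinterval prim_L1[OF assms(1)]) auto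
  moreover have "integral {0..x} f = F x - F 0" "integral {0..y} f = F y - F 0"
    using assms by (simp_all add: prim_def)
  ultimately show ?thesis by (simp add: algebra_simps)
qed

lemma prim_abs_continuous_on: "prim f F \<Longrightarrow> abs_continuous_on 0 1 F"
  by (rule abs_continuous_on_integral[where f = f]) (auto simp: prim_integral_diff L1_def dest: prim_L1)

text \<open>The endpoints are left out because \<open>F\<close> is unconstrained outside
  \<open>{0..1}\<close>, so a two-sided derivative there may fail to exist.\<close>

lemma prim_has_derivative_AE:
  assumes "prim f F"
  shows "AE x in lebesgue. x \<in> {0<..<1} \<longrightarrow> (F has_vector_derivative f x) (at x)"
proof -
  define f' where "f' x = (if x \<in> {0..1} then f x else 0)" for x
  have f': "f' integrable_on {a..b}" for a b
  proof -
    have "f' integrable_on UNIV"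
      unfolding f'_def integrable_restrict_UNIV by (rule L1_integrable[OF prim_L1[OF assms]])
    then show ?thesis by (rule integrable_on_subinterval) auto
  qed
  have "AE x in lebesgue. (primitive f' has_vector_derivative f' x) (at x)"
    by (rule indefinite_integral_has_vector_derivative_AE[OF f' primitive_diff[OF f']])
  then show ?thesis
  proof (rule AE_mp, intro AE_I2 impI)
    fix x assume d: "(primitive f' has_vector_derivative f' x) (at x)" and x: "x \<in> {0<..<1::real}"
    have F: "F y = F 0 + primitive f' y" if "y \<in> {0<..<1}" for y
    proof -
      have "integral {0..y} f = integral {0..y} f'"
        using that by (intro integral_cong) (auto simp: f'_def)
      then have "F y - F 0 = primitive f' y" using assms that by (auto simp: prim_def primitive_def)
      then show ?thesis by (metis add.commute diff_add_cancel)
    qed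
    have "((\<lambda>y. F 0 + primitive f' y) has_vector_derivative f' x) (at x)"
      using has_vector_derivative_add[OF has_vector_derivative_const d, of "F 0"] by simp
    then have "(F has_vector_derivative f' x) (at x)"
      by (rule has_vector_derivative_transform_within_open[where S = "{0<..<1}"]) (use x F in auto)
    then show "(F has_vector_derivative f x) (at x)"
      using x by (simp add: f'_def)
  qed
qed

text \<open>Absolute continuity replaces differentiability everywhere in the product rule.\<close>

lemma prim_mult:
  assumes F: "prim f F" and G: "prim g G"
  shows "prim (\<lambda>x. f x * G x + F x * g x) (\<lambda>x. F x * G x)"
  unfolding prim_def
proof (intro conjI ballI)
  show "L1 (\<lambda>x. f x * G x + F x * g x)"
    by (intro L1_add L1_mult_continuous L1_continuous_mult prim_continuous_on[OF F]
        prim_continuous_on[OF G] prim_L1[OF F] prim_L1[OF G])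
  fix x :: real assume x: "x \<in> {0..1}"
  define v where "v x = (if x \<in> {0<..<1} then f x * G x + F x * g x else 0)" for x
  \<comment> \<open>Freezing the product at its endpoint values outside \<open>{0..1}\<close> gives
    a function differentiable almost everywhere on the line, as the fundamental theorem
    requires.\<close>
  define H where "H x = F (max 0 (min 1 x)) * G (max 0 (min 1 x))" for x :: real
  have "((\<lambda>x. f x * G x + F x * g x) has_integral H x - H 0) {0..x}"
  proof -
    have "abs_continuous_on 0 1 (\<lambda>x. F x * G x)"
      by (rule abs_continuous_on_mult[OF prim_abs_continuous_on[OF F] prim_abs_continuous_on[OF G]])
    then have ac: "abs_continuous_on 0 x H"
      by (rule abs_continuous_on_cong_subset) (use x in \<open>auto simp: H_def\<close>)
    have "AE x in lebesgue. (H has_vector_derivative v x) (at x)"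
    proof -
      have "AE x in lebesgue. x \<noteq> (0::real)" "AE x in lebesgue. x \<noteq> (1::real)"
        by (auto intro!: AE_I'[of "{_}"])
      with prim_has_derivative_AE[OF F] prim_has_derivative_AE[OF G] show ?thesis
      proof eventually_elim
        case (elim x)
        consider "x < 0" | "x > 1" | "x \<in> {0<..<1}"
          using elim(3,4) by force
        then show ?case
        proof cases
          case 1
          have "((\<lambda>x. H 0) has_vector_derivative 0) (at x)" by simp
          then have "(H has_vector_derivative 0) (at x)"
            by (rule has_vector_derivative_transform_within_open[where S = "{..<0}"]) (use 1 in \<open>auto simp: H_def\<close>)
          then show ?thesis using 1 by (simp add: v_def)
        next
          case 2
          have "((\<lambda>x. H 1) has_vector_derivative 0) (at x)" by simp
          then have "(H has_vector_derivative 0) (at x)"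
            by (rule has_vector_derivative_transform_within_open[where S = "{1<..}"]) (use 2 in \<open>auto simp: H_def\<close>)
          then show ?thesis using 2 by (simp add: v_def)
        next
          case 3
          then have "((\<lambda>x. F x * G x) has_vector_derivative F x * g x + f x * G x) (at x)"
            using elim(1,2) by (intro has_vector_derivative_mult) auto
          then have "(H has_vector_derivative F x * g x + f x * G x) (at x)"
            by (rule has_vector_derivative_transform_within_open[where S = "{0<..<1}"]) (use 3 in \<open>auto simp: H_def\<close>)
          then show ?thesis using 3 by (simp add: v_def add.commute)
        qed
      qed
    qed
    from fundamental_theorem_abs_continuous[OF _ ac this] x
    have "(v has_integral H x - H 0) {0..x}" by auto
    then show ?thesis
      by (rule has_integral_spike[of "{0,1}", rotated 2]) (use x in \<open>auto simp: v_def\<close>)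
  qed
  then show "integral {0..x} (\<lambda>x. f x * G x + F x * g x) = F x * G x - F 0 * G 0"
    using x by (simp add: integral_unique H_def)
qed

section \<open>The oscillating resolvent\<close>

definition fexp :: "int \<Rightarrow> real \<Rightarrow> complex" where
  "fexp n x = cis (2 * pi * of_int n * x)"

text \<open>The multiplier by which a mean-free primitive acts on the mode
  \<open>fexp n\<close>.\<close>

definition kap :: "int \<Rightarrow> complex" where
  "kap n = 1 / (2 * pi * \<i> * of_int n)"

text \<open>The inverse of differentiation on mean-free periodic functions. Subtracting the mean of
  \<open>f\<close> makes the primitive periodic; subtracting the mean of the primitive fixes the
  constant and makes the operator skew.\<close>

definition zprim :: "(real \<Rightarrow> complex) \<Rightarrow> real \<Rightarrow> complex" where
  "zprim f x = integral {0..x} (\<lambda>t. f t - mean f) - mean (\<lambda>x. integral {0..x} (\<lambda>t. f t - mean f))"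

text \<open>By partial fractions, \<open>Tn n\<close> inverts \<open>D\<^sup>2 - 2 pi i n D\<close> up to the resonant modes \<open>1\<close> and \<open>fexp n\<close>,
  since \<open>D - 2 pi i n\<close> is \<open>D\<close> conjugated by \<open>fexp n\<close>; it is \<open>0\<close> for \<open>n = 0\<close>.\<close>

definition Tn :: "int \<Rightarrow> (real \<Rightarrow> complex) \<Rightarrow> real \<Rightarrow> complex" where
  "Tn n f x = kap n * (fexp n x * zprim (\<lambda>t. fexp (- n) t * f t) x - zprim f x)"

lemma fexp_continuous: "continuous_on A (fexp n)"
  unfolding fexp_def by (intro continuous_intros)

lemma norm_fexp [simp]: "cmod (fexp n x) = 1"
  by (simp add: fexp_def)

lemma fexp_add: "fexp n x * fexp m x = fexp (n + m) x"
  by (simp add: fexp_def cis_mult algebra_simps)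

lemma fexp_0 [simp]: "fexp 0 x = 1"
  by (simp add: fexp_def)

lemma fexp_at_0 [simp]: "fexp n 0 = 1"
  by (simp add: fexp_def)

lemma fexp_at_1 [simp]: "fexp n 1 = 1"
  using cis_multiple_2pi[of "of_int n"] by (simp add: fexp_def mult_ac)

lemma fexp_minus_mult [simp]: "fexp (- n) x * fexp n x = 1" "fexp n x * fexp (- n) x = 1"
  by (simp_all add: fexp_add)

lemma fexp_minus_cancel [simp]: "fexp (- n) x * (fexp n x * c) = c" "fexp n x * (fexp (- n) x * c) = c"
  by (simp_all flip: mult.assoc)

lemma cnj_fexp_reflect: "cnj (fexp n (1 - x)) = fexp n x"
proof -
  have "cnj (fexp n (1 - x)) = cis (- (2 * pi * of_int n * (1 - x)))"
    by (simp add: fexp_def cis_cnj)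
  also have "\<dots> = fexp (- n) 1 * fexp n x"
    by (simp add: fexp_def cis_mult algebra_simps)
  finally show ?thesis by simp
qed

lemma fexp_exp: "fexp n x = exp (\<i> * 2 * of_real pi * of_int n * of_real x)"
  by (simp add: fexp_def cis_conv_exp mult_ac)

lemma fourier_coeff_mean: "fourier_coeff f n = mean (\<lambda>x. f x * fexp (- n) x)"
  by (simp add: fourier_coeff_def mean_def fexp_exp)

lemma kap_minus: "kap (- n) = - kap n"
  by (simp add: kap_def)

lemma norm_kap: "cmod (kap n) = 1 / (2 * pi * \<bar>of_int n\<bar>)"
  by (simp add: kap_def norm_divide norm_mult)

lemma kap_nonzero: "n \<noteq> 0 \<Longrightarrow> kap n \<noteq> 0"
  by (simp add: kap_def)

lemma kap_mult_2pi: "n \<noteq> 0 \<Longrightarrow> kap n * (2 * pi * \<i> * of_int n) = 1"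
  by (simp add: kap_def)

lemma prim_fexp: "prim (\<lambda>x. 2 * pi * \<i> * of_int n * fexp n x) (fexp n)"
proof (rule prim_vector_derivative)
  fix x :: real
  have "((\<lambda>x. exp (\<i> * 2 * of_real pi * of_int n * of_real x)) has_vector_derivative
      2 * pi * \<i> * of_int n * exp (\<i> * 2 * of_real pi * of_int n * of_real x)) (at x within {0..1})"
    by (rule has_vector_derivative_real_field) (auto intro!: derivative_eq_intros)
  then show "(fexp n has_vector_derivative 2 * pi * \<i> * of_int n * fexp n x) (at x within {0..1})"
    unfolding fexp_exp[abs_def] by simp
qed (intro continuous_intros fexp_continuous)

lemma mean_fexp: "n \<noteq> 0 \<Longrightarrow> mean (fexp n) = 0"
  using prim_1[OF prim_fexp[of n]] mean_cmult[of "2 * pi * \<i> * of_int n" "fexp n"] by simp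

lemma prim_zero:
  assumes "prim f F" "\<And>x. f x = 0" "x \<in> {0..1}"
  shows "F x = F 0"
proof -
  have "integral {0..x} f = F x - F 0"
    using assms(1,3) unfolding prim_def by blast
  moreover have "f = (\<lambda>x. 0)" using assms(2) by auto
  ultimately show ?thesis by simp
qed

lemma zprim_prim: "L1 f \<Longrightarrow> prim (\<lambda>x. f x - mean f) (zprim f)"
  unfolding zprim_def[abs_def] diff_conv_add_uminus[of "integral _ _"] add.commute[of "integral _ _"]
  by (rule prim_integral) (simp add: L1_diff L1_const flip: diff_conv_add_uminus)

lemma zprim_continuous: "L1 f \<Longrightarrow> continuous_on {0..1} (zprim f)"
  by (rule prim_continuous_on[OF zprim_prim])

lemma zprim_mean: assumes "L1 f" shows "mean (zprim f) = 0"
proof -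
  have "continuous_on {0..1} (\<lambda>x. integral {0..x} (\<lambda>t. f t - mean f))"
    by (intro indefinite_integral_continuous_1 L1_integrable L1_diff L1_const assms)
  then show ?thesis
    unfolding zprim_def[abs_def] by (simp add: mean_diff L1_continuous L1_const mean_const)
qed

lemma zprim_periodic: "L1 f \<Longrightarrow> zprim f 1 = zprim f 0"
  using prim_1[OF zprim_prim, of f] by (simp add: mean_diff L1_const mean_const)

lemma zprim_cong:
  assumes "\<And>x. x \<in> {0..1} \<Longrightarrow> f x = g x" "x \<in> {0..1}"
  shows "zprim f x = zprim g x"
proof -
  have m: "mean f = mean g" by (rule mean_cong[OF assms(1)])
  have i: "integral {0..x} (\<lambda>t. f t - mean f) = integral {0..x} (\<lambda>t. g t - mean g)" if "x \<in> {0..1}" for x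
    using that assms(1) by (intro integral_cong) (auto simp: m)
  show ?thesis
    unfolding zprim_def i[OF assms(2)] using mean_cong[OF i] by simp
qed

text \<open>A characterisation by derivative and periodicity, from which linearity and the behaviour
  under reflection follow without returning to the two integrals.\<close>

lemma zprim_unique:
  assumes f: "L1 f" and F: "prim (\<lambda>x. f x - c) F" and per: "F 1 = F 0"
  shows "mean f = c" "x \<in> {0..1} \<Longrightarrow> F x = mean F + zprim f x"
proof -
  show m: "mean f = c"
    using prim_1[OF F] per f by (simp add: mean_diff L1_const mean_const)
  have "prim (\<lambda>x. (f x - mean f) - (f x - mean f)) (\<lambda>x. F x - zprim f x)"
    using F m by (intro prim_diff zprim_prim f) simp
  then have c: "F x - zprim f x = F 0 - zprim f 0" if "x \<in> {0..1}" for x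
    by (rule prim_zero[OF _ _ that]) simp
  have "mean (\<lambda>x. F x - zprim f x) = F 0 - zprim f 0"
    using mean_cong[OF c] by (simp add: mean_const)
  moreover have "mean (\<lambda>x. F x - zprim f x) = mean F"
    using prim_continuous_on[OF F] zprim_continuous[OF f] by (simp add: mean_diff L1_continuous zprim_mean f)
  ultimately show "F x = mean F + zprim f x" if "x \<in> {0..1}"
    using c[OF that] by (metis diff_add_cancel)
qed

text \<open>Bounding by partial integrals rather than by \<open>norm1 f\<close> matters for
  oscillating \<open>f\<close>, whose partial integrals are small while the norm is not. Removing
  the mean gives \<open>2 * B\<close> for the primitive, and its own mean costs the same
  again.\<close>

lemma zprim_bound:
  assumes "\<And>x. x \<in> {0..1} \<Longrightarrow> cmod (integral {0..x} f) \<le> B" "L1 f" "x \<in> {0..1}"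
  shows "cmod (zprim f x) \<le> 4 * B"
proof -
  have m: "cmod (mean f) \<le> B"
    using assms(1)[of 1] by (simp add: mean_def)
  have P: "cmod (integral {0..x} (\<lambda>t. f t - mean f)) \<le> 2 * B" if x: "x \<in> {0..1}" for x
  proof -
    have "integral {0..x} (\<lambda>t. f t - mean f) = integral {0..x} f - x *\<^sub>R mean f"
      using x by (subst integral_diff) (auto intro!: L1_subinterval assms L1_const)
    moreover have "cmod (x *\<^sub>R mean f) \<le> 1 * B"
      unfolding norm_scaleR using x m by (intro mult_mono) auto
    ultimately show ?thesis
      using assms(1)[OF x] norm_triangle_ineq4[of "integral {0..x} f" "x *\<^sub>R mean f"] by simp
  qed
  have "continuous_on {0..1} (\<lambda>x. integral {0..x} (\<lambda>t. f t - mean f))"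
    by (intro indefinite_integral_continuous_1 L1_integrable L1_diff L1_const assms)
  then have "cmod (mean (\<lambda>x. integral {0..x} (\<lambda>t. f t - mean f))) \<le> 2 * B"
    unfolding mean_def[of "\<lambda>x. integral {0..x} (\<lambda>t. f t - mean f)"]
    using integral_norm_bound_integral[of "\<lambda>x. integral {0..x} (\<lambda>t. f t - mean f)" "{0..1}" "\<lambda>x. 2 * B"] P
    by (auto simp: integrable_continuous_real)
  then show ?thesis
    using P[OF assms(3)] norm_triangle_ineq4 unfolding zprim_def by (smt (verit))
qed

lemma zprim_norm1: "L1 f \<Longrightarrow> x \<in> {0..1} \<Longrightarrow> cmod (zprim f x) \<le> 4 * norm1 f"
  by (rule zprim_bound) (auto intro: norm_integral_le_norm1)

lemma zprim_add:
  assumes "L1 f" "L1 g" "x \<in> {0..1}"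
  shows "zprim (\<lambda>x. f x + g x) x = zprim f x + zprim g x"
proof -
  have "prim (\<lambda>x. (f x + g x) - (mean f + mean g)) (\<lambda>x. zprim f x + zprim g x)"
    by (rule prim_cong[OF prim_add[OF zprim_prim zprim_prim], of f g]) (use assms in auto)
  from zprim_unique(2)[OF L1_add[OF assms(1,2)] this, of x] assms show ?thesis
    by (simp add: zprim_periodic mean_add zprim_mean L1_continuous zprim_continuous)
qed

lemma zprim_cmult:
  assumes "L1 f" "x \<in> {0..1}"
  shows "zprim (\<lambda>x. c * f x) x = c * zprim f x"
proof -
  have "prim (\<lambda>x. c * f x - c * mean f) (\<lambda>x. c * zprim f x)"
    by (rule prim_cong[OF prim_cmult[OF zprim_prim], of f]) (use assms in \<open>auto simp: algebra_simps\<close>)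
  from zprim_unique(2)[OF L1_cmult[OF assms(1)] this, of x] assms show ?thesis
    by (simp add: zprim_periodic mean_cmult zprim_mean)
qed

lemma zprim_diff:
  assumes "L1 f" "L1 g" "x \<in> {0..1}"
  shows "zprim (\<lambda>x. f x - g x) x = zprim f x - zprim g x"
  using zprim_add[OF assms(1) L1_cmult[OF assms(2), of "-1"] assms(3)] zprim_cmult[OF assms(2,3), of "-1"]
  by simp

lemma zprim_const: "x \<in> {0..1} \<Longrightarrow> zprim (\<lambda>x. c) x = 0"
  using zprim_unique(2)[OF L1_const, of c c "\<lambda>x. 0" x] prim_const[of 0] by (simp add: mean_const)

lemma zprim_of_derivative:
  assumes "prim f F" "F 1 = F 0" "x \<in> {0..1}"
  shows "zprim f x = F x - mean F"
  using zprim_unique(2)[of f 0 F x] assms prim_L1[OF assms(1)] by simp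

text \<open>The product of the two primitives is periodic, so its derivative has mean zero; the
  terms coming from the means of \<open>f\<close> and \<open>g\<close> vanish because the primitives
  are mean-free.\<close>

lemma zprim_skew:
  assumes f: "L1 f" and g: "L1 g"
  shows "mean (\<lambda>x. f x * zprim g x) = - mean (\<lambda>x. zprim f x * g x)"
proof -
  note c = zprim_continuous[OF f] zprim_continuous[OF g]
  have "prim (\<lambda>x. (f x - mean f) * zprim g x + zprim f x * (g x - mean g)) (\<lambda>x. zprim f x * zprim g x)"
    by (rule prim_mult[OF zprim_prim[OF f] zprim_prim[OF g]])
  from prim_1[OF this] have "mean (\<lambda>x. (f x - mean f) * zprim g x + zprim f x * (g x - mean g)) = 0"
    by (simp add: zprim_periodic f g)
  also have "(\<lambda>x. (f x - mean f) * zprim g x + zprim f x * (g x - mean g)) =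
     (\<lambda>x. (f x * zprim g x - mean f * zprim g x) + (zprim f x * g x - mean g * zprim f x))"
    by (auto simp: algebra_simps)
  also have "mean \<dots> = mean (\<lambda>x. f x * zprim g x) - mean f * mean (zprim g) +
     (mean (\<lambda>x. zprim f x * g x) - mean g * mean (zprim f))"
    using f g c by (simp add: mean_add mean_diff mean_cmult L1_mult_continuous L1_continuous_mult L1_diff L1_cmult L1_continuous)
  finally show ?thesis
    by (simp add: zprim_mean f g add_eq_0_iff2)
qed

section \<open>Algebra and bounds of the operator \<open>Tn\<close>\<close>

lemma L1_fexp_mult: "L1 f \<Longrightarrow> L1 (\<lambda>x. fexp n x * f x)"
  by (intro L1_continuous_mult fexp_continuous)

lemma norm1_fexp_mult [simp]: "norm1 (\<lambda>x. fexp n x * f x) = norm1 f"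
  by (simp add: norm1_def norm_mult)

lemma Tn_continuous: "L1 f \<Longrightarrow> continuous_on {0..1} (Tn n f)"
  unfolding Tn_def[abs_def]
  by (intro continuous_intros fexp_continuous zprim_continuous L1_fexp_mult)

lemma Tn_cong:
  assumes "\<And>x. x \<in> {0..1} \<Longrightarrow> f x = g x" "x \<in> {0..1}"
  shows "Tn n f x = Tn n g x"
  using zprim_cong[of f g x] zprim_cong[of "\<lambda>t. fexp (- n) t * f t" "\<lambda>t. fexp (- n) t * g t" x] assms
  by (simp add: Tn_def)

lemma Tn_periodic: "L1 f \<Longrightarrow> Tn n f 1 = Tn n f 0"
  by (simp add: Tn_def zprim_periodic L1_fexp_mult)

text \<open>Smoothing from the integral norm to the supremum norm: \<open>kap n\<close> supplies one
  power of \<open>1 / n\<close>, and each of the two primitives costs a factor 4.\<close>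

lemma Tn_bound:
  assumes "L1 f" "x \<in> {0..1}"
  shows "cmod (Tn n f x) \<le> 8 * cmod (kap n) * norm1 f"
proof -
  have "cmod (fexp n x * zprim (\<lambda>t. fexp (- n) t * f t) x - zprim f x) \<le> 4 * norm1 f + 4 * norm1 f"
    using zprim_norm1[OF assms] zprim_norm1[OF L1_fexp_mult[OF assms(1), of "-n"] assms(2)]
    by (intro order_trans[OF norm_triangle_ineq4] add_mono) (auto simp: norm_mult)
  then show ?thesis
    unfolding Tn_def norm_mult using mult_left_mono[of _ _ "cmod (kap n)"] by (fastforce simp: mult_ac)
qed

lemma Tn_add:
  assumes "L1 f" "L1 g" "x \<in> {0..1}"
  shows "Tn n (\<lambda>x. f x + g x) x = Tn n f x + Tn n g x"
  using zprim_add[OF assms] zprim_add[OF L1_fexp_mult[OF assms(1), of "-n"] L1_fexp_mult[OF assms(2), of "-n"] assms(3)]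
  by (simp add: Tn_def algebra_simps)

lemma Tn_cmult:
  assumes "L1 f" "x \<in> {0..1}"
  shows "Tn n (\<lambda>x. c * f x) x = c * Tn n f x"
proof -
  have "(\<lambda>t. fexp (- n) t * (c * f t)) = (\<lambda>t. c * (fexp (- n) t * f t))"
    by (simp add: mult.left_commute)
  then show ?thesis
    using zprim_cmult[OF assms, of c] zprim_cmult[OF L1_fexp_mult[OF assms(1), of "-n"] assms(2), of c]
    by (simp add: Tn_def right_diff_distrib)
qed

lemma Tn_diff:
  assumes "L1 f" "L1 g" "x \<in> {0..1}"
  shows "Tn n (\<lambda>x. f x - g x) x = Tn n f x - Tn n g x"
  using Tn_add[OF assms(1) L1_cmult[OF assms(2), of "-1"] assms(3)] Tn_cmult[OF assms(2,3), of n "-1"]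
  by simp

text \<open>Conjugation by \<open>fexp n\<close> exchanges the two resonant modes and with them the
  two terms of \<open>Tn\<close>; the resulting sign is that of
  \<open>kap (- n) = - kap n\<close>.\<close>

lemma Tn_shift:
  assumes "L1 f" "x \<in> {0..1}"
  shows "Tn n (\<lambda>x. fexp n x * f x) x = fexp n x * Tn (- n) f x"
  by (simp add: Tn_def kap_minus algebra_simps)

text \<open>Both halves of \<open>Tn\<close> are built from the skew operator \<open>zprim\<close>.
  Transposing flips the sign of \<open>kap n\<close> and moves the exponentials to the other factor,
  which is exactly \<open>Tn (- n)\<close>.\<close>

lemma Tn_adjoint:
  assumes f: "L1 f" and g: "L1 g"
  shows "mean (\<lambda>x. f x * Tn n g x) = mean (\<lambda>x. Tn (- n) f x * g x)"
proof -
  define a b where "a = (\<lambda>x. fexp n x * f x)" and "b = (\<lambda>x. fexp (- n) x * g x)"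
  have ab: "L1 a" "L1 b" unfolding a_def b_def by (intro L1_fexp_mult f g)+
  note c = zprim_continuous[OF ab(1)] zprim_continuous[OF ab(2)] zprim_continuous[OF f] zprim_continuous[OF g]
  have "mean (\<lambda>x. f x * Tn n g x) = mean (\<lambda>x. kap n * (a x * zprim b x - f x * zprim g x))"
    by (intro mean_cong) (simp add: Tn_def a_def b_def algebra_simps)
  also have "\<dots> = kap n * (mean (\<lambda>x. a x * zprim b x) - mean (\<lambda>x. f x * zprim g x))"
    unfolding mean_cmult using f g ab c by (subst mean_diff) (auto intro: L1_mult_continuous)
  also have "\<dots> = - kap n * (mean (\<lambda>x. zprim a x * b x) - mean (\<lambda>x. zprim f x * g x))"
    unfolding zprim_skew[OF ab] zprim_skew[OF f g] by (simp add: algebra_simps)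
  also have "\<dots> = mean (\<lambda>x. - kap n * (zprim a x * b x - zprim f x * g x))"
    unfolding mean_cmult using f g ab c by (subst mean_diff) (auto intro: L1_continuous_mult)
  also have "\<dots> = mean (\<lambda>x. Tn (- n) f x * g x)"
    by (intro mean_cong) (simp add: Tn_def a_def b_def kap_minus algebra_simps)
  finally show ?thesis .
qed

lemma fourier_coeff_derivative:
  assumes F: "prim f F" and per: "F 1 = F 0" and n: "n \<noteq> 0"
  shows "fourier_coeff F n = kap n * fourier_coeff f n"
proof -
  note cF = prim_continuous_on[OF F]
  have "prim (\<lambda>x. f x * fexp (- n) x + F x * (2 * pi * \<i> * of_int (- n) * fexp (- n) x)) (\<lambda>x. F x * fexp (- n) x)"
    by (rule prim_mult[OF F prim_fexp])
  from prim_1[OF this] per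
  have "mean (\<lambda>x. f x * fexp (- n) x + F x * (2 * pi * \<i> * of_int (- n) * fexp (- n) x)) = 0" by simp
  also have "(\<lambda>x. f x * fexp (- n) x + F x * (2 * pi * \<i> * of_int (- n) * fexp (- n) x)) =
      (\<lambda>x. f x * fexp (- n) x - (2 * pi * \<i> * of_int n) * (F x * fexp (- n) x))"
    by (auto simp: algebra_simps)
  also have "mean \<dots> = fourier_coeff f n - (2 * pi * \<i> * of_int n) * fourier_coeff F n"
    unfolding fourier_coeff_mean mean_cmult[symmetric]
    by (intro mean_diff L1_cmult L1_mult_continuous fexp_continuous prim_L1[OF F] L1_continuous cF)
  finally have *: "fourier_coeff f n = (2 * pi * \<i> * of_int n) * fourier_coeff F n" by simp
  have "kap n * fourier_coeff f n = (kap n * (2 * pi * \<i> * of_int n)) * fourier_coeff F n"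
    by (simp only: * mult.assoc)
  then show ?thesis by (simp only: kap_mult_2pi[OF n] mult_1)
qed

lemma fourier_coeff_zprim:
  assumes f: "L1 f" and n: "n \<noteq> 0"
  shows "fourier_coeff (zprim f) n = kap n * fourier_coeff f n"
proof -
  have "fourier_coeff (zprim f) n = kap n * fourier_coeff (\<lambda>x. f x - mean f) n"
    by (rule fourier_coeff_derivative[OF zprim_prim[OF f] zprim_periodic[OF f] n])
  also have "fourier_coeff (\<lambda>x. f x - mean f) n = fourier_coeff f n - mean f * mean (fexp (- n))"
    unfolding fourier_coeff_mean mean_cmult[symmetric]
    by (subst mean_diff[symmetric])
      (intro L1_mult_continuous L1_cmult fexp_continuous f L1_continuous[OF fexp_continuous] | simp add: algebra_simps)+
  finally show ?thesis using n by (simp add: mean_fexp)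
qed

lemma fourier_coeff_0: "fourier_coeff f 0 = mean f"
  by (simp add: fourier_coeff_mean)

text \<open>On a resonant mode one half of \<open>Tn\<close> vanishes because a primitive is
  mean-free, and the other contributes a second factor \<open>kap\<close>. So these modes are
  multiplied by a small number, and a mode absent from \<open>f\<close> is absent from
  \<open>Tn n f\<close>.\<close>

lemma fourier_coeff_Tn:
  assumes f: "L1 f" and n: "n \<noteq> 0"
  shows "fourier_coeff (Tn n f) n = - (kap n)\<^sup>2 * fourier_coeff f n"
    and "mean (Tn n f) = - (kap n)\<^sup>2 * mean f"
proof -
  define g where "g = (\<lambda>t. fexp (- n) t * f t)"
  have g: "L1 g" unfolding g_def by (rule L1_fexp_mult[OF f])
  note c = zprim_continuous[OF f] zprim_continuous[OF g]
  have "fourier_coeff (Tn n f) n = mean (\<lambda>x. kap n * (zprim g x - zprim f x * fexp (- n) x))"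
    unfolding fourier_coeff_mean by (intro mean_cong) (simp add: Tn_def g_def algebra_simps)
  also have "\<dots> = kap n * (mean (zprim g) - fourier_coeff (zprim f) n)"
    unfolding mean_cmult fourier_coeff_mean using c
    by (subst mean_diff) (auto intro!: L1_continuous continuous_intros fexp_continuous)
  finally show "fourier_coeff (Tn n f) n = - (kap n)\<^sup>2 * fourier_coeff f n"
    by (simp add: zprim_mean g fourier_coeff_zprim f n power2_eq_square)
  have "mean (Tn n f) = mean (\<lambda>x. kap n * (zprim g x * fexp (- (- n)) x - zprim f x))"
    by (intro mean_cong) (simp add: Tn_def g_def algebra_simps)
  also have "\<dots> = kap n * (fourier_coeff (zprim g) (- n) - mean (zprim f))"
    unfolding mean_cmult fourier_coeff_mean using c
    by (subst mean_diff) (auto intro!: L1_continuous continuous_intros fexp_continuous)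
  also have "fourier_coeff (zprim g) (- n) = kap (- n) * mean f"
    using n by (subst fourier_coeff_zprim[OF g]) (auto simp: fourier_coeff_mean g_def mult_ac)
  finally show "mean (Tn n f) = - (kap n)\<^sup>2 * mean f"
    by (simp add: zprim_mean f kap_minus power2_eq_square)
qed

lemma Tn_const:
  assumes n: "n \<noteq> 0" and x: "x \<in> {0..1}"
  shows "Tn n (\<lambda>x. c) x = - (kap n)\<^sup>2 * c"
proof -
  have p: "prim (\<lambda>x. fexp (- n) x) (\<lambda>x. kap (- n) * fexp (- n) x)"
    by (rule prim_cong[OF prim_cmult[OF prim_fexp[of "- n"], of "kap (- n)"]]) (use n in \<open>simp_all add: kap_def\<close>)
  have "zprim (fexp (- n)) x = kap (- n) * fexp (- n) x"
    using zprim_of_derivative[OF p _ x] n by (simp add: mean_cmult mean_fexp)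
  then show ?thesis
    using x n zprim_cmult[OF L1_continuous[OF fexp_continuous], of x c "- n"]
    by (simp add: Tn_def zprim_const kap_minus power2_eq_square mult.commute[of _ c])
qed

text \<open>As a Fourier multiplier, \<open>Tn n\<close> commutes with differentiation of periodic
  functions. This is what allows a Leibniz rule for nested products.\<close>

lemma Tn_derivative:
  assumes F: "prim f F" and per: "F 1 = F 0"
  shows "prim (Tn n f) (Tn n F)"
proof -
  define w where "w = 2 * pi * \<i> * of_int n"
  note LF = L1_continuous[OF prim_continuous_on[OF F]] and Lf = prim_L1[OF F]
  have 1: "prim (zprim f) (zprim F)"
    by (rule prim_cong[OF zprim_prim[OF LF]]) (use zprim_of_derivative[OF F per] in auto)
  have pe: "prim (\<lambda>x. fexp (- n) x * f x - w * (fexp (- n) x * F x)) (\<lambda>x. fexp (- n) x * F x)"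
    by (rule prim_cong[OF prim_mult[OF prim_fexp F]]) (auto simp: w_def algebra_simps)
  \<comment> \<open>The product rule for \<open>fexp (- n) * F\<close> produces an extra term with
    factor \<open>w\<close>; it matches the derivative of the outer exponential
    \<open>fexp n\<close>.\<close>
  have 2: "zprim (\<lambda>x. fexp (- n) x * f x) x = fexp (- n) x * F x - mean (\<lambda>x. fexp (- n) x * F x)
      + w * zprim (\<lambda>x. fexp (- n) x * F x) x" if x: "x \<in> {0..1}" for x
  proof -
    have "zprim (\<lambda>x. fexp (- n) x * f x - w * (fexp (- n) x * F x)) x = fexp (- n) x * F x - mean (\<lambda>x. fexp (- n) x * F x)"
      by (rule zprim_of_derivative[OF pe _ x]) (simp add: per)
    then show ?thesis
      unfolding zprim_diff[OF L1_fexp_mult[OF Lf, of "- n"] L1_cmult[OF L1_fexp_mult[OF LF, of "- n"], of w] x]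
        zprim_cmult[OF L1_fexp_mult[OF LF, of "- n"] x, of w] by (simp only: diff_eq_eq)
  qed
  have "prim (\<lambda>x. w * fexp n x * zprim (\<lambda>x. fexp (- n) x * F x) x +
      fexp n x * (fexp (- n) x * F x - mean (\<lambda>x. fexp (- n) x * F x))) (\<lambda>x. fexp n x * zprim (\<lambda>x. fexp (- n) x * F x) x)"
    unfolding w_def by (rule prim_mult[OF prim_fexp zprim_prim[OF L1_fexp_mult[OF LF]]])
  then have "prim (\<lambda>x. fexp n x * zprim (\<lambda>x. fexp (- n) x * f x) x) (\<lambda>x. fexp n x * zprim (\<lambda>x. fexp (- n) x * F x) x)"
    by (rule prim_cong) (auto simp: 2 ring_distribs mult.assoc mult.left_commute[of w])
  from prim_cmult[OF prim_diff[OF this 1], of "kap n"] show ?thesis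
    by (rule prim_cong) (simp_all add: Tn_def)
qed

section \<open>The Riemann-Lebesgue lemma and iterated resolvents\<close>

lemma norm_integral_fexp_le:
  assumes p: "prim p' p" and n: "n \<noteq> 0" and x: "x \<in> {0..1}"
    and B: "\<And>x. x \<in> {0..1} \<Longrightarrow> cmod (p x) \<le> B"
  shows "cmod (integral {0..x} (\<lambda>t. fexp n t * p t)) \<le> cmod (kap n) * (2 * B + norm1 p')"
proof -
  have pc: "L1 p" by (rule L1_continuous[OF prim_continuous_on[OF p]])
  define w where "w = 2 * pi * \<i> * of_int n"
  have 1: "prim (\<lambda>x. w * fexp n x * p x + fexp n x * p' x) (\<lambda>x. fexp n x * p x)"
    unfolding w_def by (rule prim_mult[OF prim_fexp p])
  have "integral {0..x} (\<lambda>t. w * fexp n t * p t + fexp n t * p' t) =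
     w * integral {0..x} (\<lambda>t. fexp n t * p t) + integral {0..x} (\<lambda>t. fexp n t * p' t)"
    unfolding mult.assoc using x
    by (subst integral_add) (auto intro!: L1_subinterval L1_cmult L1_fexp_mult pc prim_L1[OF p])
  moreover have "integral {0..x} (\<lambda>t. w * fexp n t * p t + fexp n t * p' t) = fexp n x * p x - p 0"
    using 1 x by (simp add: prim_def)
  ultimately have "w * integral {0..x} (\<lambda>t. fexp n t * p t) = fexp n x * p x - p 0 - integral {0..x} (\<lambda>t. fexp n t * p' t)"
    by (simp add: algebra_simps)
  then have "kap n * w * integral {0..x} (\<lambda>t. fexp n t * p t) =
      kap n * (fexp n x * p x - p 0 - integral {0..x} (\<lambda>t. fexp n t * p' t))"
    by (simp only: mult.assoc)
  then have "integral {0..x} (\<lambda>t. fexp n t * p t) = kap n * (fexp n x * p x - p 0 - integral {0..x} (\<lambda>t. fexp n t * p' t))"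
    unfolding w_def kap_mult_2pi[OF n] by simp
  also have "cmod \<dots> = cmod (kap n) * cmod (fexp n x * p x - p 0 - integral {0..x} (\<lambda>t. fexp n t * p' t))"
    by (rule norm_mult)
  also have "\<dots> \<le> cmod (kap n) * (2 * B + norm1 p')"
  proof (rule mult_left_mono)
    have "cmod (integral {0..x} (\<lambda>t. fexp n t * p' t)) \<le> norm1 p'"
      using norm_integral_le_norm1[OF L1_fexp_mult[OF prim_L1[OF p], of n], of 0 x] x by simp
    moreover have "cmod (fexp n x * p x) \<le> B" "cmod (p 0) \<le> B"
      using B[OF x] B[of 0] by (auto simp: norm_mult)
    ultimately show "cmod (fexp n x * p x - p 0 - integral {0..x} (\<lambda>t. fexp n t * p' t)) \<le> 2 * B + norm1 p'"
      using norm_triangle_ineq4[of "fexp n x * p x - p 0" "integral {0..x} (\<lambda>t. fexp n t * p' t)"]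
        norm_triangle_ineq4[of "fexp n x * p x" "p 0"] by linarith
  qed simp
  finally show ?thesis .
qed

lemma eventually_cofinite_abs_int: "eventually (\<lambda>n::int. K \<le> real_of_int \<bar>n\<bar>) cofinite"
proof -
  have "{n::int. \<not> K \<le> real_of_int \<bar>n\<bar>} \<subseteq> {- \<lceil>\<bar>K\<bar>\<rceil>..\<lceil>\<bar>K\<bar>\<rceil>}"
  proof (clarify, goal_cases)
    case (1 n)
    then have "real_of_int \<bar>n\<bar> \<le> of_int \<lceil>\<bar>K\<bar>\<rceil>" by (smt (verit) le_of_int_ceiling)
    then have "\<bar>n\<bar> \<le> \<lceil>\<bar>K\<bar>\<rceil>" by (simp only: of_int_le_iff)
    then show ?case by auto
  qed
  then show ?thesis
    unfolding eventually_cofinite by (rule finite_subset) simp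
qed

lemma eventually_cofinite_nonzero: "eventually (\<lambda>n::int. n \<noteq> 0) cofinite"
  by (simp add: eventually_cofinite)

lemma filterlim_uminus_cofinite: "filterlim (uminus :: int \<Rightarrow> int) cofinite cofinite"
  unfolding filterlim_iff eventually_cofinite
proof (intro allI impI)
  fix P :: "int \<Rightarrow> bool" assume "finite {x. \<not> P x}"
  then have "finite (uminus ` {x. \<not> P x})" by simp
  then show "finite {x. \<not> P (- x)}"
    by (rule finite_subset[rotated]) (auto simp: image_iff, metis minus_minus)
qed

text \<open>Uniformity in the upper limit is needed because \<open>zprim\<close> integrates up to
  every \<open>x\<close>. Replacing \<open>f\<close> by a polynomial costs an error independent of
  \<open>n\<close> and \<open>x\<close>, and the polynomial part gains \<open>kap n\<close> by one
  integration by parts.\<close>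

lemma riemann_lebesgue_uniform:
  assumes f: "L1 f" and e: "e > 0"
  shows "eventually (\<lambda>n. \<forall>x\<in>{0..1}. cmod (integral {0..x} (\<lambda>t. fexp n t * f t)) \<le> e) cofinite"
proof -
  obtain g where g: "continuous_on UNIV g" "integral {0..1} (\<lambda>x. cmod (f x - g x)) < e / 4"
    using absolutely_integrable_approx_continuous[OF f[unfolded L1_def], of "e / 4"] e by auto
  have gc: "continuous_on {0..1} g" using g(1) by (rule continuous_on_subset) auto
  obtain p where p: "polynomial_function p" "\<And>x. x \<in> {0..1} \<Longrightarrow> cmod (g x - p x) < e / 4"
    using Stone_Weierstrass_polynomial_function[of "{0..1}" g "e / 4"] gc e by auto
  obtain p' where p': "polynomial_function p'" "\<And>x. (p has_vector_derivative p' x) (at x)"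
    using has_vector_derivative_polynomial_function[OF p(1)] by blast
  have pp: "prim p' p"
    by (rule prim_vector_derivative)
      (use p' in \<open>auto intro: has_vector_derivative_at_within continuous_on_polymonial_function\<close>)
  have pc: "continuous_on {0..1} p" by (rule prim_continuous_on[OF pp])
  have "bounded (p ` {0..1})"
    by (intro compact_imp_bounded compact_continuous_image pc) auto
  then obtain B where B: "\<And>x. x \<in> {0..1} \<Longrightarrow> cmod (p x) \<le> B"
    by (meson bounded_iff imageI)
  have fg: "L1 (\<lambda>x. f x - g x)" and gp: "L1 (\<lambda>x. g x - p x)" and fp: "L1 (\<lambda>x. f x - p x)"
    by (intro L1_diff f L1_continuous gc pc)+
  have "norm1 (\<lambda>x. g x - p x) \<le> integral {0..1} (\<lambda>x::real. e / 4)"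
    unfolding norm1_def by (rule integral_le[OF L1_norm_integrable[OF gp]]) (use p(2) in \<open>auto intro: less_imp_le\<close>)
  then have n2: "norm1 (\<lambda>x. f x - p x) \<le> e / 2"
    using norm1_add_le[OF fg gp] g(2) by (simp add: norm1_def)
  \<comment> \<open>\<open>M\<close> collects the boundary values and the integral of the derivative
    of \<open>p\<close>; the condition \<open>M / e <= |n|\<close> then makes the polynomial part at
    most \<open>e / 2\<close>.\<close>
  define M where "M = 2 * B + norm1 p'"
  have "0 \<le> B" by (rule order_trans[OF norm_ge_zero B[of 0]]) simp
  then have M0: "M \<ge> 0" using norm1_nonneg[of p'] by (simp add: M_def)
  have "eventually (\<lambda>n::int. max 1 (M / e) \<le> real_of_int \<bar>n\<bar>) cofinite"
    by (rule eventually_cofinite_abs_int)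
  then show ?thesis
  proof eventually_elim
    case (elim n)
    then have n1: "real_of_int \<bar>n\<bar> \<ge> 1" "M / e \<le> real_of_int \<bar>n\<bar>" by auto
    then have n0: "n \<noteq> 0" by auto
    show ?case
    proof
      fix x :: real assume x: "x \<in> {0..1}"
      have "integral {0..x} (\<lambda>t. fexp n t * f t) = integral {0..x} (\<lambda>t. fexp n t * (f t - p t)) + integral {0..x} (\<lambda>t. fexp n t * p t)"
      proof -
        have "integral {0..x} (\<lambda>t. fexp n t * (f t - p t) + fexp n t * p t) =
            integral {0..x} (\<lambda>t. fexp n t * (f t - p t)) + integral {0..x} (\<lambda>t. fexp n t * p t)"
          by (rule integral_add; rule L1_subinterval) (use x in \<open>auto intro!: L1_fexp_mult fp L1_continuous[OF pc]\<close>)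
        then show ?thesis by (simp flip: distrib_left)
      qed
      moreover have "cmod (integral {0..x} (\<lambda>t. fexp n t * (f t - p t))) \<le> e / 2"
        using norm_integral_le_norm1[OF L1_fexp_mult[OF fp, of n], of 0 x] x n2 by simp
      moreover have "cmod (integral {0..x} (\<lambda>t. fexp n t * p t)) \<le> e / 2"
      proof -
        have "cmod (integral {0..x} (\<lambda>t. fexp n t * p t)) \<le> cmod (kap n) * M"
          unfolding M_def by (rule norm_integral_fexp_le[OF pp n0 x B])
        also have "\<dots> = M / (2 * pi * real_of_int \<bar>n\<bar>)" by (simp add: norm_kap)
        also have "\<dots> \<le> M / (2 * real_of_int \<bar>n\<bar>)"
        proof -
          have "2 * real_of_int \<bar>n\<bar> \<le> (2 * pi) * real_of_int \<bar>n\<bar>"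
            using pi_ge_two by (intro mult_right_mono) auto
          then show ?thesis using n1 M0 by (intro frac_le) auto
        qed
        also have "\<dots> \<le> e / 2"
          using n1 e by (simp add: field_simps)
        finally show ?thesis .
      qed
      ultimately show "cmod (integral {0..x} (\<lambda>t. fexp n t * f t)) \<le> e"
        using norm_triangle_ineq[of "integral {0..x} (\<lambda>t. fexp n t * (f t - p t))" "integral {0..x} (\<lambda>t. fexp n t * p t)"]
        by simp
    qed
  qed
qed

lemma zprim_fexp_small:
  assumes f: "L1 f" and e: "e > 0"
  shows "eventually (\<lambda>n. \<forall>x\<in>{0..1}. cmod (zprim (\<lambda>t. fexp (- n) t * f t) x) \<le> e) cofinite"
proof -
  have "eventually (\<lambda>n. \<forall>x\<in>{0..1}. cmod (integral {0..x} (\<lambda>t. fexp (- n) t * f t)) \<le> e / 4) cofinite"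
    using filterlim_uminus_cofinite riemann_lebesgue_uniform[OF f, of "e / 4"] e
    by (auto simp: filterlim_iff)
  then show ?thesis
  proof eventually_elim
    case (elim n)
    then show ?case
      using zprim_bound[OF _ L1_fexp_mult[OF f], of "-n" "e / 4"] by auto
  qed
qed

text \<open>This is \<open>a n = o(|n|^(- r))\<close> at both ends of the integers: the cofinite
  filter treats \<open>n\<close> and \<open>- n\<close> alike, as products of opposite coefficients
  will require.\<close>

definition decays :: "nat \<Rightarrow> (int \<Rightarrow> complex) \<Rightarrow> bool" where
  "decays r a \<longleftrightarrow> ((\<lambda>n. of_int n ^ r * a n) \<longlongrightarrow> 0) cofinite"

lemma decays_add: "decays r a \<Longrightarrow> decays r b \<Longrightarrow> decays r (\<lambda>n. a n + b n)"
  unfolding decays_def distrib_left by (rule tendsto_add_zero)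

lemma decays_mult: "decays r a \<Longrightarrow> decays r' b \<Longrightarrow> decays (r + r') (\<lambda>n. a n * b n)"
  unfolding decays_def using tendsto_mult_zero[of "\<lambda>n. of_int n ^ r * a n" cofinite "\<lambda>n. of_int n ^ r' * b n"]
  by (simp add: power_add mult_ac)

lemma decays_bounded_mult:
  assumes "decays r a" "\<And>n. cmod (b n) \<le> C"
  shows "decays r (\<lambda>n. b n * a n)"
proof -
  have "Bfun b cofinite" using assms(2) by (auto intro!: BfunI[of _ C])
  with assms(1) show ?thesis
    unfolding decays_def mult.left_commute[of _ "b _"]
    using bounded_bilinear.Zfun_prod_Bfun[OF bounded_bilinear_mult, of "\<lambda>n. of_int n ^ r * a n" cofinite b]
    by (simp add: tendsto_Zfun_iff mult_ac)
qed

lemma decays_cmult: "decays r a \<Longrightarrow> decays r (\<lambda>n. c * a n)"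
  by (rule decays_bounded_mult[of _ _ _ "cmod c"]) auto

lemma decays_minus: "decays r a \<Longrightarrow> decays r (\<lambda>n. - a n)"
  using decays_cmult[of r a "-1"] by simp

lemma decays_diff: "decays r a \<Longrightarrow> decays r b \<Longrightarrow> decays r (\<lambda>n. a n - b n)"
  using decays_add[OF _ decays_minus, of r a b] by simp

lemma decays_zero: "decays r (\<lambda>n. 0)"
  by (simp add: decays_def)

lemma decays_cong: "(\<And>n. n \<noteq> 0 \<Longrightarrow> a n = b n) \<Longrightarrow> decays r a \<longleftrightarrow> decays r b"
  unfolding decays_def
  by (intro filterlim_cong refl eventually_mono[OF eventually_cofinite_nonzero]) simp

lemma decays_reflect: "decays r a \<Longrightarrow> decays r (\<lambda>n. a (- n))"
proof -
  assume "decays r a"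
  then have "((\<lambda>n. of_int (- n) ^ r * a (- n)) \<longlongrightarrow> 0) cofinite"
    unfolding decays_def by (rule filterlim_compose[OF _ filterlim_uminus_cofinite])
  then have "((\<lambda>n. (-1) ^ r * (of_int (- n) ^ r * a (- n))) \<longlongrightarrow> 0) cofinite"
    by (rule tendsto_mult_right_zero)
  moreover have "(-1) ^ r * (of_int (- n) ^ r * a (- n)) = of_int n ^ r * a (- n)" for n
  proof -
    have "(-1) ^ r * (of_int (- n) ^ r * a (- n)) = ((-1) * of_int (- n)) ^ r * a (- n)"
      by (simp only: power_mult_distrib mult.assoc)
    then show ?thesis by simp
  qed
  ultimately show ?thesis
    unfolding decays_def by (simp only:)
qed

lemma decays_kap_mult: "decays r a \<Longrightarrow> decays (Suc r) (\<lambda>n. kap n * a n)"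
proof -
  assume "decays r a"
  then have "decays r (\<lambda>n. (1 / (2 * pi * \<i>)) * a n)" by (rule decays_cmult)
  then show ?thesis
    unfolding decays_def
    by (rule tendsto_cong[THEN iffD1, rotated], intro eventually_mono[OF eventually_cofinite_nonzero])
      (simp add: kap_def)
qed

lemma decays_Suc: "decays (Suc r) a \<Longrightarrow> decays r a"
  unfolding decays_def
proof (rule Lim_null_comparison)
  assume *: "((\<lambda>n. of_int n ^ Suc r * a n) \<longlongrightarrow> 0) cofinite"
  show "((\<lambda>n. cmod (of_int n ^ Suc r * a n)) \<longlongrightarrow> 0) cofinite"
    using * by (rule tendsto_norm_zero)
  show "\<forall>\<^sub>F n in cofinite. cmod (of_int n ^ r * a n) \<le> cmod (of_int n ^ Suc r * a n)"
    using eventually_cofinite_abs_int[of 1]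
  proof eventually_elim
    case (elim n)
    then show ?case
      using mult_right_mono[of 1 "\<bar>real_of_int n\<bar>" "cmod (of_int n ^ r * a n)"]
      by (simp add: norm_mult norm_power mult.assoc)
  qed
qed

lemma decays_mono: "decays r a \<Longrightarrow> r' \<le> r \<Longrightarrow> decays r' a"
  by (induction r) (auto simp: le_Suc_eq dest: decays_Suc)

section \<open>Nested products of factors and resolvents\<close>

lemma norm_fourier_coeff_le: "L1 f \<Longrightarrow> cmod (fourier_coeff f n) \<le> norm1 f"
  unfolding fourier_coeff_mean mult.commute[of "f _"]
  using norm_mean_le[OF L1_fexp_mult, of f "- n"] by (simp only: norm1_fexp_mult)

lemma decays_fourier_coeff: "L1 f \<Longrightarrow> decays 0 (fourier_coeff f)"
  unfolding decays_def power_0 mult_1 tendsto_iff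
proof (intro allI impI)
  fix e :: real assume f: "L1 f" and e: "e > 0"
  then have "e / 2 > 0" by simp
  have "eventually (\<lambda>n. \<forall>x\<in>{0..1}. cmod (integral {0..x} (\<lambda>t. fexp (- n) t * f t)) \<le> e / 2) cofinite"
    using filterlim_uminus_cofinite riemann_lebesgue_uniform[OF f \<open>e / 2 > 0\<close>]
    by (auto simp: filterlim_iff)
  then show "eventually (\<lambda>n. dist (fourier_coeff f n) 0 < e) cofinite"
  proof eventually_elim
    case (elim n)
    then have "cmod (integral {0..1} (\<lambda>t. fexp (- n) t * f t)) \<le> e / 2" by (rule bspec) simp
    then show ?case using e by (simp add: fourier_coeff_mean mean_def mult.commute)
  qed
qed

text \<open>The nested product \<open>f1 * Tn (f2 * Tn (... fk))\<close>. The case distinction stops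
  at the last factor instead of applying \<open>Tn\<close> to 1, so \<open>k\<close> factors carry
  \<open>k - 1\<close> resolvents. Factors may differ because derivatives and primitives fall on
  single ones.\<close>

primrec chain :: "int \<Rightarrow> (real \<Rightarrow> complex) list \<Rightarrow> real \<Rightarrow> complex" where
  "chain n [] = (\<lambda>x. 1)"
| "chain n (f # fs) = (\<lambda>x. f x * (if fs = [] then 1 else Tn n (chain n fs) x))"

lemma L1_chain: "(\<And>f. f \<in> set F \<Longrightarrow> L1 f) \<Longrightarrow> L1 (chain n F)"
proof (induction F)
  case (Cons f F)
  then show ?case
    by (cases "F = []") (auto intro!: L1_mult_continuous Tn_continuous)
qed (simp add: L1_const)

lemma norm1_chain:
  "F \<noteq> [] \<Longrightarrow> (\<And>f. f \<in> set F \<Longrightarrow> L1 f) \<Longrightarrow>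
    norm1 (chain n F) \<le> (8 * cmod (kap n)) ^ (length F - 1) * prod_list (map norm1 F)"
proof (induction F)
  case (Cons f F)
  show ?case
  proof (cases "F = []")
    case False
    have L: "L1 (chain n F)" using Cons.prems by (intro L1_chain) auto
    have "norm1 (chain n (f # F)) \<le> (8 * cmod (kap n) * norm1 (chain n F)) * norm1 f"
      using False Cons.prems Tn_bound[OF L]
      by (simp, intro norm1_mult_le Tn_continuous L) auto
    also have "\<dots> \<le> (8 * cmod (kap n) * ((8 * cmod (kap n)) ^ (length F - 1) * prod_list (map norm1 F))) * norm1 f"
      using Cons False by (intro mult_right_mono mult_left_mono norm1_nonneg) auto
    also have "\<dots> = (8 * cmod (kap n)) ^ (length (f # F) - 1) * prod_list (map norm1 (f # F))"
      using False by (cases F) (simp_all add: mult_ac)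
    finally show ?thesis .
  qed simp
qed simp

text \<open>Linearity in one slot, in the shape of \<open>q x - z * 1\<close>, so that the same
  lemma expands the shifted potential.\<close>

lemma chain_linear:
  assumes "\<And>f. f \<in> set G \<union> set H \<Longrightarrow> L1 f" "L1 f" "L1 g" "x \<in> {0..1}"
  shows "chain n (G @ (\<lambda>x. f x - c * g x) # H) x = chain n (G @ f # H) x - c * chain n (G @ g # H) x"
  using assms
proof (induction G arbitrary: x)
  case Nil
  then show ?case by (simp add: algebra_simps)
next
  case (Cons h G)
  have 1: "L1 (chain n (G @ f # H))" "L1 (chain n (G @ g # H))"
    by (intro L1_chain; use Cons.prems in auto)+
  have "Tn n (chain n (G @ (\<lambda>x. f x - c * g x) # H)) x = Tn n (\<lambda>x. chain n (G @ f # H) x - c * chain n (G @ g # H) x) x"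
    by (rule Tn_cong) (use Cons in auto)
  also have "\<dots> = Tn n (chain n (G @ f # H)) x - c * Tn n (chain n (G @ g # H)) x"
    using Tn_diff[OF 1(1) L1_cmult[OF 1(2)], of x n c] Tn_cmult[OF 1(2), of x n c] Cons.prems by simp
  finally show ?case by (simp add: right_diff_distrib)
qed

lemma chain_snoc:
  assumes "x \<in> {0..1}"
  shows "chain n (G @ [g, f]) x = chain n (G @ [\<lambda>x. g x * Tn n f x]) x"
  using assms
proof (induction G arbitrary: x)
  case (Cons h G)
  have "Tn n (chain n (G @ [g, f])) x = Tn n (chain n (G @ [\<lambda>x. g x * Tn n f x])) x"
    by (rule Tn_cong) (use Cons in auto)
  then show ?case by simp
qed simp

lemma fourier_coeff_cong: "(\<And>x. x \<in> {0..1} \<Longrightarrow> f x = g x) \<Longrightarrow> fourier_coeff f n = fourier_coeff g n"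
  unfolding fourier_coeff_mean by (rule mean_cong) simp

lemma fourier_coeff_add: "L1 f \<Longrightarrow> L1 g \<Longrightarrow> fourier_coeff (\<lambda>x. f x + g x) n = fourier_coeff f n + fourier_coeff g n"
  unfolding fourier_coeff_mean distrib_right
  by (intro mean_add L1_mult_continuous fexp_continuous)

lemma fourier_coeff_cmult: "fourier_coeff (\<lambda>x. c * f x) n = c * fourier_coeff f n"
  unfolding fourier_coeff_mean mult.assoc by (rule mean_cmult)

lemma fourier_coeff_diff: "L1 f \<Longrightarrow> L1 g \<Longrightarrow> fourier_coeff (\<lambda>x. f x - g x) n = fourier_coeff f n - fourier_coeff g n"
  unfolding fourier_coeff_mean left_diff_distrib
  by (intro mean_diff L1_mult_continuous fexp_continuous)

lemma fourier_coeff_const: "n \<noteq> 0 \<Longrightarrow> fourier_coeff (\<lambda>x. c) n = 0"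
  unfolding fourier_coeff_mean mean_cmult by (simp add: mean_fexp)

text \<open>The innermost factor is \<open>kap n\<close> times the difference of an oscillating primitive, which
  vanishes uniformly, and of a primitive independent of \<open>n\<close>, which shortens the chain.\<close>

lemma decays_chain_L1:
  "F \<noteq> [] \<Longrightarrow> (\<And>f. f \<in> set F \<Longrightarrow> L1 f) \<Longrightarrow> decays (length F - 1) (\<lambda>n. fourier_coeff (chain n F) n)"
proof (induction "length F" arbitrary: F rule: less_induct)
  case less
  show ?case
  proof (cases "\<exists>f. F = [f]")
    case True
    then obtain f where "F = [f]" by blast
    then show ?thesis using less.prems decays_fourier_coeff[of f] by simp
  next
    case False
    obtain G g f where F: "F = G @ [g, f]"
    proof -
      obtain F' f where 1: "F = F' @ [f]" using less.prems(1) by (cases F rule: rev_cases) auto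
      with False obtain G g where "F' = G @ [g]" by (cases F' rule: rev_cases) auto
      with 1 that show thesis by simp
    qed
    have L: "L1 f" "L1 g" "\<And>h. h \<in> set G \<Longrightarrow> L1 h" using less.prems F by auto
    \<comment> \<open>The two halves of the innermost \<open>Tn\<close>, stripped of
      \<open>kap n\<close> and multiplied into the preceding factor: \<open>a n\<close> oscillates
      with \<open>n\<close>, \<open>b\<close> is a fixed function.\<close>
    define a where "a n = (\<lambda>x. g x * (fexp n x * zprim (\<lambda>t. fexp (- n) t * f t) x))" for n
    define b where "b = (\<lambda>x. g x * zprim f x)"
    have La: "L1 (a n)" for n
      unfolding a_def by (intro L1_mult_continuous continuous_intros fexp_continuous zprim_continuous L1_fexp_mult L)
    have Lb: "L1 b"
      unfolding b_def by (intro L1_mult_continuous zprim_continuous L)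
    have split: "fourier_coeff (chain n F) n =
       kap n * fourier_coeff (chain n (G @ [a n])) n - kap n * fourier_coeff (chain n (G @ [b])) n" for n
    proof -
      have "fourier_coeff (chain n F) n = fourier_coeff (chain n (G @ [\<lambda>x. g x * Tn n f x])) n"
        unfolding F by (intro fourier_coeff_cong chain_snoc)
      also have "(\<lambda>x. g x * Tn n f x) = (\<lambda>x. (\<lambda>x. 0 - (- kap n) * a n x) x - kap n * b x)"
        by (auto simp: Tn_def a_def b_def algebra_simps)
      also have "fourier_coeff (chain n (G @ [\<lambda>x. (\<lambda>x. 0 - (- kap n) * a n x) x - kap n * b x])) n =
         fourier_coeff (\<lambda>x. (chain n (G @ [\<lambda>x. 0]) x + kap n * chain n (G @ [a n]) x) - kap n * chain n (G @ [b]) x) n"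
      proof (intro fourier_coeff_cong)
        fix x :: real assume x: "x \<in> {0..1}"
        have "chain n (G @ [\<lambda>x. (\<lambda>x. 0 - (- kap n) * a n x) x - kap n * b x]) x =
           chain n (G @ [\<lambda>x. 0 - (- kap n) * a n x]) x - kap n * chain n (G @ [b]) x"
          by (rule chain_linear) (use L x Lb in \<open>auto intro!: L1_cmult La L1_diff L1_const\<close>)
        moreover have "chain n (G @ [\<lambda>x. 0 - (- kap n) * a n x]) x =
           chain n (G @ [\<lambda>x. 0]) x - (- kap n) * chain n (G @ [a n]) x"
          by (rule chain_linear) (use L x in \<open>auto intro!: La L1_const\<close>)
        ultimately show "chain n (G @ [\<lambda>x. (\<lambda>x. 0 - (- kap n) * a n x) x - kap n * b x]) x =
           (chain n (G @ [\<lambda>x. 0]) x + kap n * chain n (G @ [a n]) x) - kap n * chain n (G @ [b]) x"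
          by simp
      qed
      also have "\<dots> = fourier_coeff (chain n (G @ [\<lambda>x. 0])) n + kap n * fourier_coeff (chain n (G @ [a n])) n -
         kap n * fourier_coeff (chain n (G @ [b])) n"
      proof -
        have "L1 (chain n (G @ [a n]))" "L1 (chain n (G @ [b]))" "L1 (chain n (G @ [\<lambda>x. 0]))"
          by (intro L1_chain; use L La Lb L1_const in auto)+
        then show ?thesis
          by (simp add: fourier_coeff_diff fourier_coeff_add fourier_coeff_cmult L1_add L1_cmult)
      qed
      also have "fourier_coeff (chain n (G @ [\<lambda>x. 0])) n = 0"
      proof -
        have "chain n (G @ [\<lambda>x. 0 - 1 * 0]) x = chain n (G @ [\<lambda>x. 0]) x - 1 * chain n (G @ [\<lambda>x. 0]) x"
          if "x \<in> {0..1}" for x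
          by (rule chain_linear) (use that L in \<open>auto intro!: L1_const\<close>)
        then have "fourier_coeff (chain n (G @ [\<lambda>x. 0])) n = fourier_coeff (\<lambda>x. 0) n"
          by (intro fourier_coeff_cong) simp
        then show ?thesis by (simp add: fourier_coeff_mean mean_const)
      qed
      finally show ?thesis by simp
    qed
    have "decays (length (G @ [b]) - 1) (\<lambda>n. fourier_coeff (chain n (G @ [b])) n)"
      by (rule less.hyps) (use F L Lb in auto)
    from decays_kap_mult[OF this] have db: "decays (length F - 1) (\<lambda>n. kap n * fourier_coeff (chain n (G @ [b])) n)"
      by (simp add: F)
    \<comment> \<open>The factor \<open>a n\<close> varies with \<open>n\<close>, so the induction
      hypothesis does not cover it. The plain norm bound suffices: each remaining resolvent gives
      one power of \<open>1 / n\<close>, and the last factor tends to zero in norm.\<close>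
    have da': "decays (length G) (\<lambda>n. fourier_coeff (chain n (G @ [a n])) n)"
      unfolding decays_def tendsto_iff
    proof (intro allI impI)
      fix e :: real assume e: "e > 0"
      \<comment> \<open>The base 2 bounds \<open>|n| * 8 * cmod (kap n) = 4 / pi\<close>. Dividing
        by \<open>C + 1\<close> avoids a zero denominator and gives a strict inequality at the
        end.\<close>
      define C where "C = 2 ^ length G * (prod_list (map norm1 G) * norm1 g)"
      have C: "C \<ge> 0" unfolding C_def
        by (intro mult_nonneg_nonneg norm1_nonneg prod_list_nonneg) (auto simp: norm1_nonneg)
      then have e': "e / (C + 1) > 0" using e by simp
      from eventually_conj[OF zprim_fexp_small[OF L(1) e'] eventually_cofinite_nonzero]
      show "\<forall>\<^sub>F n in cofinite. dist (of_int n ^ length G * fourier_coeff (chain n (G @ [a n])) n) 0 < e"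
      proof eventually_elim
        case (elim n)
        have na: "norm1 (a n) \<le> e / (C + 1) * norm1 g"
          unfolding a_def by (rule norm1_mult_le) (use elim L in \<open>auto simp: norm_mult
            intro!: continuous_intros fexp_continuous zprim_continuous L1_fexp_mult\<close>)
        have nk: "\<bar>real_of_int n\<bar> * (8 * cmod (kap n)) \<le> 2"
          using elim pi_gt3 by (simp add: norm_kap field_simps)
        have "cmod (fourier_coeff (chain n (G @ [a n])) n) \<le> norm1 (chain n (G @ [a n]))"
          by (intro norm_fourier_coeff_le L1_chain) (use L La in auto)
        also have "\<dots> \<le> (8 * cmod (kap n)) ^ length G * (prod_list (map norm1 G) * norm1 (a n))"
          using norm1_chain[of "G @ [a n]" n] L La by auto
        finally have "\<bar>real_of_int n\<bar> ^ length G * cmod (fourier_coeff (chain n (G @ [a n])) n) \<le>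
           \<bar>real_of_int n\<bar> ^ length G * ((8 * cmod (kap n)) ^ length G * (prod_list (map norm1 G) * norm1 (a n)))"
          by (intro mult_left_mono) auto
        also have "\<dots> = (\<bar>real_of_int n\<bar> * (8 * cmod (kap n))) ^ length G * (prod_list (map norm1 G) * norm1 (a n))"
          by (simp add: power_mult_distrib)
        also have "\<dots> \<le> 2 ^ length G * (prod_list (map norm1 G) * (e / (C + 1) * norm1 g))"
          using na nk by (intro mult_mono power_mono mult_nonneg_nonneg norm1_nonneg prod_list_nonneg)
            (auto simp: norm1_nonneg intro!: prod_list_nonneg)
        also have "\<dots> = e * (C / (C + 1))" by (simp add: C_def)
        also have "\<dots> < e" using e C by (simp add: field_simps)
        finally show ?case by (simp add: norm_mult norm_power)
      qed
    qed
    from decays_kap_mult[OF this] have "decays (length F - 1) (\<lambda>n. kap n * fourier_coeff (chain n (G @ [a n])) n)"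
      by (simp add: F)
    from decays_diff[OF this db] show ?thesis by (simp add: split)
  qed
qed

section \<open>Periodic regularity and the decay it yields\<close>

text \<open>The endpoint conditions encode periodicity, so that no extension beyond \<open>{0..1}\<close> is needed.\<close>

primrec psob :: "nat \<Rightarrow> (real \<Rightarrow> complex) \<Rightarrow> bool" where
  "psob 0 f \<longleftrightarrow> L1 f"
| "psob (Suc s) f \<longleftrightarrow> (\<exists>g. psob s g \<and> prim g f \<and> f 1 = f 0)"

lemma psob_Suc: "psob (Suc s) f \<Longrightarrow> psob s f"
proof (induction s arbitrary: f)
  case 0
  then show ?case by (auto intro: L1_continuous prim_continuous_on)
next
  case (Suc s)
  then show ?case by (metis psob.simps(2))
qed

lemma psob_L1: "psob s f \<Longrightarrow> L1 f"
  by (induction s) (auto dest: psob_Suc simp del: psob.simps(2))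

lemma psob_periodic: "psob (Suc s) f \<Longrightarrow> f 1 = f 0"
  by auto

lemma L1_sum_list: "(\<And>G. G \<in> set Gs \<Longrightarrow> L1 (F G)) \<Longrightarrow> L1 (\<lambda>x. \<Sum>G\<leftarrow>Gs. F G x)"
  by (induction Gs) (auto intro: L1_add L1_const)

lemma psob_const: "psob s (\<lambda>x. c)"
proof (induction s arbitrary: c)
  case (Suc s)
  then show ?case using prim_const[of c] by auto
qed (simp add: L1_const)

declare psob.simps(2) [simp del]

lemma Tn_sum_list:
  assumes "\<And>G. G \<in> set Gs \<Longrightarrow> L1 (F G)" "x \<in> {0..1}"
  shows "Tn n (\<lambda>x. \<Sum>G\<leftarrow>Gs. F G x) x = (\<Sum>G\<leftarrow>Gs. Tn n (F G) x)"
  using assms(1)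
proof (induction Gs)
  case Nil
  show ?case using Tn_cmult[OF L1_const assms(2), of n 0 0] by simp
next
  case (Cons G Gs)
  have "L1 (\<lambda>x. \<Sum>G\<leftarrow>Gs. F G x)"
    by (rule L1_sum_list) (use Cons.prems in auto)
  then show ?case
    using Cons Tn_add[of "F G" "\<lambda>x. \<Sum>G\<leftarrow>Gs. F G x" x n] assms(2) by simp
qed

lemma chain_periodic:
  "(\<And>f. f \<in> set F \<Longrightarrow> L1 f \<and> f 1 = f 0) \<Longrightarrow> chain n F 1 = chain n F 0"
proof (induction F)
  case (Cons f F)
  have "L1 (chain n F)" by (rule L1_chain) (use Cons.prems in auto)
  then show ?case using Cons.prems by (simp add: Tn_periodic)
qed simp

text \<open>Leibniz rule: each summand has one factor differentiated, and
  \<open>Tn_derivative\<close> carries the derivative inwards. The list \<open>Gs\<close> is chosen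
  before \<open>n\<close>, so the decay of finitely many fixed products can be added up.\<close>

lemma chain_derivative:
  "(\<And>f. f \<in> set F \<Longrightarrow> psob (Suc s) f) \<Longrightarrow> F \<noteq> [] \<Longrightarrow>
   \<exists>Gs. (\<forall>G\<in>set Gs. length G = length F \<and> (\<forall>g\<in>set G. psob s g)) \<and>
        (\<forall>n. prim (\<lambda>x. \<Sum>G\<leftarrow>Gs. chain n G x) (chain n F))"
proof (induction F)
  case (Cons f F)
  obtain f' where f': "psob s f'" "prim f' f" "f 1 = f 0"
    using Cons.prems(1)[of f] by (auto simp: psob.simps(2))
  show ?case
  proof (cases "F = []")
    case True
    then show ?thesis using f' by (intro exI[of _ "[[f']]"]) auto
  next
    case False
    obtain Gs where Gs: "\<And>G. G \<in> set Gs \<Longrightarrow> length G = length F \<and> (\<forall>g\<in>set G. psob s g)"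
      "\<And>n. prim (\<lambda>x. \<Sum>G\<leftarrow>Gs. chain n G x) (chain n F)"
      using Cons False by auto
    have LG: "L1 (chain n G)" if "G \<in> set Gs" for n G
      using Gs(1)[OF that] by (intro L1_chain) (auto intro: psob_L1)
    have ne: "G \<noteq> []" if "G \<in> set Gs" for G
      using Gs(1)[OF that] False by auto
    have per: "chain n F 1 = chain n F 0" for n
      by (intro chain_periodic conjI psob_L1[of "Suc s"] psob_periodic[of s] Cons.prems) auto
    have psf: "psob s g" if "g \<in> set (f # F)" for g
      by (rule psob_Suc[OF Cons.prems(1)[OF that]])
    show ?thesis
    proof (intro exI[of _ "(f' # F) # map ((#) f) Gs"] conjI allI)
      show "\<forall>G\<in>set ((f' # F) # map ((#) f) Gs). length G = length (f # F) \<and> (\<forall>g\<in>set G. psob s g)"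
        using Gs(1) f'(1) psf by auto
      fix n
      have "prim (\<lambda>x. f' x * Tn n (chain n F) x + f x * Tn n (\<lambda>x. \<Sum>G\<leftarrow>Gs. chain n G x) x) (\<lambda>x. f x * Tn n (chain n F) x)"
        by (rule prim_mult[OF f'(2) Tn_derivative[OF Gs(2) per]])
      then show "prim (\<lambda>x. \<Sum>G\<leftarrow>(f' # F) # map ((#) f) Gs. chain n G x) (chain n (f # F))"
      proof (rule prim_cong)
        fix x :: real assume x: "x \<in> {0..1}"
        have "(\<Sum>G\<leftarrow>map ((#) f) Gs. chain n G x) = (\<Sum>G\<leftarrow>Gs. f x * Tn n (chain n G) x)"
          unfolding map_map by (intro arg_cong[where f = sum_list] map_cong) (auto dest: ne)
        then show "f' x * Tn n (chain n F) x + f x * Tn n (\<lambda>x. \<Sum>G\<leftarrow>Gs. chain n G x) x =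
          (\<Sum>G\<leftarrow>(f' # F) # map ((#) f) Gs. chain n G x)"
          using False by (simp add: Tn_sum_list[OF LG x] sum_list_const_mult)
      qed (use False in simp)
    qed
  qed
qed simp

lemma fourier_coeff_sum_list:
  assumes "\<And>G. G \<in> set Gs \<Longrightarrow> L1 (F G)"
  shows "fourier_coeff (\<lambda>x. \<Sum>G\<leftarrow>Gs. F G x) n = (\<Sum>G\<leftarrow>Gs. fourier_coeff (F G) n)"
  using assms
proof (induction Gs)
  case Nil
  show ?case by (simp add: fourier_coeff_mean mean_const)
next
  case (Cons G Gs)
  have "L1 (\<lambda>x. \<Sum>G\<leftarrow>Gs. F G x)"
    by (rule L1_sum_list) (use Cons.prems in auto)
  then show ?case
    using Cons by (simp add: fourier_coeff_add)
qed

lemma decays_sum_list: "(\<And>G. G \<in> set Gs \<Longrightarrow> decays r (a G)) \<Longrightarrow> decays r (\<lambda>n. \<Sum>G\<leftarrow>Gs. a G n)"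
  by (induction Gs) (auto intro: decays_zero decays_add)

text \<open>The nested product is periodic, so its coefficient is \<open>kap n\<close> times that of
  its derivative. Thus each order of regularity is traded for one power of \<open>1 / n\<close>,
  with the number of factors unchanged.\<close>

lemma decays_chain:
  "F \<noteq> [] \<Longrightarrow> (\<And>f. f \<in> set F \<Longrightarrow> psob s f) \<Longrightarrow> decays (s + length F - 1) (\<lambda>n. fourier_coeff (chain n F) n)"
proof (induction s arbitrary: F)
  case 0
  then show ?case using decays_chain_L1[of F] by simp
next
  case (Suc s)
  obtain Gs where Gs: "\<And>G. G \<in> set Gs \<Longrightarrow> length G = length F \<and> (\<forall>g\<in>set G. psob s g)"
      "\<And>n. prim (\<lambda>x. \<Sum>G\<leftarrow>Gs. chain n G x) (chain n F)"
    using chain_derivative[OF Suc.prems(2,1)] by auto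
  have LG: "L1 (chain n G)" if "G \<in> set Gs" for n G
    using Gs(1)[OF that] by (intro L1_chain) (auto intro: psob_L1)
  have per: "chain n F 1 = chain n F 0" for n
    by (intro chain_periodic conjI psob_L1[of "Suc s"] psob_periodic[of s] Suc.prems)
  have "decays (s + length F - 1) (\<lambda>n. \<Sum>G\<leftarrow>Gs. fourier_coeff (chain n G) n)"
  proof (rule decays_sum_list)
    fix G assume G: "G \<in> set Gs"
    then have "G \<noteq> []" "length G = length F" using Gs(1)[OF G] Suc.prems(1) by auto
    then show "decays (s + length F - 1) (\<lambda>n. fourier_coeff (chain n G) n)"
      using Suc.IH[of G] Gs(1)[OF G] by simp
  qed
  then have "decays (Suc (s + length F - 1)) (\<lambda>n. kap n * (\<Sum>G\<leftarrow>Gs. fourier_coeff (chain n G) n))"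
    by (rule decays_kap_mult)
  also have "decays (Suc (s + length F - 1)) (\<lambda>n. kap n * (\<Sum>G\<leftarrow>Gs. fourier_coeff (chain n G) n)) \<longleftrightarrow>
     decays (Suc (s + length F - 1)) (\<lambda>n. fourier_coeff (chain n F) n)"
    by (intro decays_cong) (simp add: fourier_coeff_derivative[OF Gs(2) per] fourier_coeff_sum_list LG)
  finally show ?case using Suc.prems(1) by (cases F) auto
qed

text \<open>The shift \<open>z n\<close> varies with \<open>n\<close>, so \<open>q x - z n\<close>
  is not a fixed factor. Expanding one factor at a time into \<open>q\<close> and the constant 1
  moves it into the fixed prefix \<open>G\<close>, and the bounded coefficient \<open>z n\<close>
  preserves the order.\<close>

lemma decays_chain_perturbed:
  assumes q: "psob s q" and z: "\<And>n. cmod (z n) \<le> C"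
  shows "G @ replicate j q \<noteq> [] \<Longrightarrow> (\<And>f. f \<in> set G \<Longrightarrow> psob s f) \<Longrightarrow>
    decays (s + (length G + j) - 1) (\<lambda>n. fourier_coeff (chain n (G @ replicate j (\<lambda>x. q x - z n))) n)"
proof (induction j arbitrary: G)
  case 0
  then show ?case using decays_chain[of G s] by simp
next
  case (Suc j)
  let ?v = "\<lambda>n x. q x - z n"
  have Lv: "L1 (?v n)" for n by (intro L1_diff L1_const psob_L1[OF q])
  have L: "L1 h" if "h \<in> set G \<union> set (replicate j (?v n))" for h n
    using that Suc.prems(2) Lv by (auto intro: psob_L1)
  have Lc: "L1 (chain n ((G @ [f]) @ replicate j (?v n)))" if "L1 f" for f n
    by (rule L1_chain) (use L that in auto)
  have eq: "fourier_coeff (chain n (G @ replicate (Suc j) (?v n))) n =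
     fourier_coeff (chain n ((G @ [q]) @ replicate j (?v n))) n -
     z n * fourier_coeff (chain n ((G @ [\<lambda>x. 1]) @ replicate j (?v n))) n" for n
  proof -
    have "fourier_coeff (chain n (G @ replicate (Suc j) (?v n))) n =
      fourier_coeff (\<lambda>x. chain n ((G @ [q]) @ replicate j (?v n)) x - z n * chain n ((G @ [\<lambda>x. 1]) @ replicate j (?v n)) x) n"
    proof (rule fourier_coeff_cong)
      fix x :: real assume x: "x \<in> {0..1}"
      show "chain n (G @ replicate (Suc j) (?v n)) x =
         chain n ((G @ [q]) @ replicate j (?v n)) x - z n * chain n ((G @ [\<lambda>x. 1]) @ replicate j (?v n)) x"
      proof -
        have "chain n (G @ w # replicate j (?v n)) x =
           chain n (G @ q # replicate j (?v n)) x - z n * chain n (G @ (\<lambda>x. 1) # replicate j (?v n)) x"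
          if "w = (\<lambda>x. q x - z n * (\<lambda>x. 1) x)" for w
          unfolding that by (rule chain_linear[OF _ psob_L1[OF q] L1_const x]) (rule L)
        then show ?thesis by simp
      qed
    qed
    also have "\<dots> = fourier_coeff (chain n ((G @ [q]) @ replicate j (?v n))) n -
     z n * fourier_coeff (chain n ((G @ [\<lambda>x. 1]) @ replicate j (?v n))) n"
      unfolding fourier_coeff_cmult[symmetric]
      by (intro fourier_coeff_diff L1_cmult Lc psob_L1[OF q] L1_const)
    finally show ?thesis .
  qed
  have 1: "decays (s + (length (G @ [q]) + j) - 1) (\<lambda>n. fourier_coeff (chain n ((G @ [q]) @ replicate j (?v n))) n)"
    by (rule Suc.IH) (use Suc.prems q in auto)
  have 2: "decays (s + (length (G @ [\<lambda>x. 1]) + j) - 1) (\<lambda>n. fourier_coeff (chain n ((G @ [\<lambda>x. 1]) @ replicate j (?v n))) n)"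
    by (rule Suc.IH) (use Suc.prems psob_const in auto)
  show ?case
    unfolding eq
  proof (rule decays_diff)
    show "decays (s + (length G + Suc j) - 1) (\<lambda>n. fourier_coeff (chain n ((G @ [q]) @ replicate j (?v n))) n)"
      using 1 by simp
    show "decays (s + (length G + Suc j) - 1) (\<lambda>n. z n * fourier_coeff (chain n ((G @ [\<lambda>x. 1]) @ replicate j (?v n))) n)"
      by (rule decays_bounded_mult[OF _ z]) (use 2 in simp)
  qed
qed

text \<open>By skewness of \<open>zprim\<close> both halves of \<open>Tn\<close> give the same
  coefficient of \<open>q * zprim q\<close>. This product is half the derivative of
  \<open>(zprim q)^2\<close>, and the factor \<open>kap n\<close> undoes the derivative.\<close>

lemma fourier_coeff_second_order:
  assumes q: "L1 q" "mean q = 0" and n: "n \<noteq> 0"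
  shows "fourier_coeff (\<lambda>x. q x * Tn n q x) n = - fourier_coeff (\<lambda>x. (zprim q x)\<^sup>2) n"
proof -
  define Z where "Z = zprim q"
  define h where "h = (\<lambda>t. fexp (- n) t * q t)"
  have Lh: "L1 h" unfolding h_def by (rule L1_fexp_mult[OF q(1)])
  have Zc: "continuous_on {0..1} Z" and hc: "continuous_on {0..1} (zprim h)"
    unfolding Z_def by (intro zprim_continuous q Lh)+
  have pZ: "prim q Z" using zprim_prim[OF q(1)] by (simp add: q(2) Z_def)
  have "fourier_coeff (\<lambda>x. q x * Tn n q x) n = mean (\<lambda>x. kap n * (q x * zprim h x - q x * Z x * fexp (- n) x))"
    unfolding fourier_coeff_mean by (intro mean_cong) (simp add: Tn_def h_def Z_def algebra_simps)
  also have "\<dots> = kap n * (mean (\<lambda>x. q x * zprim h x) - fourier_coeff (\<lambda>x. q x * Z x) n)"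
    unfolding mean_cmult fourier_coeff_mean
    by (subst mean_diff) (intro L1_mult_continuous fexp_continuous q Zc hc refl)+
  also have "mean (\<lambda>x. q x * zprim h x) = - fourier_coeff (\<lambda>x. q x * Z x) n"
    unfolding zprim_skew[OF q(1) Lh] fourier_coeff_mean by (simp add: Z_def h_def mult_ac)
  finally have 1: "fourier_coeff (\<lambda>x. q x * Tn n q x) n = - 2 * (kap n * fourier_coeff (\<lambda>x. q x * Z x) n)" by simp
  have "prim (\<lambda>x. 2 * (q x * Z x)) (\<lambda>x. (Z x)\<^sup>2)"
    by (rule prim_cong[OF prim_mult[OF pZ pZ]]) (simp_all add: power2_eq_square)
  from fourier_coeff_derivative[OF this _ n]
  have "fourier_coeff (\<lambda>x. (Z x)\<^sup>2) n = kap n * (2 * fourier_coeff (\<lambda>x. q x * Z x) n)"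
    by (simp add: Z_def zprim_periodic q fourier_coeff_cmult)
  then show ?thesis using 1 by (simp add: Z_def)
qed

text \<open>The mean-free primitive is \<open>Q - Q_0\<close>, and after squaring the constant
  disappears from every coefficient with \<open>n\<close> nonzero. This is the origin of the
  combination \<open>S_n - 2 Q_0 Q_n\<close>.\<close>

lemma fourier_coeff_zprim_square:
  assumes q: "L1 q" "mean q = 0" and n: "n \<noteq> 0"
  shows "fourier_coeff (\<lambda>x. (zprim q x)\<^sup>2) n = fourier_coeff (\<lambda>x. (primitive q x)\<^sup>2) n
    - 2 * fourier_coeff (primitive q) 0 * fourier_coeff (primitive q) n"
proof -
  let ?Q = "primitive q"
  have Qc: "continuous_on {0..1} ?Q"
    by (subst continuous_on_cong[OF refl, of _ _ "\<lambda>x. integral {0..x} q"])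
      (auto simp: primitive_def intro!: indefinite_integral_continuous_1 L1_integrable q)
  define c where "c = fourier_coeff ?Q 0"
  have m: "mean ?Q = c" by (simp add: c_def fourier_coeff_0)
  have z: "zprim q x = ?Q x - c" if "x \<in> {0..1}" for x
    unfolding m[symmetric] zprim_def q(2)
    using that by (simp add: primitive_def) (rule mean_cong, simp add: primitive_def)
  have "fourier_coeff (\<lambda>x. (zprim q x)\<^sup>2) n = fourier_coeff (\<lambda>x. ((?Q x)\<^sup>2 - (2 * c) * ?Q x) + c\<^sup>2) n"
    by (intro fourier_coeff_cong) (simp add: z power2_eq_square algebra_simps)
  also have "\<dots> = fourier_coeff (\<lambda>x. (?Q x)\<^sup>2) n - 2 * c * fourier_coeff ?Q n"
  proof -
    have "L1 (\<lambda>x. (?Q x)\<^sup>2)" "L1 (\<lambda>x. (2 * c) * ?Q x)"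
      using Qc by (auto intro!: L1_continuous continuous_intros)
    then show ?thesis
      using n by (simp add: fourier_coeff_add fourier_coeff_diff L1_diff L1_const fourier_coeff_const fourier_coeff_cmult)
  qed
  finally show ?thesis by (simp add: c_def)
qed

text \<open>Off-diagonal entry of the resonance matrix, truncated after \<open>N\<close> terms; the
  term with index \<open>k\<close> contains \<open>k\<close> resolvents.\<close>

definition beta :: "nat \<Rightarrow> (real \<Rightarrow> complex) \<Rightarrow> int \<Rightarrow> complex" where
  "beta N v n = (\<Sum>k<N. fourier_coeff (chain n (replicate (Suc k) v)) n)"

text \<open>The constant \<open>z n\<close> has no \<open>n\<close>-th coefficient, so it is absent
  from the first term. In the second it passes through \<open>Tn\<close> as the number
  \<open>- (kap n)^2\<close> and leaves only a multiple of \<open>(kap n)^2 * q_n\<close>, of order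
  \<open>s + 2\<close>. Terms with two or more resolvents have that order already.\<close>

lemma beta_asymptotics:
  assumes q: "psob s q" "mean q = 0" and z: "\<And>n. cmod (z n) \<le> C" and N: "N \<ge> 2"
  shows "decays (s + 2) (\<lambda>n. beta N (\<lambda>x. q x - z n) n -
     (fourier_coeff q n - fourier_coeff (\<lambda>x. (zprim q x)\<^sup>2) n))"
proof -
  let ?v = "\<lambda>n x. q x - z n"
  have Lq: "L1 q" by (rule psob_L1[OF q(1)])
  have Lv: "L1 (?v n)" for n by (intro L1_diff L1_const Lq)
  obtain M where M: "N = Suc (Suc M)" using N by (metis add_2_eq_Suc le_Suc_ex)
  have 0: "fourier_coeff (chain n (replicate (Suc 0) (?v n))) n = fourier_coeff q n" if "n \<noteq> 0" for n
    using that by (simp add: fourier_coeff_diff Lq L1_const fourier_coeff_const)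
  \<comment> \<open>Both mixed terms, \<open>Tn\<close> acting on \<open>z n\<close> and on
    \<open>q\<close>, give the same product \<open>z n * (kap n)^2 * q_n\<close>, hence the factor
    2; the term quadratic in \<open>z n\<close> is constant and drops out.\<close>
  have 1: "fourier_coeff (chain n (replicate (Suc 1) (?v n))) n =
      - fourier_coeff (\<lambda>x. (zprim q x)\<^sup>2) n + 2 * z n * (kap n * (kap n * fourier_coeff q n))" if n: "n \<noteq> 0" for n
  proof -
    have Tc: "continuous_on {0..1} (Tn n q)" by (rule Tn_continuous[OF Lq])
    have "fourier_coeff (chain n (replicate (Suc 1) (?v n))) n =
       fourier_coeff (\<lambda>x. (q x * Tn n q x + z n * (kap n)\<^sup>2 * q x) - (z n * Tn n q x + (z n)\<^sup>2 * (kap n)\<^sup>2)) n"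
    proof (rule fourier_coeff_cong)
      fix x :: real assume x: "x \<in> {0..1}"
      have "Tn n (?v n) x = Tn n q x + (kap n)\<^sup>2 * z n"
        using Tn_diff[OF Lq L1_const x, of n "z n"] Tn_const[OF n x, of "z n"] by simp
      moreover have "Tn n (\<lambda>x. ?v n x * 1) x = Tn n (?v n) x" by simp
      ultimately show "chain n (replicate (Suc 1) (?v n)) x =
        (q x * Tn n q x + z n * (kap n)\<^sup>2 * q x) - (z n * Tn n q x + (z n)\<^sup>2 * (kap n)\<^sup>2)"
        by (simp add: algebra_simps power2_eq_square)
    qed
    also have "\<dots> = (fourier_coeff (\<lambda>x. q x * Tn n q x) n + z n * (kap n)\<^sup>2 * fourier_coeff q n) -
       (z n * fourier_coeff (Tn n q) n + fourier_coeff (\<lambda>x. (z n)\<^sup>2 * (kap n)\<^sup>2) n)"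
      unfolding fourier_coeff_cmult[symmetric]
      by (subst fourier_coeff_diff fourier_coeff_add |
          intro refl L1_add L1_cmult L1_mult_continuous Tc Lq L1_const L1_continuous[OF Tc])+
    finally show ?thesis
      using n by (simp add: fourier_coeff_second_order[OF Lq q(2)] fourier_coeff_Tn[OF Lq] fourier_coeff_const power2_eq_square)
  qed
  have high: "decays (s + 2) (\<lambda>n. \<Sum>k<M. fourier_coeff (chain n (replicate (Suc (Suc (Suc k))) (?v n))) n)"
  proof -
    have "decays (s + 2) (\<lambda>n. \<Sum>k\<leftarrow>[0..<M]. fourier_coeff (chain n (replicate (Suc (Suc (Suc k))) (?v n))) n)"
    proof (rule decays_sum_list)
      fix k
      \<comment> \<open>A product of \<open>k + 3\<close> factors contains \<open>k + 2\<close>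
        resolvents, which is enough for order \<open>s + 2\<close>.\<close>
      have "decays (s + (length ([]::(real \<Rightarrow> complex) list) + Suc (Suc (Suc k))) - 1) (\<lambda>n. fourier_coeff (chain n ([] @ replicate (Suc (Suc (Suc k))) (?v n))) n)"
        by (rule decays_chain_perturbed[OF q(1) z]) auto
      then have "decays (s + 2 + k) (\<lambda>n. fourier_coeff (chain n (replicate (Suc (Suc (Suc k))) (?v n))) n)"
        by simp
      then show "decays (s + 2) (\<lambda>n. fourier_coeff (chain n (replicate (Suc (Suc (Suc k))) (?v n))) n)"
        by (rule decays_mono) simp
    qed
    then show ?thesis by (simp add: interv_sum_list_conv_sum_set_nat atLeast0LessThan)
  qed
  have dq: "decays s (fourier_coeff q)"
    using decays_chain[of "[q]" s] q(1) by simp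
  have "decays (Suc (Suc s)) (\<lambda>n. 2 * z n * (kap n * (kap n * fourier_coeff q n)))"
    by (rule decays_bounded_mult[of _ _ _ "2 * C"]) (use z dq in \<open>auto intro: decays_kap_mult simp: norm_mult\<close>)
  with high have "decays (s + 2) (\<lambda>n. 2 * z n * (kap n * (kap n * fourier_coeff q n)) +
      (\<Sum>k<M. fourier_coeff (chain n (replicate (Suc (Suc (Suc k))) (?v n))) n))"
    by (intro decays_add) simp_all
  also have "decays (s + 2) (\<lambda>n. 2 * z n * (kap n * (kap n * fourier_coeff q n)) +
      (\<Sum>k<M. fourier_coeff (chain n (replicate (Suc (Suc (Suc k))) (?v n))) n)) \<longleftrightarrow> ?thesis"
  proof (rule decays_cong)
    fix n :: int assume n: "n \<noteq> 0"
    have "beta N (?v n) n = fourier_coeff (chain n (replicate (Suc 0) (?v n))) n +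
       (fourier_coeff (chain n (replicate (Suc 1) (?v n))) n +
        (\<Sum>k<M. fourier_coeff (chain n (replicate (Suc (Suc (Suc k))) (?v n))) n))"
      unfolding beta_def M sum.lessThan_Suc_shift by (simp del: replicate.simps)
    then show "2 * z n * (kap n * (kap n * fourier_coeff q n)) +
      (\<Sum>k<M. fourier_coeff (chain n (replicate (Suc (Suc (Suc k))) (?v n))) n) =
      beta N (?v n) n - (fourier_coeff q n - fourier_coeff (\<lambda>x. (zprim q x)\<^sup>2) n)"
      unfolding 0[OF n] 1[OF n] by simp
  qed
  finally show ?thesis .
qed

text \<open>The reflected factor must involve the same shift, hence the evenness of
  \<open>z\<close>. Multiplying out \<open>a - t\<close> and its reflection gives
  \<open>P_coeff\<close> plus \<open>t n * t (- n)\<close>, and the latter is negligible because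
  \<open>t\<close> has order \<open>s + 1\<close>.\<close>

lemma beta_product_asymptotics:
  assumes q: "psob s q" "mean q = 0" and z: "\<And>n. cmod (z n) \<le> C" "\<And>n. z (- n) = z n" and N: "N \<ge> 2"
  shows "decays (2 * s + 2) (\<lambda>n. beta N (\<lambda>x. q x - z n) n * beta N (\<lambda>x. q x - z n) (- n) - P_coeff q n)"
proof -
  define a where "a = fourier_coeff q"
  define t where "t = fourier_coeff (\<lambda>x. (zprim q x)\<^sup>2)"
  define b where "b n = beta N (\<lambda>x. q x - z n) n" for n
  define e where "e n = b n - (a n - t n)" for n
  have Lq: "L1 q" by (rule psob_L1[OF q(1)])
  have da: "decays s a"
    using decays_chain[of "[q]" s] q(1) by (simp add: a_def)
  have dt: "decays (s + 1) t"
  proof -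
    have "decays (s + 1) (\<lambda>n. - fourier_coeff (chain n [q, q]) n)"
      using decays_minus[OF decays_chain[of "[q, q]" s]] q(1) by simp
    also have "decays (s + 1) (\<lambda>n. - fourier_coeff (chain n [q, q]) n) \<longleftrightarrow> decays (s + 1) t"
      by (rule decays_cong) (simp add: fourier_coeff_second_order[OF Lq q(2)] t_def)
    finally show ?thesis .
  qed
  have de: "decays (s + 2) e"
    unfolding e_def[abs_def] b_def a_def t_def by (rule beta_asymptotics[OF q z(1) N])
  have P: "P_coeff q n = a n * a (- n) - a n * t (- n) - a (- n) * t n" if "n \<noteq> 0" for n
    using that fourier_coeff_zprim_square[OF Lq q(2), of n] fourier_coeff_zprim_square[OF Lq q(2), of "- n"]
    by (simp add: P_coeff_def Let_def a_def t_def)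
  note m = decays_mono[OF decays_mult]
  \<comment> \<open>What remains after subtracting \<open>P_coeff\<close>: the product of the two
    \<open>t\<close> has order \<open>2 * (s + 1)\<close>, and every other term pairs some
    \<open>e\<close> of order \<open>s + 2\<close> with a factor of order at least
    \<open>s\<close>.\<close>
  have "decays (2 * s + 2) (\<lambda>n. t n * t (- n) + (a n - t n) * e (- n) + e n * (a (- n) - t (- n)) + e n * e (- n))"
    by (intro decays_add m[OF dt decays_reflect[OF dt]] m[OF decays_diff[OF da decays_mono[OF dt]] decays_reflect[OF de]]
        m[OF de decays_diff[OF decays_reflect[OF da] decays_mono[OF decays_reflect[OF dt]]]] m[OF de decays_reflect[OF de]]) simp_all
  also have "decays (2 * s + 2) (\<lambda>n. t n * t (- n) + (a n - t n) * e (- n) + e n * (a (- n) - t (- n)) + e n * e (- n)) \<longleftrightarrow>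
     decays (2 * s + 2) (\<lambda>n. b n * b (- n) - P_coeff q n)"
  proof (rule decays_cong)
    fix n :: int assume n: "n \<noteq> 0"
    have b: "b n = e n + (a n - t n)" for n by (simp add: e_def)
    show "t n * t (- n) + (a n - t n) * e (- n) + e n * (a (- n) - t (- n)) + e n * e (- n) = b n * b (- n) - P_coeff q n"
      unfolding P[OF n] b by (simp add: algebra_simps)
  qed
  finally show ?thesis by (simp add: b_def z(2))
qed

section \<open>Reduction to the two resonant modes\<close>

lemma has_integral_reflect_unit:
  fixes f :: "real \<Rightarrow> 'a::euclidean_space"
  assumes "(f has_integral i) {a..b}"
  shows "((\<lambda>x. f (1 - x)) has_integral i) {1 - b..1 - a}"
proof -
  have "((\<lambda>x. f ((-1) *\<^sub>R x + 1)) has_integral (1 / \<bar>-1::real\<bar> ^ DIM(real)) *\<^sub>R i) ((\<lambda>x. (1 / (-1::real)) *\<^sub>R x + - ((1 / -1) *\<^sub>R 1)) ` cbox a b)"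
    by (rule has_integral_affinity) (use assms in auto)
  moreover have "(\<lambda>x. (1 / (-1::real)) *\<^sub>R x + - ((1 / -1) *\<^sub>R 1)) ` cbox a b = {1 - b..1 - a}"
    by (auto simp: image_iff intro!: bexI[of _ "1 - _"])
  ultimately show ?thesis by (simp add: algebra_simps)
qed

lemma L1_reflect: "L1 f \<Longrightarrow> L1 (\<lambda>x. f (1 - x))"
proof -
  assume f: "L1 f"
  have "(\<lambda>x. f (1 - x)) integrable_on {0..1}"
    using has_integral_reflect_unit[OF integrable_integral[OF L1_integrable[OF f]]] by auto
  moreover have "(\<lambda>x. cmod (f (1 - x))) integrable_on {0..1}"
    using has_integral_reflect_unit[OF integrable_integral[OF L1_norm_integrable[OF f]]] by auto
  ultimately show ?thesis by (rule L1_I)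
qed

lemma L1_cnj: "L1 f \<Longrightarrow> L1 (\<lambda>x. cnj (f x))"
  by (rule L1_I) (auto dest: L1_integrable L1_norm_integrable simp: integrable_on_cnj_iff)

lemma mean_reflect: "L1 f \<Longrightarrow> mean (\<lambda>x. f (1 - x)) = mean f"
  unfolding mean_def
  using has_integral_reflect_unit[OF integrable_integral[OF L1_integrable[of f]]] by (auto intro: integral_unique)

lemma mean_cnj: "mean (\<lambda>x. cnj (f x)) = cnj (mean f)"
  by (simp add: mean_def integral_cnj)

lemma prim_cnj: "prim f F \<Longrightarrow> prim (\<lambda>x. cnj (f x)) (\<lambda>x. cnj (F x))"
  by (auto simp: prim_def L1_cnj simp flip: integral_cnj)

lemma prim_reflect:
  assumes "prim f F"
  shows "prim (\<lambda>x. - f (1 - x)) (\<lambda>x. F (1 - x))"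
  unfolding prim_def
proof (intro conjI ballI)
  show "L1 (\<lambda>x. - f (1 - x))"
    using L1_cmult[OF L1_reflect[OF prim_L1[OF assms]], of "-1"] by simp
  fix x :: real assume x: "x \<in> {0..1}"
  have "(f has_integral F 1 - F (1 - x)) {1 - x..1}"
    using prim_integral_diff[OF assms, of "1 - x" 1] x L1_subinterval[OF prim_L1[OF assms], of "1 - x" 1]
    by (auto simp: has_integral_iff)
  from has_integral_reflect_unit[OF this]
  show "integral {0..x} (\<lambda>x. - f (1 - x)) = F (1 - x) - F (1 - 0)"
    by (auto simp: integral_unique)
qed

text \<open>The symmetry of \<open>q\<close> shifted by one period, so that it becomes a reflection
  of \<open>{0..1}\<close> about its midpoint. For integrable functions it makes all Fourier
  coefficients real.\<close>

definition psym :: "(real \<Rightarrow> complex) \<Rightarrow> bool" where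
  "psym f \<longleftrightarrow> (\<forall>x\<in>{0..1}. cnj (f (1 - x)) = f x)"

lemma psym_mult: "psym f \<Longrightarrow> psym g \<Longrightarrow> psym (\<lambda>x. f x * g x)"
  by (simp add: psym_def)

lemma psym_fexp: "psym (fexp n)"
  by (simp add: psym_def cnj_fexp_reflect)

lemma psym_mean: "L1 f \<Longrightarrow> psym f \<Longrightarrow> mean f \<in> \<real>"
proof -
  assume f: "L1 f" "psym f"
  have "cnj (mean f) = mean (\<lambda>x. cnj (f (1 - x)))"
    using mean_reflect[OF L1_cnj[OF f(1)]] by (simp add: mean_cnj)
  also have "\<dots> = mean f" by (rule mean_cong) (use f(2) in \<open>auto simp: psym_def\<close>)
  finally show ?thesis by (simp add: Reals_cnj_iff)
qed

lemma psym_zprim: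
  assumes f: "L1 f" "psym f" and x: "x \<in> {0..1}"
  shows "cnj (zprim f (1 - x)) = - zprim f x"
proof -
  have r: "cnj (mean f) = mean f" using psym_mean[OF f] by (simp add: Reals_cnj_iff)
  have "prim (\<lambda>x. - 1 * cnj (- (f (1 - x) - mean f))) (\<lambda>x. - 1 * cnj (zprim f (1 - x)))"
    by (intro prim_cmult prim_cnj prim_reflect zprim_prim f)
  then have "prim (\<lambda>x. f x - mean f) (\<lambda>x. - 1 * cnj (zprim f (1 - x)))"
    by (rule prim_cong) (use f(2) r in \<open>auto simp: psym_def\<close>)
  from zprim_unique(2)[OF f(1) this _ x]
  have "- 1 * cnj (zprim f (1 - x)) = mean (\<lambda>x. - 1 * cnj (zprim f (1 - x))) + zprim f x"
    by (simp add: zprim_periodic f)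
  also have "mean (\<lambda>x. - 1 * cnj (zprim f (1 - x))) = - 1 * cnj (mean (zprim f))"
    unfolding mean_cmult mean_cnj mean_reflect[OF L1_continuous[OF zprim_continuous[OF f(1)]]] ..
  finally show ?thesis by (simp add: zprim_mean f) (metis minus_equation_iff)
qed

text \<open>A primitive changes sign under the reflection, and so does the purely imaginary number
  \<open>kap n\<close> under conjugation; the two signs cancel.\<close>

lemma psym_Tn:
  assumes f: "L1 f" "psym f"
  shows "psym (Tn n f)"
  unfolding psym_def
proof
  fix x :: real assume x: "x \<in> {0..1}"
  have "cnj (zprim (\<lambda>t. fexp (- n) t * f t) (1 - x)) = - zprim (\<lambda>t. fexp (- n) t * f t) x"
    by (intro psym_zprim L1_fexp_mult psym_mult psym_fexp f x)
  moreover have "cnj (kap n) = - kap n" by (simp add: kap_def)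
  ultimately show "cnj (Tn n f (1 - x)) = Tn n f x"
    unfolding Tn_def complex_cnj_mult complex_cnj_diff cnj_fexp_reflect psym_zprim[OF f x] by (simp add: algebra_simps)
qed

lemma psym_chain: "(\<And>f. f \<in> set F \<Longrightarrow> L1 f \<and> psym f) \<Longrightarrow> psym (chain n F)"
proof (induction F)
  case Nil
  show ?case by (simp add: psym_def)
next
  case (Cons f F)
  have "L1 (chain n F)" by (rule L1_chain) (use Cons.prems in auto)
  then have "psym (Tn n (chain n F))" using Cons by (intro psym_Tn) auto
  then show ?case using Cons.prems by (cases "F = []") (auto intro!: psym_mult)
qed

text \<open>\<open>Tn_adjoint\<close> transfers one resolvent at a time from the right factor to the
  left, turning \<open>n\<close> into \<open>- n\<close>; since all factors are equal, the reversed
  product has the same form.\<close>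

lemma mean_chain_reverse:
  assumes v: "L1 v"
  shows "mean (\<lambda>x. chain (- n) (replicate (Suc i) v) x * Tn n (chain n (replicate (Suc j) v)) x) =
    mean (chain (- n) (replicate (Suc (Suc (i + j))) v))"
proof (induction j arbitrary: i)
  case 0
  have L: "L1 (chain (- n) (replicate (Suc i) v))" by (rule L1_chain) (use v in auto)
  have "chain n (replicate (Suc 0) v) = v" by simp
  then show ?case
    using Tn_adjoint[OF L v, of n] by (simp add: mult.commute)
next
  case (Suc j)
  have L: "L1 (chain (- n) (replicate (Suc i) v))" "L1 (chain n (replicate (Suc j) v))"
    by (rule L1_chain; use v in auto)+
  let ?g = "\<lambda>x. v x * Tn n (chain n (replicate (Suc j) v)) x"
  have g: "L1 ?g" by (intro L1_mult_continuous v Tn_continuous L)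
  have "chain n (replicate (Suc (Suc j)) v) = ?g" by simp
  then have "mean (\<lambda>x. chain (- n) (replicate (Suc i) v) x * Tn n (chain n (replicate (Suc (Suc j)) v)) x) =
     mean (\<lambda>x. Tn (- n) (chain (- n) (replicate (Suc i) v)) x * ?g x)"
    using Tn_adjoint[OF L(1) g, of n] by simp
  also have "\<dots> = mean (\<lambda>x. chain (- n) (replicate (Suc (Suc i)) v) x * Tn n (chain n (replicate (Suc j) v)) x)"
    by (intro mean_cong) simp
  also have "\<dots> = mean (chain (- n) (replicate (Suc (Suc (Suc i + j))) v))"
    by (rule Suc.IH)
  finally show ?case by simp
qed

text \<open>Makes the two diagonal entries of the resonance matrix coincide, so that its determinant
  contains the square of one number rather than a product.\<close>

lemma mean_chain_minus:
  assumes v: "L1 v"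
  shows "mean (chain (- n) (replicate k v)) = mean (chain n (replicate k v))"
proof -
  consider "k = 0" | "k = 1" | j where "k = Suc (Suc j)"
    by (metis One_nat_def old.nat.exhaust)
  then show ?thesis
  proof cases
    case 3
    have "mean (chain n (replicate (Suc (Suc j)) v)) =
       mean (\<lambda>x. chain (- n) (replicate (Suc 0) v) x * Tn n (chain n (replicate (Suc j) v)) x)"
      by (intro mean_cong) simp
    also have "\<dots> = mean (chain (- n) (replicate (Suc (Suc (0 + j))) v))"
      by (rule mean_chain_reverse[OF v])
    finally show ?thesis using 3 by simp
  qed simp_all
qed

text \<open>The exponential in the innermost factor is pulled outwards, and by
  \<open>Tn_shift\<close> every resolvent it passes becomes \<open>Tn (- n)\<close>. This explains
  why the coefficient of \<open>a\<close> involves \<open>beta\<close> at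
  \<open>- n\<close>.\<close>

lemma chain_fexp:
  assumes v: "L1 v" "x \<in> {0..1}"
  shows "chain n (replicate k v @ [\<lambda>x. v x * fexp n x]) x = fexp n x * chain (- n) (replicate (Suc k) v) x"
  using v(2)
proof (induction k arbitrary: x)
  case (Suc k)
  have L: "L1 (chain (- n) (replicate (Suc k) v))" by (rule L1_chain) (use v in auto)
  have "Tn n (chain n (replicate k v @ [\<lambda>x. v x * fexp n x])) x =
     Tn n (\<lambda>x. fexp n x * chain (- n) (replicate (Suc k) v) x) x"
    by (rule Tn_cong) (use Suc in auto)
  also have "\<dots> = fexp n x * Tn (- n) (chain (- n) (replicate (Suc k) v)) x"
    by (rule Tn_shift[OF L Suc.prems])
  finally show ?case by simp
qed simp

section \<open>The two-by-two resonance system\<close>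

text \<open>After removing the fast phase, an (anti)periodic eigenfunction with eigenvalue
  \<open>(pi n)\<^sup>2 + z\<close> becomes a solution \<open>u\<close> of this fixed point equation.\<close>

definition resonant :: "(real \<Rightarrow> complex) \<Rightarrow> int \<Rightarrow> complex \<Rightarrow> bool" where
  "resonant q n z \<longleftrightarrow> (\<exists>u b a. continuous_on {0..1} u \<and> (\<exists>x\<in>{0..1}. u x \<noteq> 0) \<and>
     mean (\<lambda>x. (q x - z) * u x) = 0 \<and> fourier_coeff (\<lambda>x. (q x - z) * u x) n = 0 \<and>
     (\<forall>x\<in>{0..1}. u x = b + a * fexp n x + Tn n (\<lambda>x. (q x - z) * u x) x))"

text \<open>Diagonal entry of the resonance matrix, truncated like \<open>beta\<close>.\<close>

definition diag :: "nat \<Rightarrow> (real \<Rightarrow> complex) \<Rightarrow> int \<Rightarrow> complex" where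
  "diag N v n = (\<Sum>k<N. mean (chain n (replicate (Suc k) v)))"

text \<open>One iteration: the fixed point equation is substituted for \<open>u\<close> in the
  innermost factor, which splits off the contributions of \<open>b\<close> and \<open>a\<close> and
  lengthens the product by one.\<close>

lemma chain_expansion:
  assumes v: "L1 v" and u: "continuous_on {0..1} u"
    and eq: "\<And>x. x \<in> {0..1} \<Longrightarrow> u x = b + a * fexp n x + Tn n (\<lambda>x. v x * u x) x" and x: "x \<in> {0..1}"
  shows "chain n (replicate k v @ [\<lambda>x. v x * u x]) x =
     b * chain n (replicate (Suc k) v) x + a * (fexp n x * chain (- n) (replicate (Suc k) v) x) +
     chain n (replicate (Suc k) v @ [\<lambda>x. v x * u x]) x"
proof -
  let ?w = "\<lambda>x. v x * u x"
  have w: "L1 ?w" by (rule L1_mult_continuous[OF v u])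
  have vf: "L1 (\<lambda>x. v x * fexp n x)" by (rule L1_mult_continuous[OF v fexp_continuous])
  have vT: "L1 (\<lambda>x. v x * Tn n ?w x)" by (rule L1_mult_continuous[OF v Tn_continuous[OF w]])
  have L: "L1 (chain n (replicate k v @ [f]))" if "L1 f" for f
    by (rule L1_chain) (use v that in auto)
  have cong: "chain n (replicate k v @ [f]) x = chain n (replicate k v @ [g]) x"
    if "\<And>x. x \<in> {0..1} \<Longrightarrow> f x = g x" "x \<in> {0..1}" for f g x
    using that(2)
  proof (induction k arbitrary: x)
    case (Suc k)
    have "Tn n (chain n (replicate k v @ [f])) x = Tn n (chain n (replicate k v @ [g])) x"
      by (rule Tn_cong) (use Suc in auto)
    then show ?case by simp
  qed (use that(1) in simp)
  have lin: "chain n (replicate k v @ [\<lambda>x. f x - c * g x]) x =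
     chain n (replicate k v @ [f]) x - c * chain n (replicate k v @ [g]) x"
    if "L1 f" "L1 g" for f g c
    by (rule chain_linear[OF _ that x]) (use v in auto)
  have "chain n (replicate k v @ [?w]) x =
     chain n (replicate k v @ [\<lambda>x. (v x * Tn n ?w x - (- b) * v x) - (- a) * (v x * fexp n x)]) x"
    by (rule cong[OF _ x]) (subst eq, auto simp: algebra_simps)
  also have "\<dots> = chain n (replicate k v @ [\<lambda>x. v x * Tn n ?w x]) x + b * chain n (replicate k v @ [v]) x
      + a * chain n (replicate k v @ [\<lambda>x. v x * fexp n x]) x"
    by (simp only: lin[OF L1_diff[OF vT L1_cmult[OF v]] vf] lin[OF vT v]) simp
  also have "chain n (replicate k v @ [\<lambda>x. v x * Tn n ?w x]) x = chain n (replicate (Suc k) v @ [?w]) x"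
  proof -
    have "replicate k v @ [v, ?w] = replicate (Suc k) v @ [?w]" by (induction k) auto
    then show ?thesis using chain_snoc[OF x, of n "replicate k v" v ?w] by (simp only:)
  qed
  also have "chain n (replicate k v @ [v]) x = chain n (replicate (Suc k) v) x"
    by (simp add: replicate_append_same)
  also have "chain n (replicate k v @ [\<lambda>x. v x * fexp n x]) x = fexp n x * chain (- n) (replicate (Suc k) v) x"
    by (rule chain_fexp[OF v x])
  finally show ?thesis by simp
qed

text \<open>The iterations telescope. Reading the result in the modes \<open>0\<close> and
  \<open>n\<close> gives the two rows of the system: the contribution of \<open>a\<close> carries
  \<open>fexp n\<close>, which shifts its mode by \<open>n\<close>, and
  \<open>mean_chain_minus\<close> identifies the second diagonal entry with the first.\<close>

lemma chain_expansion_sum: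
  assumes v: "L1 v" and u: "continuous_on {0..1} u"
    and eq: "\<And>x. x \<in> {0..1} \<Longrightarrow> u x = b + a * fexp n x + Tn n (\<lambda>x. v x * u x) x"
  shows "mean (\<lambda>x. v x * u x) = b * diag N v n + a * beta N v (- n) + mean (chain n (replicate N v @ [\<lambda>x. v x * u x]))"
    and "fourier_coeff (\<lambda>x. v x * u x) n = b * beta N v n + a * diag N v n + fourier_coeff (chain n (replicate N v @ [\<lambda>x. v x * u x])) n"
proof -
  let ?w = "\<lambda>x. v x * u x"
  have w: "L1 ?w" by (rule L1_mult_continuous[OF v u])
  have L: "L1 (chain n (replicate k v @ [?w]))" "L1 (chain m (replicate k v))" for k m
    by (rule L1_chain; use v w in auto)+
  have fm: "fourier_coeff f 0 = mean f" for f by (rule fourier_coeff_0)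
  have step: "fourier_coeff (chain n (replicate k v @ [?w])) m = b * fourier_coeff (chain n (replicate (Suc k) v)) m +
      a * fourier_coeff (chain (- n) (replicate (Suc k) v)) (m - n) + fourier_coeff (chain n (replicate (Suc k) v @ [?w])) m" for k m
  proof -
    have "fourier_coeff (chain n (replicate k v @ [?w])) m =
      fourier_coeff (\<lambda>x. b * chain n (replicate (Suc k) v) x + a * (fexp n x * chain (- n) (replicate (Suc k) v) x) +
     chain n (replicate (Suc k) v @ [?w]) x) m"
      by (intro fourier_coeff_cong chain_expansion[OF v u eq])
    also have "\<dots> = b * fourier_coeff (chain n (replicate (Suc k) v)) m +
      a * fourier_coeff (\<lambda>x. fexp n x * chain (- n) (replicate (Suc k) v) x) m + fourier_coeff (chain n (replicate (Suc k) v @ [?w])) m"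
      unfolding fourier_coeff_cmult[symmetric]
      by (subst fourier_coeff_add | intro refl L1_add L1_cmult L1_fexp_mult L)+
    also have "fourier_coeff (\<lambda>x. fexp n x * chain (- n) (replicate (Suc k) v) x) m = fourier_coeff (chain (- n) (replicate (Suc k) v)) (m - n)"
      unfolding fourier_coeff_mean
    proof (intro mean_cong)
      fix x :: real
      have "fexp n x * fexp (- m) x = fexp (- (m - n)) x" by (simp add: fexp_add)
      then show "fexp n x * chain (- n) (replicate (Suc k) v) x * fexp (- m) x =
        chain (- n) (replicate (Suc k) v) x * fexp (- (m - n)) x"
        by (metis mult.assoc mult.commute)
    qed
    finally show ?thesis .
  qed
  have tot: "fourier_coeff ?w m = b * (\<Sum>k<N. fourier_coeff (chain n (replicate (Suc k) v)) m) +
      a * (\<Sum>k<N. fourier_coeff (chain (- n) (replicate (Suc k) v)) (m - n)) + fourier_coeff (chain n (replicate N v @ [?w])) m" for m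
  proof (induction N)
    case 0
    then show ?case by simp
  next
    case (Suc N)
    then show ?case using step[of N m] by (simp add: algebra_simps del: replicate.simps)
  qed
  show "mean ?w = b * diag N v n + a * beta N v (- n) + mean (chain n (replicate N v @ [?w]))"
    using tot[of 0] by (simp add: fm beta_def diag_def del: replicate.simps)
  show "fourier_coeff ?w n = b * beta N v n + a * diag N v n + fourier_coeff (chain n (replicate N v @ [?w])) n"
    using tot[of n] by (simp add: fm beta_def diag_def mean_chain_minus[OF v] del: replicate.simps)
qed

text \<open>The first bound confines the shift without assuming it small, which the choice of a
  bounded sequence of shifts needs. The second says that the truncated system has a nearly vanishing
  determinant.\<close>

lemma resonant_bounds:
  assumes q: "L1 q" and n: "n \<noteq> 0" and small: "8 * cmod (kap n) * norm1 (\<lambda>x. q x - z) \<le> 1 / 2"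
    and res: "resonant q n z"
  defines "v \<equiv> \<lambda>x. q x - z"
  shows "cmod z \<le> 4 * norm1 q"
    and "cmod ((diag N v n)\<^sup>2 - beta N v n * beta N v (- n)) \<le> 8 * real N * (norm1 v)\<^sup>2 * (8 * cmod (kap n) * norm1 v) ^ N"
proof -
  obtain u b a where u: "continuous_on {0..1} u" and nz: "\<exists>x\<in>{0..1}. u x \<noteq> 0"
    and m0: "mean (\<lambda>x. v x * u x) = 0" and mn: "fourier_coeff (\<lambda>x. v x * u x) n = 0"
    and eq: "\<And>x. x \<in> {0..1} \<Longrightarrow> u x = b + a * fexp n x + Tn n (\<lambda>x. v x * u x) x"
    using res unfolding resonant_def v_def by blast
  let ?w = "\<lambda>x. v x * u x"
  define S where "S = cmod b + cmod a"
  have v: "L1 v" unfolding v_def by (intro L1_diff L1_const q)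
  have w: "L1 ?w" by (rule L1_mult_continuous[OF v u])
  define e where "e = 8 * cmod (kap n) * norm1 v"
  have e: "0 \<le> e" "e \<le> 1 / 2" using small by (auto simp: e_def v_def norm1_nonneg)
  obtain x0 where x0: "x0 \<in> {0..1}" "\<And>x. x \<in> {0..1} \<Longrightarrow> cmod (u x) \<le> cmod (u x0)"
  proof -
    have "continuous_on {0..1} (\<lambda>x. cmod (u x))" using u by (intro continuous_intros)
    from continuous_attains_sup[OF _ _ this] show thesis using that by auto
  qed
  \<comment> \<open>The supremum of \<open>u\<close> is controlled by \<open>b\<close> and
    \<open>a\<close> alone, since the smallness hypothesis allows the \<open>Tn\<close> term to be
    absorbed. In particular \<open>b\<close> and \<open>a\<close> cannot both vanish.\<close>
  define M where "M = cmod (u x0)"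
  have w1: "norm1 ?w \<le> M * norm1 v"
    unfolding M_def by (rule norm1_mult_le[OF v u x0(2)])
  have "M \<le> cmod b + cmod (a * fexp n x0) + cmod (Tn n ?w x0)"
    unfolding M_def by (subst eq[OF x0(1)]) (intro norm_triangle_mono norm_triangle_ineq order_refl)
  also have "cmod (Tn n ?w x0) \<le> 8 * cmod (kap n) * norm1 ?w" by (rule Tn_bound[OF w x0(1)])
  also have "\<dots> \<le> 8 * cmod (kap n) * (M * norm1 v)" by (intro mult_left_mono w1) auto
  also have "\<dots> = e * M" by (simp add: e_def)
  also have "\<dots> \<le> 1 / 2 * M" using e by (intro mult_right_mono) (auto simp: M_def)
  finally have M: "M \<le> 2 * S" by (simp add: S_def norm_mult)
  have "0 < M"
    using nz x0(2) unfolding M_def by (metis less_le_trans zero_less_norm_iff)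
  then have S: "S > 0" using M by simp
  have Lu: "L1 u" by (rule L1_continuous[OF u])
  have Tc: "L1 (Tn n ?w)" by (rule L1_continuous[OF Tn_continuous[OF w]])
  have fu: "fourier_coeff u k = fourier_coeff (\<lambda>x. b) k + a * fourier_coeff (fexp n) k + fourier_coeff (Tn n ?w) k" for k
  proof -
    have "fourier_coeff u k = fourier_coeff (\<lambda>x. b + a * fexp n x + Tn n ?w x) k"
      by (intro fourier_coeff_cong eq)
    also have "\<dots> = fourier_coeff (\<lambda>x. b) k + fourier_coeff (\<lambda>x. a * fexp n x) k + fourier_coeff (Tn n ?w) k"
      by (subst fourier_coeff_add | intro refl L1_add L1_cmult L1_const Tc L1_continuous[OF fexp_continuous])+
    finally show ?thesis by (simp add: fourier_coeff_cmult)
  qed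
  \<comment> \<open>The solvability conditions make the \<open>Tn\<close> term vanish in both
    resonant modes, so \<open>b\<close> and \<open>a\<close> are Fourier coefficients of
    \<open>u\<close>. Then \<open>z * b\<close> and \<open>z * a\<close> are coefficients of
    \<open>q * u\<close>, which bounds \<open>z\<close>.\<close>
  have ub: "mean u = b"
    using fu[of 0] n by (simp add: fourier_coeff_0 mean_const mean_fexp fourier_coeff_Tn[OF w n] m0)
  have ua: "fourier_coeff u n = a"
  proof -
    have "fourier_coeff (fexp n) n = 1" by (simp add: fourier_coeff_mean mean_const)
    then show ?thesis using fu[of n] n by (simp add: fourier_coeff_const fourier_coeff_Tn[OF w n] mn)
  qed
  have qu: "L1 (\<lambda>x. q x * u x)" by (rule L1_mult_continuous[OF q u])
  have w_eq: "?w = (\<lambda>x. q x * u x - z * u x)" by (auto simp: v_def algebra_simps)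
  have q1: "norm1 (\<lambda>x. q x * u x) \<le> M * norm1 q"
    unfolding M_def by (rule norm1_mult_le[OF q u x0(2)])
  have zb: "z * b = mean (\<lambda>x. q x * u x)"
    using m0 unfolding w_eq mean_diff[OF qu L1_cmult[OF Lu]] mean_cmult ub by simp
  have za: "z * a = fourier_coeff (\<lambda>x. q x * u x) n"
    using mn unfolding w_eq fourier_coeff_diff[OF qu L1_cmult[OF Lu]] fourier_coeff_cmult ua by simp
  have "cmod z * S = cmod (z * b) + cmod (z * a)"
    by (simp add: S_def norm_mult algebra_simps)
  also have "\<dots> \<le> norm1 (\<lambda>x. q x * u x) + norm1 (\<lambda>x. q x * u x)"
    unfolding zb za by (intro add_mono norm_mean_le norm_fourier_coeff_le qu)
  also have "\<dots> \<le> 2 * (M * norm1 q)" using q1 by simp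
  also have "\<dots> \<le> 2 * ((2 * S) * norm1 q)"
    using M by (intro mult_left_mono mult_right_mono norm1_nonneg) auto
  finally have "cmod z * S \<le> (4 * norm1 q) * S" by (simp add: mult_ac)
  then show "cmod z \<le> 4 * norm1 q" using S by simp
  define d where "d = diag N v n"
  define b1 where "b1 = beta N v n"
  define b2 where "b2 = beta N v (- n)"
  \<comment> \<open>The remainder after \<open>N\<close> iterations relative to \<open>S\<close>:
    \<open>N\<close> resolvents give \<open>e ^ N\<close>, and the 2 comes from
    \<open>M <= 2 * S\<close>.\<close>
  define \<rho> where "\<rho> = 2 * e ^ N * norm1 v"
  let ?R = "chain n (replicate N v @ [?w])"
  have R: "L1 ?R" by (rule L1_chain) (use v w in auto)
  have "norm1 ?R \<le> (8 * cmod (kap n)) ^ (length (replicate N v @ [?w]) - 1) * prod_list (map norm1 (replicate N v @ [?w]))"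
    by (rule norm1_chain) (use v w in auto)
  also have "\<dots> = e ^ N * norm1 ?w"
    by (simp add: e_def power_mult_distrib prod_list_replicate)
  also have "\<dots> \<le> e ^ N * ((2 * S) * norm1 v)"
    using w1 M e by (intro mult_left_mono order_trans[OF w1] mult_right_mono norm1_nonneg) auto
  finally have nR: "norm1 ?R \<le> \<rho> * S" by (simp add: \<rho>_def mult_ac)
  have e1: "cmod (b * d + a * b2) \<le> \<rho> * S"
  proof -
    have "b * d + a * b2 = - mean ?R"
      using chain_expansion_sum(1)[OF v u eq, of N] m0 by (simp add: d_def b2_def eq_neg_iff_add_eq_0)
    then show ?thesis using norm_mean_le[OF R] nR by simp
  qed
  have e2: "cmod (b * b1 + a * d) \<le> \<rho> * S"
  proof -
    have "b * b1 + a * d = - fourier_coeff ?R n"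
      using chain_expansion_sum(2)[OF v u eq, of N] mn by (simp add: d_def b1_def eq_neg_iff_add_eq_0)
    then show ?thesis using norm_fourier_coeff_le[OF R, of n] nR by simp
  qed
  have chain_le: "norm1 (chain m (replicate (Suc k) v)) \<le> norm1 v" if "m = n \<or> m = - n" for m k
  proof -
    have "norm1 (chain m (replicate (Suc k) v)) \<le>
       (8 * cmod (kap m)) ^ (length (replicate (Suc k) v) - 1) * prod_list (map norm1 (replicate (Suc k) v))"
      by (rule norm1_chain) (use v in auto)
    also have "\<dots> = e ^ k * norm1 v"
      using that by (auto simp: e_def power_mult_distrib prod_list_replicate kap_minus)
    also have "\<dots> \<le> 1 * norm1 v"
      using e by (intro mult_right_mono norm1_nonneg power_le_one) auto
    finally show ?thesis by simp
  qed
  have Lc: "L1 (chain m (replicate (Suc k) v))" for m k by (rule L1_chain) (use v in auto)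
  have dB: "cmod d \<le> N * norm1 v"
    unfolding d_def diag_def
    by (rule order_trans[OF norm_sum], rule order_trans[OF sum_bounded_above[of _ _ "norm1 v"]])
      (auto simp del: replicate.simps intro: order_trans[OF norm_mean_le[OF Lc] chain_le])
  have bB: "cmod (beta N v m) \<le> N * norm1 v" if "m = n \<or> m = - n" for m
    unfolding beta_def
    by (rule order_trans[OF norm_sum], rule order_trans[OF sum_bounded_above[of _ _ "norm1 v"]])
      (auto simp del: replicate.simps intro!: order_trans[OF norm_fourier_coeff_le[OF Lc] chain_le[OF that]])
  have b1B: "cmod b1 \<le> N * norm1 v" and b2B: "cmod b2 \<le> N * norm1 v"
    unfolding b1_def b2_def by (intro bB; simp)+
  have \<rho>0: "\<rho> * S \<ge> 0" using e S by (auto simp: \<rho>_def norm1_nonneg)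
  \<comment> \<open>Cramer's rule without division: the determinant times \<open>b\<close>, and
    times \<open>a\<close>, is a combination of the two small residuals.\<close>
  define D where "D = d\<^sup>2 - b1 * b2"
  have "D * b = d * (b * d + a * b2) - b2 * (b * b1 + a * d)"
    by (simp add: D_def power2_eq_square algebra_simps)
  then have "cmod (D * b) \<le> cmod d * cmod (b * d + a * b2) + cmod b2 * cmod (b * b1 + a * d)"
    by (metis norm_triangle_ineq4 norm_mult)
  also have "\<dots> \<le> (N * norm1 v) * (\<rho> * S) + (N * norm1 v) * (\<rho> * S)"
    by (intro add_mono mult_mono dB b2B e1 e2) (auto simp: norm1_nonneg)
  finally have 1: "cmod D * cmod b \<le> 2 * ((N * norm1 v) * (\<rho> * S))" by (simp only: norm_mult mult_2)
  have "D * a = d * (b * b1 + a * d) - b1 * (b * d + a * b2)"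
    by (simp add: D_def power2_eq_square algebra_simps)
  then have "cmod (D * a) \<le> cmod d * cmod (b * b1 + a * d) + cmod b1 * cmod (b * d + a * b2)"
    by (metis norm_triangle_ineq4 norm_mult)
  also have "\<dots> \<le> (N * norm1 v) * (\<rho> * S) + (N * norm1 v) * (\<rho> * S)"
    by (intro add_mono mult_mono dB b1B e1 e2) (auto simp: norm1_nonneg)
  finally have 2: "cmod D * cmod a \<le> 2 * ((N * norm1 v) * (\<rho> * S))" by (simp only: norm_mult mult_2)
  have "cmod D * S \<le> (4 * ((N * norm1 v) * \<rho>)) * S"
    using 1 2 by (simp add: S_def algebra_simps)
  then have "cmod D \<le> 4 * ((N * norm1 v) * \<rho>)" using S by simp
  then show "cmod ((diag N v n)\<^sup>2 - beta N v n * beta N v (- n)) \<le> 8 * real N * (norm1 v)\<^sup>2 * (8 * cmod (kap n) * norm1 v) ^ N"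
    by (simp add: D_def d_def b1_def b2_def \<rho>_def e_def power2_eq_square mult_ac)
qed

section \<open>Exclusion of resonances for large \<open>n\<close>\<close>

lemma psym_diff_const: "psym q \<Longrightarrow> z \<in> \<real> \<Longrightarrow> psym (\<lambda>x. q x - z)"
  by (auto simp: psym_def Reals_cnj_iff)

lemma psym_diag_real: "L1 v \<Longrightarrow> psym v \<Longrightarrow> diag N v n \<in> \<real>"
  unfolding diag_def by (intro sum_in_Reals psym_mean L1_chain psym_chain) auto

lemma eight_kap_le:
  assumes "n > 0"
  shows "8 * cmod (kap n) \<le> 4 / (3 * real_of_int n)"
proof -
  have "8 * cmod (kap n) = 4 / (pi * real_of_int n)"
    using assms by (simp add: norm_kap)
  also have "\<dots> \<le> 4 / (3 * real_of_int n)"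
    using assms pi_gt3 by (intro divide_left_mono mult_right_mono mult_pos_pos) auto
  finally show ?thesis .
qed

lemma norm1_diff_const_le: "L1 q \<Longrightarrow> norm1 (\<lambda>x. q x - z) \<le> norm1 q + cmod z"
  using norm1_add_le[OF _ L1_const, of q "- z"] by (simp add: norm1_const)

text \<open>The decay estimates concern sequences, whereas a resonance may occur at any shift. One
  is therefore selected for every \<open>n\<close> that has one; since
  \<open>resonant_bounds\<close> confines them to a fixed interval, the selected sequence is
  bounded.\<close>

lemma eventually_not_resonant:
  assumes q: "psob s q" "mean q = 0" "psym q" and \<alpha>: "\<alpha> > 0"
    and P: "\<And>n::int. real_of_int n > m \<Longrightarrow> Re (P_coeff q n) < - \<alpha> * real_of_int n powi (- 2 * int s - 2)"
  shows "\<exists>K. \<forall>n::int. \<forall>z::real. K \<le> real_of_int n \<longrightarrow> \<bar>z\<bar> \<le> real_of_int n / 4 \<longrightarrow> \<not> resonant q n (of_real z)"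
proof -
  \<comment> \<open>The remainder is then \<open>O(n^(-2s-3))\<close>, one order below the assumed
    bound on \<open>P_coeff\<close>.\<close>
  define N where "N = 2 * s + 3"
  have Lq: "L1 q" by (rule psob_L1[OF q(1)])
  define Z where "Z = 4 * norm1 q"
  have Z0: "Z \<ge> 0" by (simp add: Z_def norm1_nonneg)
  define bad where "bad n z \<longleftrightarrow> \<bar>z\<bar> \<le> Z \<and> resonant q n (complex_of_real z)" for n z
  \<comment> \<open>Selecting by the absolute value of \<open>n\<close> makes the sequence even; 0
    is the default where nothing has to be excluded.\<close>
  define z where "z n = (if \<exists>z. bad \<bar>n\<bar> z then SOME z. bad \<bar>n\<bar> z else 0)" for n :: int
  have zb: "bad \<bar>n\<bar> (z n)" if "bad \<bar>n\<bar> w" for n w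
    unfolding z_def using that by (auto intro: someI)
  have zZ: "\<bar>z n\<bar> \<le> Z" for n
    using zb[of n] Z0 by (cases "\<exists>w. bad \<bar>n\<bar> w") (auto simp: bad_def z_def)
  define B where "B n = beta N (\<lambda>x. q x - of_real (z n)) n * beta N (\<lambda>x. q x - of_real (z n)) (- n)" for n
  have "decays (2 * s + 2) (\<lambda>n. B n - P_coeff q n)"
    unfolding B_def
    by (rule beta_product_asymptotics[OF q(1,2), of "\<lambda>n. of_real (z n)" Z]) (use zZ in \<open>auto simp: z_def N_def\<close>)
  then have ev1: "eventually (\<lambda>n. cmod (of_int n ^ (2 * s + 2) * (B n - P_coeff q n)) < \<alpha> / 2) cofinite"
    unfolding decays_def tendsto_iff using \<alpha> by (auto dest: spec[of _ "\<alpha> / 2"])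
  define C where "C = norm1 q + Z"
  have C0: "C \<ge> 0" by (simp add: C_def Z0 norm1_nonneg)
  \<comment> \<open>The entries ensure \<open>x >= 1\<close> and \<open>x > m\<close>, the smallness
    needed for \<open>resonant_bounds\<close>, and a remainder below \<open>\<alpha> / 2\<close>:
    since \<open>N\<close> exceeds \<open>2 * s + 2\<close> by one, a factor \<open>1 / x\<close> is
    left over for this.\<close>
  define K0 where "K0 = max (max 1 (\<bar>m\<bar> + 1)) (max (8 * C) (2 * (8 * real N * C\<^sup>2 * (2 * C) ^ N + 1) / \<alpha>))"
  have ev2: "eventually (\<lambda>n. K0 \<le> real_of_int \<bar>n\<bar>) cofinite"
    by (rule eventually_cofinite_abs_int)
  have nb: "eventually (\<lambda>n. n > 0 \<longrightarrow> (\<forall>w. \<not> bad n w)) cofinite"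
    using ev1 ev2
  proof eventually_elim
    case (elim n)
    show ?case
    proof (intro impI allI notI)
      fix w assume n0: "n > 0" and w: "bad n w"
      have bad: "bad n (z n)" using zb[of n w] n0 w by simp
      define x where "x = real_of_int n"
      have x: "x \<ge> 1" "x > m" "8 * C \<le> x" "2 * (8 * real N * C\<^sup>2 * (2 * C) ^ N + 1) / \<alpha> \<le> x"
        using elim(2) n0 by (auto simp: K0_def x_def)
      define v where "v = (\<lambda>x. q x - of_real (z n))"
      have v: "L1 v" "psym v" unfolding v_def by (intro L1_diff L1_const Lq psym_diff_const q Reals_of_real)+
      have nv: "norm1 v \<le> C"
        unfolding v_def C_def using norm1_diff_const_le[OF Lq, of "of_real (z n)"] zZ[of n] by simp
      have k: "8 * cmod (kap n) * norm1 v \<le> 2 * C / x"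
      proof -
        have "8 * cmod (kap n) * norm1 v \<le> 4 / (3 * x) * C"
          unfolding x_def by (intro mult_mono eight_kap_le n0 nv) (use n0 in \<open>auto simp: norm1_nonneg\<close>)
        also have "\<dots> \<le> 2 * C / x" using x C0 by (simp add: field_simps)
        finally show ?thesis .
      qed
      have small: "8 * cmod (kap n) * norm1 (\<lambda>x. q x - of_real (z n)) \<le> 1 / 2"
      proof -
        have "2 * C / x \<le> 1 / 2" using x by (simp add: field_simps)
        then show ?thesis using k unfolding v_def by linarith
      qed
      define D where "D = diag N v n"
      have "cmod (D\<^sup>2 - B n) \<le> 8 * real N * (norm1 v)\<^sup>2 * (8 * cmod (kap n) * norm1 v) ^ N"
        unfolding D_def B_def v_def using bad n0
        by (intro resonant_bounds(2)[OF Lq _ small]) (auto simp: bad_def)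
      also have "\<dots> \<le> 8 * real N * C\<^sup>2 * (2 * C / x) ^ N"
        by (intro mult_mono power_mono nv k mult_left_mono) (auto simp: norm1_nonneg C0)
      also have "\<dots> = 8 * real N * C\<^sup>2 * (2 * C) ^ N / x / x ^ (2 * s + 2)"
        using x by (simp add: power_divide N_def power_add numeral_eq_Suc)
      also have "\<dots> < \<alpha> / 2 / x ^ (2 * s + 2)"
        using x \<alpha> by (intro divide_strict_right_mono) (auto simp: field_simps)
      finally have 1: "cmod (D\<^sup>2 - B n) < \<alpha> / 2 / x ^ (2 * s + 2)" .
      have 2: "cmod (B n - P_coeff q n) < \<alpha> / 2 / x ^ (2 * s + 2)"
      proof -
        have "cmod (of_int n ^ (2 * s + 2) * (B n - P_coeff q n)) = x ^ (2 * s + 2) * cmod (B n - P_coeff q n)"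
          unfolding norm_mult norm_power using n0 by (simp add: x_def)
        with elim(1) have "x ^ (2 * s + 2) * cmod (B n - P_coeff q n) < \<alpha> / 2" by simp
        then show ?thesis using x by (subst pos_less_divide_eq) (auto simp: mult.commute)
      qed
      have 3: "Re (P_coeff q n) < - (\<alpha> / x ^ (2 * s + 2))"
      proof -
        have "x powi (- 2 * int s - 2) = inverse (x ^ (2 * s + 2))"
          by (simp add: power_int_def nat_add_distrib nat_mult_distrib flip: power_inverse)
        then show ?thesis using P[of n] x(2) by (simp add: x_def divide_inverse)
      qed
      \<comment> \<open>The two errors, from truncation and from the asymptotics, use up less than
        \<open>\<alpha> / 2\<close> each, so the margin \<open>\<alpha>\<close> still forces a
        negative real part on the square of the real number \<open>D\<close>.\<close>
      have "Re (D\<^sup>2) = Re (D\<^sup>2 - B n) + Re (B n - P_coeff q n) + Re (P_coeff q n)" by simp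
      also have "\<dots> < \<alpha> / 2 / x ^ (2 * s + 2) + \<alpha> / 2 / x ^ (2 * s + 2) - \<alpha> / x ^ (2 * s + 2)"
        using 1 2 3 complex_Re_le_cmod[of "D\<^sup>2 - B n"] complex_Re_le_cmod[of "B n - P_coeff q n"] by linarith
      also have "\<dots> = 0" by simp
      finally have "Re (D\<^sup>2) < 0" .
      moreover have "D \<in> \<real>" unfolding D_def by (rule psym_diag_real[OF v])
      ultimately show False by (auto elim!: Reals_cases)
    qed
  qed
  then have "finite {n. \<not> (n > 0 \<longrightarrow> (\<forall>w. \<not> bad n w))}"
    by (simp add: eventually_cofinite)
  then have "bdd_above {n. \<not> (n > 0 \<longrightarrow> (\<forall>w. \<not> bad n w))}"
    by (rule bdd_above_finite)
  then obtain K1 where "\<forall>n\<in>{n. \<not> (n > 0 \<longrightarrow> (\<forall>w. \<not> bad n w))}. n \<le> K1"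
    unfolding bdd_above_def by (rule exE)
  then have K1: "n \<le> K1" if "n > 0" "bad n w" for n w using that by blast
  show ?thesis
  \<comment> \<open>From \<open>8 * norm1 q <= n\<close> and \<open>|w| <= n / 4\<close> the norm of
    \<open>q - w\<close> is at most \<open>3 * n / 8\<close>, and \<open>4 / (3 * n)\<close> times
    this is the permitted \<open>1 / 2\<close>.\<close>
  proof (intro exI[of _ "max (max 1 (8 * norm1 q)) (real_of_int K1 + 1)"] allI impI notI)
    fix n :: int and w :: real
    assume n: "max (max 1 (8 * norm1 q)) (real_of_int K1 + 1) \<le> real_of_int n" and w: "\<bar>w\<bar> \<le> real_of_int n / 4"
      and res: "resonant q n (complex_of_real w)"
    have n0: "n > 0" using n by auto
    have "8 * cmod (kap n) * norm1 (\<lambda>x. q x - of_real w) \<le> 4 / (3 * real_of_int n) * (real_of_int n * (3 / 8))"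
    proof (intro mult_mono eight_kap_le n0)
      show "norm1 (\<lambda>x. q x - of_real w) \<le> real_of_int n * (3 / 8)"
        using norm1_diff_const_le[OF Lq, of "of_real w"] w n by simp
    qed (use n0 in \<open>auto simp: norm1_nonneg\<close>)
    also have "\<dots> = 1 / 2" using n0 by simp
    finally have "cmod (of_real w) \<le> 4 * norm1 q"
      using n0 by (intro resonant_bounds(1)[OF Lq _ _ res]) auto
    then have "bad n w" using res by (simp add: bad_def Z_def)
    then have "n \<le> K1" using n0 by (intro K1)
    then show False using n by auto
  qed
qed

section \<open>The Hill discriminant\<close>

definition kk :: "real \<Rightarrow> complex" where
  "kk k = 1 / (2 * \<i> * of_real k)"

definition ycomb :: "real \<Rightarrow> (real \<Rightarrow> complex) \<Rightarrow> (real \<Rightarrow> complex) \<Rightarrow> real \<Rightarrow> complex" where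
  "ycomb k A B x = A x * cis (k * x) + B x * cis (- (k * x))"

text \<open>Variation of constants: \<open>ycomb k A B\<close> solves \<open>- y'' + q y = k\<^sup>2 y\<close>.\<close>

definition psol :: "(real \<Rightarrow> complex) \<Rightarrow> real \<Rightarrow> (real \<Rightarrow> complex) \<Rightarrow> (real \<Rightarrow> complex) \<Rightarrow> bool" where
  "psol q k A B \<longleftrightarrow> prim (\<lambda>x. kk k * (q x * (ycomb k A B x * cis (- (k * x))))) A \<and>
     prim (\<lambda>x. - kk k * (q x * (ycomb k A B x * cis (k * x)))) B"

lemma cis_cancel [simp]: "cis x * cis (- x) = 1" "cis (- x) * cis x = 1"
  by (simp_all add: cis_mult)

lemma cis_cancel_left [simp]: "cis x * (cis (- x) * c) = c" "cis (- x) * (cis x * c) = c"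
  by (simp_all flip: mult.assoc)

lemma prim_cis: "prim (\<lambda>x. \<i> * of_real k * cis (k * x)) (\<lambda>x. cis (k * x))"
proof (rule prim_vector_derivative)
  fix x :: real
  have "((\<lambda>x. exp (\<i> * of_real k * of_real x)) has_vector_derivative
      \<i> * of_real k * exp (\<i> * of_real k * of_real x)) (at x within {0..1})"
    by (rule has_vector_derivative_real_field) (auto intro!: derivative_eq_intros)
  then show "((\<lambda>x. cis (k * x)) has_vector_derivative \<i> * of_real k * cis (k * x)) (at x within {0..1})"
    by (simp add: cis_conv_exp mult_ac)
qed (intro continuous_intros)

lemma psolD:
  assumes "psol q k A B"
  shows "continuous_on {0..1} A" "continuous_on {0..1} B" "continuous_on {0..1} (ycomb k A B)"
proof -
  show *: "continuous_on {0..1} A" "continuous_on {0..1} B"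
    using assms by (auto simp: psol_def dest: prim_continuous_on)
  show "continuous_on {0..1} (ycomb k A B)"
    unfolding ycomb_def[abs_def] by (intro continuous_intros *)
qed

lemma norm_kk: "k > 0 \<Longrightarrow> cmod (kk k) = 1 / (2 * k)"
  by (simp add: kk_def norm_divide norm_mult)

lemma ycomb_linear: "ycomb k (\<lambda>x. c * A x + d * A' x) (\<lambda>x. c * B x + d * B' x) x = c * ycomb k A B x + d * ycomb k A' B' x"
  by (simp add: ycomb_def algebra_simps)

lemma psol_linear:
  assumes "psol q k A B" "psol q k A' B'"
  shows "psol q k (\<lambda>x. c * A x + d * A' x) (\<lambda>x. c * B x + d * B' x)"
  unfolding psol_def ycomb_linear
proof
  show "prim (\<lambda>x. kk k * (q x * ((c * ycomb k A B x + d * ycomb k A' B' x) * cis (- (k * x))))) (\<lambda>x. c * A x + d * A' x)"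
    by (rule prim_cong[OF prim_add[OF prim_cmult prim_cmult, of _ A _ A' c d]])
      (use assms in \<open>auto simp: psol_def algebra_simps\<close>)
  show "prim (\<lambda>x. - kk k * (q x * ((c * ycomb k A B x + d * ycomb k A' B' x) * cis (k * x)))) (\<lambda>x. c * B x + d * B' x)"
    by (rule prim_cong[OF prim_add[OF prim_cmult prim_cmult, of _ B _ B' c d]])
      (use assms in \<open>auto simp: psol_def algebra_simps\<close>)
qed

lemma prim_diff_le_norm1:
  assumes "prim f F" "x \<in> {0..1}"
  shows "cmod (F x - F 0) \<le> norm1 f"
  using prim_integral_diff[OF assms(1), of 0 x] norm_integral_le_norm1[OF prim_L1[OF assms(1)], of 0 x] assms(2)
  by auto

text \<open>The largest modulus \<open>M\<close> of the solution satisfies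
  \<open>M <= S + M * norm1 q / k\<close>, and the hypothesis on \<open>k\<close> absorbs half of
  it. The amplitudes therefore drift only by \<open>O(1 / k)\<close>.\<close>

lemma psol_bounds:
  assumes q: "L1 q" and k: "k > 0" "2 * norm1 q \<le> k" and sol: "psol q k A B" and x: "x \<in> {0..1}"
  defines "S \<equiv> cmod (A 0) + cmod (B 0)"
  shows "cmod (ycomb k A B x) \<le> 2 * S"
    and "cmod (A x - A 0) \<le> norm1 q / k * S" "cmod (B x - B 0) \<le> norm1 q / k * S"
proof -
  let ?Y = "ycomb k A B"
  have Yc: "continuous_on {0..1} ?Y" by (rule psolD[OF sol])
  obtain x0 where x0: "x0 \<in> {0..1}" "\<And>x. x \<in> {0..1} \<Longrightarrow> cmod (?Y x) \<le> cmod (?Y x0)"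
  proof -
    have "continuous_on {0..1} (\<lambda>x. cmod (?Y x))" using Yc by (intro continuous_intros)
    from continuous_attains_sup[OF _ _ this] show thesis using that by auto
  qed
  define M where "M = cmod (?Y x0)"
  have nA: "norm1 (\<lambda>x. kk k * (q x * (?Y x * cis (- (k * x))))) \<le> 1 / (2 * k) * (M * norm1 q)"
    unfolding norm1_cmult norm_kk[OF k(1)] M_def
    by (intro mult_left_mono norm1_mult_le q continuous_intros Yc) (use k x0(2) in \<open>auto simp: norm_mult\<close>)
  have nB: "norm1 (\<lambda>x. - kk k * (q x * (?Y x * cis (k * x)))) \<le> 1 / (2 * k) * (M * norm1 q)"
    unfolding norm1_cmult norm_minus_cancel norm_kk[OF k(1)] M_def
    by (intro mult_left_mono norm1_mult_le q continuous_intros Yc) (use k x0(2) in \<open>auto simp: norm_mult\<close>)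
  have A: "cmod (A x - A 0) \<le> 1 / (2 * k) * (M * norm1 q)" if "x \<in> {0..1}" for x
    using prim_diff_le_norm1[OF _ that] sol nA unfolding psol_def by (meson order_trans)
  have B: "cmod (B x - B 0) \<le> 1 / (2 * k) * (M * norm1 q)" if "x \<in> {0..1}" for x
    using prim_diff_le_norm1[OF _ that] sol nB unfolding psol_def by (meson order_trans)
  have "M \<le> cmod (A x0) + cmod (B x0)"
    unfolding M_def ycomb_def by (rule order_trans[OF norm_triangle_ineq]) (simp add: norm_mult)
  also have "\<dots> \<le> S + 2 * (1 / (2 * k) * (M * norm1 q))"
    using norm_triangle_ineq2[of "A x0" "A 0"] norm_triangle_ineq2[of "B x0" "B 0"] A[OF x0(1)] B[OF x0(1)]
    unfolding S_def by linarith
  also have "\<dots> = S + M * (norm1 q / k)" using k by simp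
  also have "\<dots> \<le> S + M * (1 / 2)"
    using k by (intro add_left_mono mult_left_mono) (auto simp: M_def field_simps)
  finally have M: "M \<le> 2 * S" by simp
  show "cmod (?Y x) \<le> 2 * S" using x0(2)[OF x] M by (simp add: M_def)
  have "1 / (2 * k) * (M * norm1 q) \<le> 1 / (2 * k) * ((2 * S) * norm1 q)"
    using M k by (intro mult_left_mono mult_right_mono norm1_nonneg) auto
  also have "\<dots> = norm1 q / k * S" by simp
  finally show "cmod (A x - A 0) \<le> norm1 q / k * S" "cmod (B x - B 0) \<le> norm1 q / k * S"
    using A[OF x] B[OF x] by linarith+
qed

text \<open>The difference of two solutions has zero initial amplitudes, and the bounds are
  proportional to those.\<close>

lemma psol_unique:
  assumes q: "L1 q" and k: "k > 0" "2 * norm1 q \<le> k" and sol: "psol q k A B" "psol q k A' B'"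
    and init: "A 0 = A' 0" "B 0 = B' 0" and x: "x \<in> {0..1}"
  shows "A x = A' x" "B x = B' x"
  using psol_bounds(2,3)[OF q k psol_linear[OF sol, of 1 "-1"] x] init by simp_all

text \<open>A single fixed point argument on the whole unit interval:
  \<open>2 * norm1 q <= k\<close> makes the integral operator a contraction with constant
  \<open>1 / 2\<close>.\<close>

lemma psol_exists:
  assumes q: "L1 q" and k: "k > 0" "2 * norm1 q \<le> k"
  shows "\<exists>A B. psol q k A B \<and> A 0 = a \<and> B 0 = b"
proof -
  define A where "A y x = a + integral {0..x} (\<lambda>t. kk k * (q t * (y t * cis (- (k * t)))))" for y :: "real \<Rightarrow> complex" and x
  define B where "B y x = b + integral {0..x} (\<lambda>t. - kk k * (q t * (y t * cis (k * t))))" for y :: "real \<Rightarrow> complex" and x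
  \<comment> \<open>Clamping the argument turns candidates on the unit interval into bounded
    continuous functions on the line, a complete space.\<close>
  define c where "c x = max 0 (min 1 x)" for x :: real
  have c01: "c x \<in> {0..1}" for x by (simp add: c_def)
  have cc: "continuous_on UNIV c" unfolding c_def by (intro continuous_intros)
  have LA: "L1 (\<lambda>t. kk k * (q t * (y t * cis (- (k * t)))))" and LB: "L1 (\<lambda>t. - kk k * (q t * (y t * cis (k * t))))"
    if "continuous_on {0..1} y" for y :: "real \<Rightarrow> complex"
    by (intro L1_cmult L1_mult_continuous q continuous_intros that)+
  have pA: "prim (\<lambda>t. kk k * (q t * (y t * cis (- (k * t))))) (A y)" if "continuous_on {0..1} y" for y
    unfolding A_def by (rule prim_integral[OF LA[OF that]])
  have pB: "prim (\<lambda>t. - kk k * (q t * (y t * cis (k * t)))) (B y)" if "continuous_on {0..1} y" for y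
    unfolding B_def by (rule prim_integral[OF LB[OF that]])
  define \<Phi> where "\<Phi> y = Bcontfun (\<lambda>x. ycomb k (A (apply_bcontfun y)) (B (apply_bcontfun y)) (c x))"
    for y :: "real \<Rightarrow>\<^sub>C complex"
  have yc: "continuous_on {0..1} (apply_bcontfun y)" for y :: "real \<Rightarrow>\<^sub>C complex"
    using continuous_on_subset[of UNIV "apply_bcontfun y"] by (simp add: continuous_on_apply_bcontfun)
  have Yc: "continuous_on {0..1} (ycomb k (A (apply_bcontfun y)) (B (apply_bcontfun y)))" for y :: "real \<Rightarrow>\<^sub>C complex"
    unfolding ycomb_def[abs_def]
    by (intro continuous_intros prim_continuous_on[OF pA[OF yc]] prim_continuous_on[OF pB[OF yc]])
  have app: "apply_bcontfun (\<Phi> y) = (\<lambda>x. ycomb k (A (apply_bcontfun y)) (B (apply_bcontfun y)) (c x))" for y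
    unfolding \<Phi>_def
  proof (rule Bcontfun_inverse)
    let ?Y = "ycomb k (A (apply_bcontfun y)) (B (apply_bcontfun y))"
    have "continuous_on UNIV (\<lambda>x. ?Y (c x))"
      by (rule continuous_on_compose2[OF Yc cc]) (use c01 in auto)
    moreover have "bounded (range (\<lambda>x. ?Y (c x)))"
      by (rule bounded_subset[OF compact_imp_bounded[OF compact_continuous_image[OF Yc compact_Icc]]]) (use c01 in auto)
    ultimately show "(\<lambda>x. ?Y (c x)) \<in> bcontfun" by (simp add: bcontfun_def)
  qed
  have lip: "dist (\<Phi> y) (\<Phi> y') \<le> 1 / 2 * dist y y'" for y y'
  proof (rule dist_bound)
    fix x
    let ?y = "apply_bcontfun y" and ?y' = "apply_bcontfun y'"
    let ?d = "\<lambda>t. ?y t - ?y' t"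
    have dc: "continuous_on {0..1} ?d" by (intro continuous_intros yc)
    have db: "cmod (?d t) \<le> dist y y'" for t
      using dist_bounded[of y t y'] by (simp add: dist_norm)
    have 1: "cmod (A ?y t - A ?y' t) \<le> 1 / (2 * k) * (dist y y' * norm1 q)" if "t \<in> {0..1}" for t
    proof -
      have "A ?y t - A ?y' t = integral {0..t} (\<lambda>t. kk k * (q t * (?d t * cis (- (k * t)))))"
        unfolding A_def using that
        by (subst integral_diff[symmetric, simplified] add_diff_add diff_self add_0_left |
            intro L1_subinterval LA yc | simp add: algebra_simps)+
      also have "cmod \<dots> \<le> norm1 (\<lambda>t. kk k * (q t * (?d t * cis (- (k * t)))))"
        using that by (intro norm_integral_le_norm1 LA dc) auto
      also have "\<dots> \<le> 1 / (2 * k) * (dist y y' * norm1 q)"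
        unfolding norm1_cmult norm_kk[OF k(1)]
        by (intro mult_left_mono norm1_mult_le q continuous_intros dc) (use k db in \<open>auto simp: norm_mult\<close>)
      finally show ?thesis .
    qed
    have 2: "cmod (B ?y t - B ?y' t) \<le> 1 / (2 * k) * (dist y y' * norm1 q)" if "t \<in> {0..1}" for t
    proof -
      have "B ?y t - B ?y' t = integral {0..t} (\<lambda>t. - kk k * (q t * (?d t * cis (k * t))))"
        unfolding B_def using that
        by (subst integral_diff[symmetric, simplified] add_diff_add diff_self add_0_left |
            intro L1_subinterval LB yc | simp add: algebra_simps)+
      also have "cmod \<dots> \<le> norm1 (\<lambda>t. - kk k * (q t * (?d t * cis (k * t))))"
        using that by (intro norm_integral_le_norm1 LB dc) auto
      also have "\<dots> \<le> 1 / (2 * k) * (dist y y' * norm1 q)"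
        unfolding norm1_cmult norm_minus_cancel norm_kk[OF k(1)]
        by (intro mult_left_mono norm1_mult_le q continuous_intros dc) (use k db in \<open>auto simp: norm_mult\<close>)
      finally show ?thesis .
    qed
    have "dist (apply_bcontfun (\<Phi> y) x) (apply_bcontfun (\<Phi> y') x) =
       cmod ((A ?y (c x) - A ?y' (c x)) * cis (k * c x) + (B ?y (c x) - B ?y' (c x)) * cis (- (k * c x)))"
      by (simp add: app dist_norm ycomb_def algebra_simps)
    also have "\<dots> \<le> cmod (A ?y (c x) - A ?y' (c x)) + cmod (B ?y (c x) - B ?y' (c x))"
      by (rule order_trans[OF norm_triangle_ineq]) (simp add: norm_mult)
    also have "\<dots> \<le> dist y y' * (norm1 q / k)"
      using 1[OF c01[of x]] 2[OF c01[of x]] k by simp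
    also have "\<dots> \<le> dist y y' * (1 / 2)"
      using k by (intro mult_left_mono) (auto simp: field_simps)
    finally show "dist (apply_bcontfun (\<Phi> y) x) (apply_bcontfun (\<Phi> y') x) \<le> 1 / 2 * dist y y'" by simp
  qed
  obtain y where y: "\<Phi> y = y"
    using banach_fix_type[of "1/2" \<Phi>] lip by auto
  let ?y = "apply_bcontfun y"
  have fix_y: "?y x = ycomb k (A ?y) (B ?y) x" if "x \<in> {0..1}" for x
    using fun_cong[OF app[of y], of x] that by (simp add: y c_def)
  have "psol q k (A ?y) (B ?y)"
    unfolding psol_def
  proof
    show "prim (\<lambda>x. kk k * (q x * (ycomb k (A ?y) (B ?y) x * cis (- (k * x))))) (A ?y)"
      by (rule prim_cong[OF pA[OF yc[of y]]]) (use fix_y in auto)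
    show "prim (\<lambda>x. - kk k * (q x * (ycomb k (A ?y) (B ?y) x * cis (k * x)))) (B ?y)"
      by (rule prim_cong[OF pB[OF yc[of y]]]) (use fix_y in auto)
  qed
  moreover have "A ?y 0 = a" "B ?y 0 = b" by (simp_all add: A_def B_def)
  ultimately show ?thesis by blast
qed

definition fsol :: "(real \<Rightarrow> complex) \<Rightarrow> real \<Rightarrow> complex \<Rightarrow> complex \<Rightarrow> (real \<Rightarrow> complex) \<times> (real \<Rightarrow> complex)" where
  "fsol q k a b = (SOME p. psol q k (fst p) (snd p) \<and> fst p 0 = a \<and> snd p 0 = b)"

text \<open>\<open>mono1\<close> and \<open>mono2\<close> are the amplitudes after one period;
  \<open>cis k\<close> and \<open>cis (- k)\<close> refer the exponentials to the new origin. Their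
  values at \<open>(1, 0)\<close> and \<open>(0, 1)\<close> form the columns of the monodromy
  matrix, and the discriminant is its trace.\<close>

definition mono1 :: "(real \<Rightarrow> complex) \<Rightarrow> real \<Rightarrow> complex \<Rightarrow> complex \<Rightarrow> complex" where
  "mono1 q k a b = fst (fsol q k a b) 1 * cis k"

definition mono2 :: "(real \<Rightarrow> complex) \<Rightarrow> real \<Rightarrow> complex \<Rightarrow> complex \<Rightarrow> complex" where
  "mono2 q k a b = snd (fsol q k a b) 1 * cis (- k)"

definition discriminant :: "(real \<Rightarrow> complex) \<Rightarrow> real \<Rightarrow> complex" where
  "discriminant q k = mono1 q k 1 0 + mono2 q k 0 1"

lemma fsol:
  assumes "L1 q" "k > 0" "2 * norm1 q \<le> k"
  shows "psol q k (fst (fsol q k a b)) (snd (fsol q k a b))" "fst (fsol q k a b) 0 = a" "snd (fsol q k a b) 0 = b"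
proof -
  have "\<exists>p. psol q k (fst p) (snd p) \<and> fst p 0 = a \<and> snd p 0 = b"
    using psol_exists[OF assms, of a b] by auto
  from someI_ex[OF this]
  show "psol q k (fst (fsol q k a b)) (snd (fsol q k a b))" "fst (fsol q k a b) 0 = a" "snd (fsol q k a b) 0 = b"
    unfolding fsol_def by blast+
qed

lemma psol_monodromy:
  assumes q: "L1 q" and k: "k > 0" "2 * norm1 q \<le> k" and sol: "psol q k A B"
  shows "A 1 * cis k = mono1 q k 1 0 * A 0 + mono1 q k 0 1 * B 0"
    and "B 1 * cis (- k) = mono2 q k 1 0 * A 0 + mono2 q k 0 1 * B 0"
proof -
  note f = fsol[OF q k]
  have "A 1 = A 0 * fst (fsol q k 1 0) 1 + B 0 * fst (fsol q k 0 1) 1"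
    "B 1 = A 0 * snd (fsol q k 1 0) 1 + B 0 * snd (fsol q k 0 1) 1"
    using psol_unique[OF q k sol psol_linear[OF f(1)[of 1 0] f(1)[of 0 1], of "A 0" "B 0"], of 1]
    by (simp_all add: f(2,3))
  then show "A 1 * cis k = mono1 q k 1 0 * A 0 + mono1 q k 0 1 * B 0"
    "B 1 * cis (- k) = mono2 q k 1 0 * A 0 + mono2 q k 0 1 * B 0"
    by (simp_all add: mono1_def mono2_def algebra_simps)
qed

text \<open>\<open>W\<close> is the Wronskian of two solutions up to a constant factor, and its
  derivative cancels pointwise.\<close>

lemma monodromy_det:
  assumes q: "L1 q" and k: "k > 0" "2 * norm1 q \<le> k"
  shows "mono1 q k 1 0 * mono2 q k 0 1 - mono1 q k 0 1 * mono2 q k 1 0 = 1"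
proof -
  define A1 B1 A2 B2 where "A1 = fst (fsol q k 1 0)" and "B1 = snd (fsol q k 1 0)"
    and "A2 = fst (fsol q k 0 1)" and "B2 = snd (fsol q k 0 1)"
  note f = fsol[OF q k]
  note s1 = f(1)[of 1 0, folded A1_def B1_def, unfolded psol_def]
  note s2 = f(1)[of 0 1, folded A2_def B2_def, unfolded psol_def]
  define W where "W x = A1 x * B2 x - A2 x * B1 x" for x
  let ?Y1 = "ycomb k A1 B1" and ?Y2 = "ycomb k A2 B2"
  let ?w = "\<lambda>x. (kk k * (q x * (?Y1 x * cis (- (k * x)))) * B2 x + A1 x * (- kk k * (q x * (?Y2 x * cis (k * x))))) -
      (kk k * (q x * (?Y2 x * cis (- (k * x)))) * B1 x + A2 x * (- kk k * (q x * (?Y1 x * cis (k * x)))))"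
  have "prim ?w W"
    unfolding W_def
    by (intro prim_diff prim_mult conjunct1[OF s1] conjunct2[OF s1] conjunct1[OF s2] conjunct2[OF s2])
  moreover have "?w x = 0" for x
  proof -
    have "?w x = kk k * q x * (?Y1 x * ?Y2 x - ?Y2 x * ?Y1 x)"
      unfolding ycomb_def[of k A2 B2] ycomb_def[of k A1 B1] by (simp add: algebra_simps)
    then show ?thesis by simp
  qed
  ultimately have "W 1 = W 0" by (rule prim_zero) simp
  then have "A1 1 * B2 1 - A2 1 * B1 1 = 1"
    using f(2,3) by (simp add: W_def A1_def A2_def B1_def B2_def)
  then show ?thesis
    by (simp add: mono1_def mono2_def mult.assoc mult.left_commute[of "cis k"] flip: A1_def A2_def B1_def B2_def)
qed

text \<open>Conjugation and reflection each exchange the two exponentials, so together they fix them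
  up to a phase, which the factors \<open>cis (- k)\<close> and \<open>cis k\<close> record.\<close>

lemma psol_reflect:
  assumes sol: "psol q k A B" and q: "psym q"
  shows "psol q k (\<lambda>x. cis (- k) * cnj (A (1 - x))) (\<lambda>x. cis k * cnj (B (1 - x)))"
proof -
  let ?A = "\<lambda>x. cis (- k) * cnj (A (1 - x))" and ?B = "\<lambda>x. cis k * cnj (B (1 - x))"
  have e1: "cnj (cis (k * (1 - x))) = cis (- k) * cis (k * x)" for x
    by (simp add: cis_cnj cis_mult algebra_simps)
  have e2: "cnj (cis (- (k * (1 - x)))) = cis k * cis (- (k * x))" for x
    by (simp add: cis_cnj cis_mult algebra_simps)
  have Y: "ycomb k ?A ?B x = cnj (ycomb k A B (1 - x))" for x
    unfolding ycomb_def complex_cnj_add complex_cnj_mult e1 e2 by simp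
  have kk: "cnj (kk k) = - kk k" by (simp add: kk_def)
  have qx: "cnj (q (1 - x)) = q x" if "x \<in> {0..1}" for x using q that by (simp add: psym_def)
  show ?thesis
    unfolding psol_def
  proof
    have "prim (\<lambda>x. cis (- k) * cnj (- (kk k * (q (1 - x) * (ycomb k A B (1 - x) * cis (- (k * (1 - x)))))))) ?A"
      by (intro prim_cmult prim_cnj prim_reflect) (use sol in \<open>simp add: psol_def\<close>)
    then show "prim (\<lambda>x. kk k * (q x * (ycomb k ?A ?B x * cis (- (k * x))))) ?A"
    proof (rule prim_cong)
      fix x :: real assume x: "x \<in> {0..1}"
      show "cis (- k) * cnj (- (kk k * (q (1 - x) * (ycomb k A B (1 - x) * cis (- (k * (1 - x))))))) =
        kk k * (q x * (ycomb k ?A ?B x * cis (- (k * x))))"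
        unfolding Y complex_cnj_minus complex_cnj_mult e2 kk qx[OF x] by (simp add: mult.left_commute[of "cis (- k)"])
    qed simp
    have "prim (\<lambda>x. cis k * cnj (- (- kk k * (q (1 - x) * (ycomb k A B (1 - x) * cis (k * (1 - x))))))) ?B"
      by (intro prim_cmult prim_cnj prim_reflect) (use sol in \<open>simp add: psol_def\<close>)
    then show "prim (\<lambda>x. - kk k * (q x * (ycomb k ?A ?B x * cis (k * x)))) ?B"
    proof (rule prim_cong)
      fix x :: real assume x: "x \<in> {0..1}"
      show "cis k * cnj (- (- kk k * (q (1 - x) * (ycomb k A B (1 - x) * cis (k * (1 - x)))))) =
        - kk k * (q x * (ycomb k ?A ?B x * cis (k * x)))"
        unfolding Y complex_cnj_minus complex_cnj_mult e1 kk qx[OF x] by (simp add: mult.left_commute[of "cis k"])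
    qed simp
  qed
qed

text \<open>The reflected first solution starts with amplitudes \<open>(cnj a, cnj c)\<close> and
  ends with \<open>(1, 0)\<close>. Solving this system with determinant 1 gives
  \<open>cnj a = d\<close>, so the trace is \<open>a + cnj a\<close>.\<close>

lemma discriminant_real:
  assumes q: "L1 q" "psym q" and k: "k > 0" "2 * norm1 q \<le> k"
  shows "discriminant q k \<in> \<real>"
proof -
  define a b c d where "a = mono1 q k 1 0" and "b = mono1 q k 0 1" and "c = mono2 q k 1 0" and "d = mono2 q k 0 1"
  note f = fsol[OF q(1) k]
  have det: "a * d - b * c = 1"
    using monodromy_det[OF q(1) k] by (simp add: a_def b_def c_def d_def)
  note m = psol_monodromy[OF q(1) k psol_reflect[OF f(1)[of 1 0] q(2)]]
  have i: "cis (- k) * cnj (fst (fsol q k 1 0) 1) = cnj a" "cis k * cnj (snd (fsol q k 1 0) 1) = cnj c"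
    by (simp_all add: a_def c_def mono1_def mono2_def cis_cnj mult.commute)
  have 1: "1 = a * cnj a + b * cnj c" and 2: "0 = c * cnj a + d * cnj c"
    using m i by (simp_all add: f a_def[symmetric] b_def[symmetric] c_def[symmetric] d_def[symmetric])
  have "cnj a = cnj a * (a * d - b * c)" by (simp add: det)
  also have "\<dots> = d * (a * cnj a + b * cnj c) - b * (c * cnj a + d * cnj c)" by (simp add: algebra_simps)
  also have "\<dots> = d" by (simp flip: 1 2)
  finally have "discriminant q k = a + cnj a" by (simp add: discriminant_def a_def d_def)
  then show ?thesis by (simp add: complex_add_cnj)
qed

text \<open>Without potential the amplitudes are constant and the trace is
  \<open>cis k + cis (- k)\<close>; the deviation is the drift of two amplitudes, each at most
  \<open>norm1 q / k\<close>.\<close>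

lemma discriminant_approx:
  assumes q: "L1 q" and k: "k > 0" "2 * norm1 q \<le> k"
  shows "cmod (discriminant q k - 2 * of_real (cos k)) \<le> 2 * norm1 q / k"
proof -
  note f = fsol[OF q k]
  have 1: "cmod (fst (fsol q k 1 0) 1 - 1) \<le> norm1 q / k"
    using psol_bounds(2)[OF q k f(1)[of 1 0], of 1] by (simp add: f)
  have 2: "cmod (snd (fsol q k 0 1) 1 - 1) \<le> norm1 q / k"
    using psol_bounds(3)[OF q k f(1)[of 0 1], of 1] by (simp add: f)
  have "2 * complex_of_real (cos k) = cis k + cis (- k)"
    by (simp add: complex_eq_iff)
  then have "discriminant q k - 2 * of_real (cos k) =
     (fst (fsol q k 1 0) 1 - 1) * cis k + (snd (fsol q k 0 1) 1 - 1) * cis (- k)"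
    by (simp add: discriminant_def mono1_def mono2_def algebra_simps)
  also have "cmod \<dots> \<le> cmod (fst (fsol q k 1 0) 1 - 1) + cmod (snd (fsol q k 0 1) 1 - 1)"
    by (rule order_trans[OF norm_triangle_ineq]) (simp add: norm_mult)
  finally show ?thesis using 1 2 by simp
qed

section \<open>Continuity of the discriminant in \<open>k\<close>\<close>

lemma norm_cis_diff_le: "cmod (cis a - cis b) \<le> \<bar>a - b\<bar>"
proof -
  have "cis a - cis b = cis b * (exp (\<i> * of_real (a - b)) - 1)"
    by (simp add: right_diff_distrib cis_mult del: of_real_diff flip: cis_conv_exp)
  then have "cmod (cis a - cis b) = cmod (cis b * (exp (\<i> * of_real (a - b)) - 1))" by (rule arg_cong)
  also have "\<dots> = dist (exp (\<i> * of_real (a - b))) 1" by (simp add: norm_mult dist_norm)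
  also have "\<dots> \<le> \<bar>a - b\<bar>"
    unfolding dist_norm dist_exp_i_1 using abs_sin_x_le_abs_x[of "(a - b) / 2"] by (simp add: abs_divide)
  finally show ?thesis .
qed

text \<open>With equal initial amplitudes the difference of the solutions satisfies an integral
  equation whose inhomogeneity is at most a multiple of \<open>|k - l|\<close>, and the absorption
  used in \<open>psol_bounds\<close> closes the estimate.\<close>

lemma psol_lipschitz:
  assumes q: "L1 q" and k: "k \<ge> 1" "2 * norm1 q \<le> k" and l: "l \<ge> 1" "2 * norm1 q \<le> l"
    and sk: "psol q k A B" and sl: "psol q l A' B'"
    and init: "A 0 = A' 0" "B 0 = B' 0" "cmod (A' 0) + cmod (B' 0) \<le> 1"
  shows "cmod (A 1 - A' 1) \<le> 8 * (norm1 q + 1) * \<bar>k - l\<bar>" "cmod (B 1 - B' 1) \<le> 8 * (norm1 q + 1) * \<bar>k - l\<bar>"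
proof -
  let ?Q = "norm1 q" and ?Y = "ycomb k A B" and ?Y' = "ycomb l A' B'"
  define \<delta> where "\<delta> = \<bar>k - l\<bar>"
  have d0: "\<delta> \<ge> 0" by (simp add: \<delta>_def)
  note Q0 = norm1_nonneg[of q]
  have k0: "k > 0" and l0: "l > 0" using k l by auto
  have Yc: "continuous_on {0..1} ?Y" "continuous_on {0..1} ?Y'" using psolD(3)[OF sk] psolD(3)[OF sl] .
  have b: "cmod (?Y' x) \<le> 2" "cmod (A' x) \<le> 2" "cmod (B' x) \<le> 2" if x: "x \<in> {0..1}" for x
  proof -
    define S where "S = cmod (A' 0) + cmod (B' 0)"
    have S: "0 \<le> S" "S \<le> 1" using init(3) by (auto simp: S_def)
    show "cmod (?Y' x) \<le> 2"
      using psol_bounds(1)[OF q l0 l(2) sl x] S by (simp add: S_def)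
    have "?Q / l * S \<le> 1 * 1" using l S Q0 by (intro mult_mono) auto
    then show "cmod (A' x) \<le> 2" "cmod (B' x) \<le> 2"
      using psol_bounds(2,3)[OF q l0 l(2) sl x] norm_triangle_ineq2[of "A' x" "A' 0"] norm_triangle_ineq2[of "B' x" "B' 0"]
        S norm_ge_zero[of "A' 0"] norm_ge_zero[of "B' 0"] unfolding S_def by linarith+
  qed
  obtain x0 where x0: "x0 \<in> {0..1}" "\<And>x. x \<in> {0..1} \<Longrightarrow> cmod (?Y x - ?Y' x) \<le> cmod (?Y x0 - ?Y' x0)"
  proof -
    have "continuous_on {0..1} (\<lambda>x. cmod (?Y x - ?Y' x))" using Yc by (intro continuous_intros)
    from continuous_attains_sup[OF _ _ this] show thesis using that by auto
  qed
  define D where "D = cmod (?Y x0 - ?Y' x0)"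
  have kkd: "cmod (kk k - kk l) \<le> \<delta>"
  proof -
    have "kk k - kk l = (of_real (l - k)) * (1 / (2 * \<i> * of_real (k * l)))"
      using k0 l0 by (simp add: kk_def field_simps)
    then have "cmod (kk k - kk l) = \<delta> * (1 / (2 * (k * l)))"
      using k0 l0 by (simp add: norm_mult norm_divide \<delta>_def abs_minus_commute del: of_real_diff of_real_mult)
    also have "\<dots> \<le> \<delta> * 1"
      using mult_mono[of 1 k 1 l] k l by (intro mult_left_mono d0) auto
    finally show ?thesis by simp
  qed
  have main: "cmod (kk k * (?Y x * c) - kk l * (?Y' x * c')) \<le> D / (2 * k) + 4 * \<delta>"
    if x: "x \<in> {0..1}" and c: "cmod c = 1" "cmod c' = 1" "cmod (c - c') \<le> \<delta>" for x c c'
  proof -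
    have "kk k * (?Y x * c) - kk l * (?Y' x * c') =
      kk k * ((?Y x - ?Y' x) * c) + ?Y' x * ((kk k - kk l) * c + kk l * (c - c'))"
      by (simp add: algebra_simps)
    also have "cmod \<dots> \<le> cmod (kk k * ((?Y x - ?Y' x) * c)) + cmod (?Y' x) * cmod ((kk k - kk l) * c + kk l * (c - c'))"
      by (rule order_trans[OF norm_triangle_ineq]) (simp add: norm_mult)
    also have "\<dots> \<le> 1 / (2 * k) * D + 2 * (\<delta> + 1 * \<delta>)"
    proof (intro add_mono mult_mono b x)
      show "cmod (kk k * ((?Y x - ?Y' x) * c)) \<le> 1 / (2 * k) * D"
        unfolding norm_mult norm_kk[OF k0] c using k0 x0(2)[OF x] by (auto simp: D_def intro!: divide_right_mono)
      have "cmod (kk l) \<le> 1" using l by (simp add: norm_kk)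
      then have "cmod (kk l * (c - c')) \<le> 1 * \<delta>"
        unfolding norm_mult using c d0 by (intro mult_mono) auto
      moreover have "cmod ((kk k - kk l) * c) \<le> \<delta>" using kkd c by (simp add: norm_mult)
      ultimately show "cmod ((kk k - kk l) * c + kk l * (c - c')) \<le> \<delta> + 1 * \<delta>"
        by (intro order_trans[OF norm_triangle_ineq] add_mono)
    qed auto
    finally show ?thesis by simp
  qed
  have cd: "cmod (cis (k * x) - cis (l * x)) \<le> \<delta>" "cmod (cis (- (k * x)) - cis (- (l * x))) \<le> \<delta>" if "x \<in> {0..1}" for x
  proof -
    have "\<bar>k * x - l * x\<bar> \<le> \<delta> * 1"
      unfolding \<delta>_def left_diff_distrib[symmetric] abs_mult using that by (intro mult_left_mono) auto
    then show "cmod (cis (k * x) - cis (l * x)) \<le> \<delta>" "cmod (cis (- (k * x)) - cis (- (l * x))) \<le> \<delta>"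
      using norm_cis_diff_le[of "k * x" "l * x"] norm_cis_diff_le[of "- (k * x)" "- (l * x)"] by auto
  qed
  define E where "E = ?Q * (D / (2 * k) + 4 * \<delta>)"
  have bound: "cmod (F x) \<le> E"
    if p: "prim (\<lambda>x. q x * h x) F" and F0: "F 0 = 0" and h: "continuous_on {0..1} h"
      "\<And>x. x \<in> {0..1} \<Longrightarrow> cmod (h x) \<le> D / (2 * k) + 4 * \<delta>" and x: "x \<in> {0..1}" for F h x
    using prim_diff_le_norm1[OF p x] norm1_mult_le[OF q h] F0 by (simp add: E_def mult.commute)
  have A: "cmod (A x - A' x) \<le> E" if x: "x \<in> {0..1}" for x
  proof (rule bound[OF _ _ _ _ x])
    let ?h = "\<lambda>x. kk k * (?Y x * cis (- (k * x))) - kk l * (?Y' x * cis (- (l * x)))"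
    show "prim (\<lambda>x. q x * ?h x) (\<lambda>x. A x - A' x)"
      by (rule prim_cong[OF prim_diff[OF conjunct1[OF sk[unfolded psol_def]] conjunct1[OF sl[unfolded psol_def]]]])
        (auto simp: algebra_simps)
    show "continuous_on {0..1} ?h" by (intro continuous_intros Yc)
    show "cmod (?h x) \<le> D / (2 * k) + 4 * \<delta>" if "x \<in> {0..1}" for x
      by (intro main cd that) auto
  qed (use init in simp)
  have B: "cmod (B x - B' x) \<le> E" if x: "x \<in> {0..1}" for x
  proof (rule bound[OF _ _ _ _ x])
    let ?h = "\<lambda>x. - (kk k * (?Y x * cis (k * x)) - kk l * (?Y' x * cis (l * x)))"
    show "prim (\<lambda>x. q x * ?h x) (\<lambda>x. B x - B' x)"
      by (rule prim_cong[OF prim_diff[OF conjunct2[OF sk[unfolded psol_def]] conjunct2[OF sl[unfolded psol_def]]]])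
        (auto simp: algebra_simps)
    show "continuous_on {0..1} ?h" by (intro continuous_intros Yc)
    show "cmod (?h x) \<le> D / (2 * k) + 4 * \<delta>" if "x \<in> {0..1}" for x
      unfolding norm_minus_cancel by (intro main cd that) auto
  qed (use init in simp)
  have "?Y x0 - ?Y' x0 = ((A x0 - A' x0) * cis (k * x0) + A' x0 * (cis (k * x0) - cis (l * x0))) +
     ((B x0 - B' x0) * cis (- (k * x0)) + B' x0 * (cis (- (k * x0)) - cis (- (l * x0))))"
    by (simp add: ycomb_def algebra_simps)
  then have "D \<le> (cmod (A x0 - A' x0) + cmod (A' x0) * cmod (cis (k * x0) - cis (l * x0))) +
     (cmod (B x0 - B' x0) + cmod (B' x0) * cmod (cis (- (k * x0)) - cis (- (l * x0))))"
    unfolding D_def by (simp only:) (intro norm_triangle_mono order_trans[OF norm_triangle_ineq], auto simp: norm_mult)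
  \<comment> \<open>\<open>E\<close> contains \<open>norm1 q * D / (2 * k)\<close>, so its two
    copies contribute at most \<open>D / 2\<close>, which is absorbed; the rest gives the constant
    \<open>16 * norm1 q + 8\<close>.\<close>
  also have "\<dots> \<le> (E + 2 * \<delta>) + (E + 2 * \<delta>)"
    by (intro add_mono A B mult_mono b cd x0(1)) auto
  also have "\<dots> = ?Q / k * D + 8 * ?Q * \<delta> + 4 * \<delta>" by (simp add: E_def algebra_simps)
  also have "?Q / k * D \<le> 1 / 2 * D"
    using k by (intro mult_right_mono) (auto simp: D_def field_simps)
  finally have D: "D \<le> (16 * ?Q + 8) * \<delta>" by (simp add: algebra_simps)
  have "E = ?Q / (2 * k) * D + 4 * ?Q * \<delta>" by (simp add: E_def algebra_simps)
  also have "\<dots> \<le> 1 / 4 * ((16 * ?Q + 8) * \<delta>) + 4 * ?Q * \<delta>"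
    using k D Q0 by (intro add_right_mono mult_mono) (auto simp: D_def field_simps)
  also have "\<dots> \<le> 8 * (?Q + 1) * \<delta>" using d0 by (simp add: algebra_simps)
  finally have "E \<le> 8 * (?Q + 1) * \<delta>" .
  then show "cmod (A 1 - A' 1) \<le> 8 * (norm1 q + 1) * \<bar>k - l\<bar>" "cmod (B 1 - B' 1) \<le> 8 * (norm1 q + 1) * \<bar>k - l\<bar>"
    using A[of 1] B[of 1] by (auto simp: \<delta>_def)
qed

lemma discriminant_continuous:
  assumes q: "L1 q" and K: "K \<ge> 1" "2 * norm1 q \<le> K"
  shows "continuous_on {K..} (discriminant q)"
proof -
  let ?C = "8 * (norm1 q + 1)"
  have lip: "cmod (fst (fsol q k 1 0) 1 - fst (fsol q l 1 0) 1) \<le> ?C * \<bar>k - l\<bar>"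
    "cmod (snd (fsol q k 0 1) 1 - snd (fsol q l 0 1) 1) \<le> ?C * \<bar>k - l\<bar>" if "k \<in> {K..}" "l \<in> {K..}" for k l
    using that K by (intro psol_lipschitz[OF q _ _ _ _ fsol(1)[OF q] fsol(1)[OF q]]; simp add: fsol[OF q])+
  have c: "continuous_on {K..} f" if "\<And>k l. k \<in> {K..} \<Longrightarrow> l \<in> {K..} \<Longrightarrow> cmod (f k - f l) \<le> ?C * \<bar>k - l\<bar>"
    for f :: "real \<Rightarrow> complex"
    by (rule lipschitz_on_continuous_on[of ?C], rule lipschitz_onI)
      (use that norm1_nonneg[of q] in \<open>auto simp: dist_norm dist_real_def\<close>)
  have "continuous_on {K..} (\<lambda>k. fst (fsol q k 1 0) 1)" "continuous_on {K..} (\<lambda>k. snd (fsol q k 0 1) 1)"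
    by (intro c lip; assumption)+
  then show ?thesis
    unfolding discriminant_def[abs_def] mono1_def mono2_def by (intro continuous_intros)
qed

section \<open>Floquet solutions and their resonant form\<close>

lemma kernel_2x2:
  fixes a b c d :: complex
  assumes "a * d - b * c = 0"
  shows "\<exists>x y. (x \<noteq> 0 \<or> y \<noteq> 0) \<and> a * x + b * y = 0 \<and> c * x + d * y = 0"
proof -
  consider "b \<noteq> 0" | "b = 0" "c \<noteq> 0" | "b = 0" "c = 0" by blast
  then show ?thesis
  proof cases
    case 1
    then show ?thesis using assms by (intro exI[of _ b] exI[of _ "- a"]) (auto simp: algebra_simps)
  next
    case 2
    then show ?thesis using assms by (intro exI[of _ d] exI[of _ "- c"]) (auto simp: algebra_simps)
  next
    case 3
    then show ?thesis using assms
      by (cases "a = 0") (auto intro: exI[of _ 1] exI[of _ 0])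
  qed
qed

text \<open>The equation for \<open>\<rho>\<close> is the characteristic equation of the monodromy
  matrix, with constant term the determinant 1; an eigenvector supplies the initial
  amplitudes.\<close>

lemma floquet_solution:
  assumes q: "L1 q" and k: "k > 0" "2 * norm1 q \<le> k" and \<rho>: "\<rho>\<^sup>2 - discriminant q k * \<rho> + 1 = 0"
  shows "\<exists>A B. psol q k A B \<and> (A 0 \<noteq> 0 \<or> B 0 \<noteq> 0) \<and> A 1 * cis k = \<rho> * A 0 \<and> B 1 * cis (- k) = \<rho> * B 0"
proof -
  define a b c d where "a = mono1 q k 1 0" and "b = mono1 q k 0 1" and "c = mono2 q k 1 0" and "d = mono2 q k 0 1"
  have det: "a * d - b * c = 1"
    using monodromy_det[OF q k] by (simp add: a_def b_def c_def d_def)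
  have "(a - \<rho>) * (d - \<rho>) - b * c = \<rho>\<^sup>2 - (a + d) * \<rho> + (a * d - b * c)"
    by (simp add: algebra_simps power2_eq_square)
  also have "\<dots> = 0" unfolding det using \<rho> by (simp add: discriminant_def a_def d_def)
  finally obtain x y where xy: "x \<noteq> 0 \<or> y \<noteq> 0" "(a - \<rho>) * x + b * y = 0" "c * x + (d - \<rho>) * y = 0"
    using kernel_2x2 by blast
  note f = fsol[OF q k, of x y]
  show ?thesis
  proof (intro exI conjI)
    show "psol q k (fst (fsol q k x y)) (snd (fsol q k x y))" by (rule f)
    have "a * x + b * y = \<rho> * x" "c * x + d * y = \<rho> * y"
      using xy(2,3) by (simp_all add: algebra_simps)
    then show "fst (fsol q k x y) 1 * cis k = \<rho> * fst (fsol q k x y) 0" "snd (fsol q k x y) 1 * cis (- k) = \<rho> * snd (fsol q k x y) 0"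
      using psol_monodromy[OF q k f(1)] by (simp_all add: f a_def b_def c_def d_def)
  qed (use xy(1) in \<open>simp add: f\<close>)
qed

definition ycomb' :: "real \<Rightarrow> (real \<Rightarrow> complex) \<Rightarrow> (real \<Rightarrow> complex) \<Rightarrow> real \<Rightarrow> complex" where
  "ycomb' k A B x = \<i> * of_real k * (A x * cis (k * x) - B x * cis (- (k * x)))"

text \<open>The kernels in \<open>psol\<close> are such that the derivatives of the amplitudes
  cancel in the first derivative of the solution. In the second they add up, and
  \<open>kk k * (2 * \<i> * k) = 1\<close> restores \<open>q\<close> times the solution.\<close>

lemma psol_ode:
  assumes sol: "psol q k A B" and k: "k > 0"
  shows "prim (ycomb' k A B) (ycomb k A B)" "prim (\<lambda>x. (q x - (of_real k)\<^sup>2) * ycomb k A B x) (ycomb' k A B)"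
proof -
  let ?Y = "ycomb k A B"
  have kk: "kk k * (2 * \<i> * of_real k) = 1" using k by (simp add: kk_def)
  have c2: "prim (\<lambda>x. - (\<i> * of_real k) * cis (- (k * x))) (\<lambda>x. cis (- (k * x)))"
    by (rule prim_cong[OF prim_cis[of "- k"]]) auto
  have a: "prim (\<lambda>x. kk k * (q x * (?Y x * cis (- (k * x)))) * cis (k * x) + A x * (\<i> * of_real k * cis (k * x))) (\<lambda>x. A x * cis (k * x))"
    by (rule prim_mult[OF _ prim_cis]) (use sol in \<open>simp add: psol_def\<close>)
  have b: "prim (\<lambda>x. - kk k * (q x * (?Y x * cis (k * x))) * cis (- (k * x)) + B x * (- (\<i> * of_real k) * cis (- (k * x)))) (\<lambda>x. B x * cis (- (k * x)))"
    by (rule prim_mult[OF _ c2]) (use sol in \<open>simp add: psol_def\<close>)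
  show "prim (ycomb' k A B) ?Y"
    by (rule prim_cong[OF prim_add[OF a b]]) (simp_all add: ycomb_def ycomb'_def algebra_simps)
  show "prim (\<lambda>x. (q x - (of_real k)\<^sup>2) * ?Y x) (ycomb' k A B)"
  proof (rule prim_cong[OF prim_cmult[OF prim_diff[OF a b], of "\<i> * of_real k"]])
    fix x :: real
    have "\<i> * of_real k * (kk k * (q x * (?Y x * cis (- (k * x)))) * cis (k * x) + A x * (\<i> * of_real k * cis (k * x)) -
       (- kk k * (q x * (?Y x * cis (k * x))) * cis (- (k * x)) + B x * (- (\<i> * of_real k) * cis (- (k * x))))) =
       (kk k * (2 * \<i> * of_real k)) * (q x * ?Y x) + (\<i> * of_real k)\<^sup>2 * ?Y x"
      by (simp add: ycomb_def algebra_simps power2_eq_square)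
    also have "\<dots> = (q x - (of_real k)\<^sup>2) * ?Y x"
      unfolding kk by (simp add: algebra_simps power2_eq_square)
    finally show "\<i> * of_real k * (kk k * (q x * (?Y x * cis (- (k * x)))) * cis (k * x) + A x * (\<i> * of_real k * cis (k * x)) -
       (- kk k * (q x * (?Y x * cis (k * x))) * cis (- (k * x)) + B x * (- (\<i> * of_real k) * cis (- (k * x))))) =
       (q x - (of_real k)\<^sup>2) * ?Y x" .
  qed (simp add: ycomb'_def)
qed

lemma ycomb_nonzero:
  assumes sol: "psol q k A B" and k: "k \<ge> 2" and nz: "A 0 \<noteq> 0 \<or> B 0 \<noteq> 0"
  shows "\<exists>x\<in>{0..1}. ycomb k A B x \<noteq> 0"
proof (rule ccontr)
  assume "\<not> ?thesis"
  then have Y: "ycomb k A B x = 0" if "x \<in> {0..1}" for x using that by blast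
  have pA: "prim (\<lambda>x. 0) A"
    by (rule prim_cong[OF conjunct1[OF sol[unfolded psol_def]]]) (simp_all add: Y)
  have pB: "prim (\<lambda>x. 0) B"
    by (rule prim_cong[OF conjunct2[OF sol[unfolded psol_def]]]) (simp_all add: Y)
  have AB: "A x = A 0" "B x = B 0" if "x \<in> {0..1}" for x
    using that by (auto intro: prim_zero[OF pA] prim_zero[OF pB])
  have 1: "A 0 + B 0 = 0" using Y[of 0] by (simp add: ycomb_def)
  \<comment> \<open>A quarter period, where the exponentials are \<open>\<i>\<close> and
    \<open>- \<i>\<close>; together with the point 0 it separates the two constant amplitudes. It
    lies in \<open>{0..1}\<close> because \<open>k >= 2\<close>.\<close>
  have x: "pi / 2 / k \<in> {0..1}" using k pi_less_4 by (auto simp: field_simps)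
  have "k * (pi / 2 / k) = pi / 2" using k by simp
  then have "A 0 * cis (pi / 2) + B 0 * cis (- (pi / 2)) = 0"
    using Y[OF x] AB[OF x] by (simp only: ycomb_def)
  then have "\<i> * (A 0 - B 0) = 0" by (simp add: cis_pi_half algebra_simps flip: cis_cnj)
  with 1 nz show False by (auto simp: add_eq_0_iff)
qed

text \<open>The amplitudes of the solution relative to the frequency \<open>pi n\<close>, not
  \<open>k\<close>, split \<open>u\<close> as \<open>b x + a x * fexp n x\<close> with
  \<open>b\<close> and \<open>a\<close> periodic. Their derivatives are multiples of
  \<open>(q - z) u\<close> and of \<open>fexp (- n) (q - z) u\<close>, so periodicity is
  solvability, and integrating them yields the two halves of \<open>Tn\<close>. The sign
  \<open>\<sigma>\<close> covers periodic and antiperiodic solutions together.\<close>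

lemma resonant_of_floquet:
  assumes q: "L1 q" and sol: "psol q k A B" and k: "k \<ge> 2" and nz: "A 0 \<noteq> 0 \<or> B 0 \<noteq> 0"
    and n: "n > 0" and \<sigma>: "\<sigma> = cis (pi * of_int n)"
    and per: "A 1 * cis k = \<sigma> * A 0" "B 1 * cis (- k) = \<sigma> * B 0"
  shows "resonant q n (of_real (k\<^sup>2 - (pi * of_int n)\<^sup>2))"
proof -
  define K where "K = pi * real_of_int n"
  have K: "K > 0" using n by (simp add: K_def)
  define z where "z = (of_real (k\<^sup>2 - K\<^sup>2) :: complex)"
  define Y Y1 where "Y = ycomb k A B" and "Y1 = ycomb' k A B"
  have pY: "prim Y1 Y" and pY1: "prim (\<lambda>x. (q x - (of_real k)\<^sup>2) * Y x) Y1"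
    unfolding Y_def Y1_def using psol_ode[OF sol] k by auto
  have \<sigma>2: "\<sigma> * \<sigma> = 1" and \<sigma>m: "cis (- K) = \<sigma>" and \<sigma>K: "cis K = \<sigma>"
  proof -
    show K': "cis K = \<sigma>" by (simp add: \<sigma> K_def)
    show s: "\<sigma> * \<sigma> = 1" using fexp_at_1[of n] by (simp add: \<sigma> cis_mult fexp_def mult.assoc del: fexp_at_1)
    have "cis (- K) = cis (- K) * (\<sigma> * \<sigma>)" using s by simp
    then show "cis (- K) = \<sigma>" by (simp flip: K')
  qed
  have Y01: "Y 1 = \<sigma> * Y 0" "Y1 1 = \<sigma> * Y1 0"
    using per by (simp_all add: Y_def Y1_def ycomb_def ycomb'_def algebra_simps)
  define w where "w = \<i> * complex_of_real K"
  have w0: "w \<noteq> 0" using K by (simp add: w_def)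
  have kap: "kap n = 1 / (2 * w)" by (simp add: kap_def w_def K_def mult_ac)
  have w2: "w * w = - (of_real K)\<^sup>2" unfolding w_def power2_eq_square[symmetric] power_mult_distrib by simp
  define u where "u x = cis (K * x) * Y x" for x
  \<comment> \<open>Half-sums that project onto the exponentials of frequency \<open>- pi n\<close>
    and, for \<open>a\<close>, \<open>pi n\<close>, with the phase removed in both cases.\<close>
  define b where "b x = cis (K * x) * ((1 / 2) * Y x - (1 / (2 * w)) * Y1 x)" for x
  define a where "a x = cis (- (K * x)) * ((1 / 2) * Y x + (1 / (2 * w)) * Y1 x)" for x
  have cm: "prim (\<lambda>x. - w * cis (- (K * x))) (\<lambda>x. cis (- (K * x)))"
    by (rule prim_cong[OF prim_cis[of "- K"]]) (auto simp: w_def)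
  have pb: "prim (\<lambda>x. - kap n * ((q x - z) * u x)) b"
  proof -
    have "prim (\<lambda>x. w * cis (K * x) * ((1 / 2) * Y x - (1 / (2 * w)) * Y1 x) +
        cis (K * x) * ((1 / 2) * Y1 x - (1 / (2 * w)) * ((q x - (of_real k)\<^sup>2) * Y x))) b"
      unfolding b_def w_def by (intro prim_mult prim_cis prim_diff prim_cmult pY pY1)
    then show ?thesis
    proof (rule prim_cong)
      fix x :: real
      have "w * cis (K * x) * ((1 / 2) * Y x - (1 / (2 * w)) * Y1 x) +
        cis (K * x) * ((1 / 2) * Y1 x - (1 / (2 * w)) * ((q x - (of_real k)\<^sup>2) * Y x)) =
        (1 / (2 * w)) * (cis (K * x) * Y x * (w * w - (q x - (of_real k)\<^sup>2)))"
        using w0 by (simp add: field_simps)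
      then show "w * cis (K * x) * ((1 / 2) * Y x - (1 / (2 * w)) * Y1 x) +
        cis (K * x) * ((1 / 2) * Y1 x - (1 / (2 * w)) * ((q x - (of_real k)\<^sup>2) * Y x)) = - kap n * ((q x - z) * u x)"
        by (simp add: kap w2 u_def z_def algebra_simps)
    qed simp
  qed
  have pa: "prim (\<lambda>x. kap n * (fexp (- n) x * ((q x - z) * u x))) a"
  proof -
    have "prim (\<lambda>x. - w * cis (- (K * x)) * ((1 / 2) * Y x + (1 / (2 * w)) * Y1 x) +
        cis (- (K * x)) * ((1 / 2) * Y1 x + (1 / (2 * w)) * ((q x - (of_real k)\<^sup>2) * Y x))) a"
      unfolding a_def by (intro prim_mult cm prim_add prim_cmult pY pY1)
    then show ?thesis
    proof (rule prim_cong)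
      fix x :: real
      have f: "fexp (- n) x * u x = cis (- (K * x)) * Y x"
      proof -
        have "fexp (- n) x * cis (K * x) = cis (- (K * x))" by (simp add: fexp_def K_def cis_mult algebra_simps)
        then show ?thesis by (simp add: u_def flip: mult.assoc)
      qed
      have "- w * cis (- (K * x)) * ((1 / 2) * Y x + (1 / (2 * w)) * Y1 x) +
        cis (- (K * x)) * ((1 / 2) * Y1 x + (1 / (2 * w)) * ((q x - (of_real k)\<^sup>2) * Y x)) =
        (1 / (2 * w)) * (cis (- (K * x)) * Y x * ((q x - (of_real k)\<^sup>2) - w * w))"
        using w0 by (simp add: field_simps)
      also have "\<dots> = kap n * ((q x - z) * (fexp (- n) x * u x))"
        unfolding f by (simp add: kap w2 z_def algebra_simps)
      finally show "- w * cis (- (K * x)) * ((1 / 2) * Y x + (1 / (2 * w)) * Y1 x) +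
        cis (- (K * x)) * ((1 / 2) * Y1 x + (1 / (2 * w)) * ((q x - (of_real k)\<^sup>2) * Y x)) =
        kap n * (fexp (- n) x * ((q x - z) * u x))" by (simp add: mult.left_commute)
    qed simp
  qed
  have uc: "continuous_on {0..1} u"
    unfolding u_def[abs_def] by (intro continuous_intros prim_continuous_on[OF pY])
  have Lvu: "L1 (\<lambda>x. (q x - z) * u x)" by (intro L1_mult_continuous L1_diff L1_const q uc)
  have b01: "b 1 = b 0"
    unfolding b_def Y01 using \<sigma>2 by (simp add: \<sigma>K algebra_simps) (simp flip: mult.assoc)
  have a01: "a 1 = a 0"
    unfolding a_def Y01 using \<sigma>2 by (simp add: \<sigma>m algebra_simps) (simp flip: mult.assoc)
  have kn: "kap n \<noteq> 0" using n by (intro kap_nonzero) simp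
  have m0: "mean (\<lambda>x. (q x - z) * u x) = 0"
    using prim_1[OF pb] b01 kn unfolding mean_cmult by simp
  have mn: "mean (\<lambda>x. fexp (- n) x * ((q x - z) * u x)) = 0"
    using prim_1[OF pa] a01 kn unfolding mean_cmult by simp
  have eb: "b x = mean b + - kap n * zprim (\<lambda>x. (q x - z) * u x) x" if "x \<in> {0..1}" for x
    using zprim_of_derivative[OF pb b01 that] unfolding zprim_cmult[OF Lvu that, of "- kap n"]
    by (metis add.commute diff_add_cancel)
  have ea: "a x = mean a + kap n * zprim (\<lambda>x. fexp (- n) x * ((q x - z) * u x)) x" if "x \<in> {0..1}" for x
    using zprim_of_derivative[OF pa a01 that] unfolding zprim_cmult[OF L1_fexp_mult[OF Lvu] that, of "kap n"]
    by (metis add.commute diff_add_cancel)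
  have ua: "u x = b x + a x * fexp n x" for x
  proof -
    have "fexp n x * cis (- (K * x)) = cis (K * x)" by (simp add: fexp_def K_def cis_mult algebra_simps)
    then have "a x * fexp n x = cis (K * x) * ((1 / 2) * Y x + (1 / (2 * w)) * Y1 x)"
      by (simp add: a_def mult_ac)
    then show ?thesis by (simp add: u_def b_def algebra_simps)
  qed
  have "resonant q n z"
    unfolding resonant_def
  proof (intro exI conjI ballI)
    show "continuous_on {0..1} u" by (rule uc)
    show "\<exists>x\<in>{0..1}. u x \<noteq> 0"
      using ycomb_nonzero[OF sol k nz] by (auto simp: u_def Y_def)
    show "mean (\<lambda>x. (q x - z) * u x) = 0" by (rule m0)
    show "fourier_coeff (\<lambda>x. (q x - z) * u x) n = 0"
      unfolding fourier_coeff_mean using mn by (simp only: mult.commute[of "fexp _ _"])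
    fix x :: real assume x: "x \<in> {0..1}"
    show "u x = mean b + mean a * fexp n x + Tn n (\<lambda>x. (q x - z) * u x) x"
      unfolding ua[of x] eb[OF x] ea[OF x] Tn_def by (simp add: algebra_simps)
  qed
  then show ?thesis by (simp add: z_def K_def)
qed

section \<open>Bloch solutions\<close>

lemma bloch_solution:
  assumes q: "psob s q" "mean q = 0" "psym q" and \<alpha>: "\<alpha> > 0"
    and P: "\<And>n::int. real_of_int n > m \<Longrightarrow> Re (P_coeff q n) < - \<alpha> * real_of_int n powi (- 2 * int s - 2)"
  shows "\<exists>K\<ge>2. \<forall>k\<ge>K. \<exists>A B \<rho>. psol q k A B \<and> (A 0 \<noteq> 0 \<or> B 0 \<noteq> 0) \<and> cmod \<rho> = 1 \<and>
    A 1 * cis k = \<rho> * A 0 \<and> B 1 * cis (- k) = \<rho> * B 0"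
proof -
  have Lq: "L1 q" by (rule psob_L1[OF q(1)])
  obtain N0 where N0: "\<And>(n::int) z::real. N0 \<le> real_of_int n \<Longrightarrow> \<bar>z\<bar> \<le> real_of_int n / 4 \<Longrightarrow> \<not> resonant q n (of_real z)"
    using eventually_not_resonant[OF q \<alpha> P] by blast
  \<comment> \<open>A small angle serves two purposes: within \<open>1 / 100\<close> of
    \<open>pi n\<close> the shift \<open>z\<close> stays below \<open>n / 4\<close>, as the
    exclusion of resonances requires, and further away \<open>2 cos x\<close> keeps a distance of at
    least \<open>2 * (1 - c)\<close> from 2 and -2.\<close>
  define c where "c = cos (1 / 100 :: real)"
  have c: "c < 1" using cos_monotone_0_pi[of 0 "1/100"] pi_gt3 by (simp add: c_def)
  have c0: "c > 0" unfolding c_def using pi_gt3 by (intro cos_gt_zero) auto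
  \<comment> \<open>The entries provide \<open>k >= 2\<close> and the contraction, errors of the
    discriminant below 1 and below \<open>2 * (1 - c)\<close>, and finally
    \<open>n >= x / 4 - 1 >= N0\<close>.\<close>
  define K where "K = max (max 2 (4 * norm1 q + 1)) (max (norm1 q / (1 - c) + 1) (4 * \<bar>N0\<bar> + 4))"
  have K: "2 \<le> K" "4 * norm1 q < K" "norm1 q / (1 - c) < K" "4 * \<bar>N0\<bar> + 4 \<le> K"
    by (auto simp: K_def)
  have k: "k > 0" "2 * norm1 q \<le> k" "k \<ge> 2" if "k \<ge> K" for k
    using that K norm1_nonneg[of q] by auto
  define F where "F x = Re (discriminant q x)" for x
  have F: "discriminant q x = of_real (F x)" if "x \<ge> K" for x
    using discriminant_real[OF Lq q(3) k(1,2)[OF that]] by (simp add: F_def)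
  have approx: "\<bar>F x - 2 * cos x\<bar> \<le> 2 * norm1 q / x" if "x \<ge> K" for x
  proof -
    have "discriminant q x - 2 * of_real (cos x) = of_real (F x - 2 * cos x)"
      by (simp add: F[OF that])
    then show ?thesis
      using discriminant_approx[OF Lq k(1,2)[OF that]] by (simp only: norm_of_real)
  qed
  have small1: "2 * norm1 q / x < 1" if "x \<ge> K" for x
    using that K k(1)[OF that] norm1_nonneg[of q] by (simp add: field_simps)
  have small2: "2 * norm1 q / x < 2 * (1 - c)" if "x \<ge> K" for x
  proof -
    have "norm1 q < (1 - c) * K" using K(3) c by (simp add: pos_divide_less_eq mult.commute)
    also have "\<dots> \<le> (1 - c) * x" using that c by (intro mult_left_mono) auto
    finally have "2 * norm1 q < 2 * ((1 - c) * x)" by linarith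
    then show ?thesis using k(1)[OF that] by (simp only: pos_divide_less_eq mult.assoc)
  qed
  have not2: "F x \<noteq> 2 \<and> F x \<noteq> - 2" if x: "x \<ge> K" for x
  proof -
    define n where "n = round (x / pi)"
    define d where "d = x - pi * of_int n"
    have "\<bar>of_int n - x / pi\<bar> \<le> 1 / 2" unfolding n_def by (rule of_int_round_abs_le)
    then have "\<bar>pi * (of_int n - x / pi)\<bar> \<le> pi * (1 / 2)"
      unfolding abs_mult by (intro mult_mono) auto
    then have d: "\<bar>d\<bar> \<le> pi / 2" by (simp add: d_def algebra_simps abs_minus_commute)
    define \<sigma> where "\<sigma> = cos (pi * of_int n)"
    have \<sigma>: "\<sigma> = 1 \<or> \<sigma> = - 1"
      unfolding \<sigma>_def by (metis cos_npi_int mult.commute)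
    have sin0: "sin (pi * real_of_int n) = 0" by (simp add: mult.commute sin_npi_int)
    have cosx: "cos x = \<sigma> * cos d"
      using cos_add[of "pi * of_int n" d] by (simp add: d_def \<sigma>_def sin0)
    have cd: "cos d \<ge> 0" using d by (intro cos_ge_zero) auto
    show ?thesis
    proof (cases "\<bar>d\<bar> \<ge> 1 / 100")
      case True
      have "cos d = cos \<bar>d\<bar>" by simp
      also have "\<dots> \<le> c" unfolding c_def using True d pi_gt3 by (intro cos_monotone_0_pi_le) auto
      finally have "\<bar>cos x\<bar> \<le> c" using cd \<sigma> by (auto simp: cosx)
      then show ?thesis using approx[OF x] small2[OF x] by (auto simp: abs_le_iff)
    next
      case False
      \<comment> \<open>Near \<open>pi n\<close> the cosine has the sign \<open>\<sigma>\<close>, so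
        the opposite value differs from \<open>2 cos x\<close> by at least 2, beyond the
        error.\<close>
      have "F x \<noteq> - 2 * \<sigma>"
      proof
        assume "F x = - 2 * \<sigma>"
        then have "F x - 2 * cos x = - \<sigma> * (2 + 2 * cos d)" by (simp add: cosx algebra_simps)
        then have "\<bar>F x - 2 * cos x\<bar> = 2 + 2 * cos d" using \<sigma> cd by (auto simp: abs_mult)
        then show False using approx[OF x] small1[OF x] cd by linarith
      qed
      moreover have "F x \<noteq> 2 * \<sigma>"
      proof
        assume Fx: "F x = 2 * \<sigma>"
        have dd: "\<bar>d\<bar> < 1 / 100" using False by simp
        have pn: "pi * of_int n = x - d" by (simp add: d_def)
        have "pi * of_int n > 0" unfolding pn using dd k(3)[OF x] by linarith
        then have n0: "n > 0" using pi_gt_zero by (simp add: zero_less_mult_iff)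
        have pn4: "pi * of_int n \<le> 4 * of_int n" using n0 pi_less_4 by (intro mult_right_mono) auto
        then have n: "real_of_int n \<ge> x / 4 - 1" using pn dd by linarith
        define z where "z = x\<^sup>2 - (pi * of_int n)\<^sup>2"
        have "z = d * (2 * (pi * of_int n) + d)" by (simp add: z_def d_def power2_eq_square algebra_simps)
        then have "\<bar>z\<bar> = \<bar>d\<bar> * \<bar>2 * (pi * of_int n) + d\<bar>" by (simp add: abs_mult)
        also have "\<dots> \<le> (1 / 100) * (2 * (4 * of_int n) + of_int n)"
        proof (intro mult_mono)
          have "real_of_int n \<ge> 1" using n0 by simp
          moreover have "0 \<le> pi * of_int n" using n0 by simp
          ultimately show "\<bar>2 * (pi * of_int n) + d\<bar> \<le> 2 * (4 * real_of_int n) + of_int n" using pn4 dd by linarith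
        qed (use dd in auto)
        also have "\<dots> \<le> real_of_int n / 4" using n0 by simp
        finally have zn: "\<bar>z\<bar> \<le> real_of_int n / 4" .
        have "N0 \<le> real_of_int n" using n x K(4) by linarith
        then have nr: "\<not> resonant q n (of_real z)" using N0 zn by blast
        \<comment> \<open>At \<open>F x = 2 * \<sigma>\<close> the characteristic polynomial is
          \<open>(\<rho> - \<sigma>)^2\<close>, so the multiplier is a sign and the Floquet solution
          is periodic or antiperiodic.\<close>
        define \<rho> where "\<rho> = cis (pi * of_int n)"
        have \<rho>: "\<rho> = of_real \<sigma>" by (simp add: \<rho>_def \<sigma>_def complex_eq_iff sin0)
        have "\<rho>\<^sup>2 - discriminant q x * \<rho> + 1 = 0"
          using \<sigma> by (auto simp: F[OF x] Fx \<rho>)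
        from floquet_solution[OF Lq k(1,2)[OF x] this] obtain A B where
          AB: "psol q x A B" "A 0 \<noteq> 0 \<or> B 0 \<noteq> 0" "A 1 * cis x = \<rho> * A 0" "B 1 * cis (- x) = \<rho> * B 0" by blast
        have "resonant q n (of_real (x\<^sup>2 - (pi * of_int n)\<^sup>2))"
          by (rule resonant_of_floquet[OF Lq AB(1) k(3)[OF x] AB(2) n0 \<rho>_def AB(3,4)])
        with nr show False by (simp add: z_def)
      qed
      ultimately show ?thesis using \<sigma> by auto
    qed
  qed
  have cont: "continuous_on {K..} F"
    unfolding F_def[abs_def] using K norm1_nonneg[of q]
    by (intro continuous_intros discriminant_continuous[OF Lq]) auto
  have conn: "connected (F ` {K..})"
    by (rule connected_continuous_image[OF cont]) (rule connected_Ici)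
  have F2: "\<bar>F x\<bar> < 2" if x: "x \<ge> K" for x
  proof (rule ccontr)
    assume "\<not> \<bar>F x\<bar> < 2"
    obtain j :: nat where j: "K \<le> real j" using real_arch_simple by blast
    \<comment> \<open>A zero of the cosine beyond \<open>K\<close>: there \<open>F\<close> is below
      1 in modulus, so a point with modulus at least 2 would force the value 2 or -2 in the
      connected image.\<close>
    define x1 where "x1 = pi * of_int (int j) + pi / 2"
    have "real j \<le> pi * real j" using pi_ge_two by (intro mult_le_cancel_right1[THEN iffD2]) auto
    then have x1: "x1 \<ge> K" using j pi_gt_zero unfolding x1_def of_int_of_nat_eq by linarith
    have "cos x1 = 0"
      unfolding x1_def by (simp add: cos_add mult.commute[of pi] sin_npi)
    then have "\<bar>F x1\<bar> < 1" using approx[OF x1] small1[OF x1] by simp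
    then have a: "F x1 \<in> F ` {K..}" "- 1 < F x1" "F x1 < 1" and b: "F x \<in> F ` {K..}" using x1 x by auto
    consider "F x \<ge> 2" | "F x \<le> - 2" using \<open>\<not> \<bar>F x\<bar> < 2\<close> by linarith
    then show False
    proof cases
      case 1
      have "2 \<in> F ` {K..}" by (rule connectedD_interval[OF conn a(1) b]) (use a 1 in auto)
      then show False using not2 by force
    next
      case 2
      have "- 2 \<in> F ` {K..}" by (rule connectedD_interval[OF conn b a(1)]) (use a 2 in auto)
      then show False using not2 by force
    qed
  qed
  show ?thesis
  proof (intro exI[of _ K] conjI allI impI K(1))
    fix x assume x: "x \<ge> K"
    define \<theta> where "\<theta> = arccos (F x / 2)"
    have ct: "2 * cos \<theta> = F x" using F2[OF x] by (simp add: \<theta>_def cos_arccos)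
    have "discriminant q x = cis \<theta> + cis (- \<theta>)"
      by (simp add: F[OF x] complex_eq_iff flip: ct)
    then have "(cis \<theta>)\<^sup>2 - discriminant q x * cis \<theta> + 1 = 0"
      by (simp add: power2_eq_square algebra_simps)
    from floquet_solution[OF Lq k(1,2)[OF x] this]
    obtain A B where "psol q x A B" "A 0 \<noteq> 0 \<or> B 0 \<noteq> 0" "A 1 * cis x = cis \<theta> * A 0" "B 1 * cis (- x) = cis \<theta> * B 0"
      by blast
    then show "\<exists>A B \<rho>. psol q x A B \<and> (A 0 \<noteq> 0 \<or> B 0 \<noteq> 0) \<and> cmod \<rho> = 1 \<and>
      A 1 * cis x = \<rho> * A 0 \<and> B 1 * cis (- x) = \<rho> * B 0"
      by (intro exI[of _ A] exI[of _ B] exI[of _ "cis \<theta>"]) auto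
  qed
qed

section \<open>Quasi-periodic extension to the line\<close>

lemma quasi_periodic_shift:
  assumes f: "\<And>x. f (x + 1) = \<rho> * f x" and \<rho>: "\<rho> \<noteq> (0::complex)"
  shows "f (x + of_int m) = \<rho> powi m * f x"
proof (induction m rule: int_induct[where k = 0])
  case (step1 m)
  then show ?case using f[of "x + of_int m"] \<rho> by (simp add: add.assoc power_int_add)
next
  case (step2 m)
  have "f (x + of_int m) = \<rho> * f (x + of_int (m - 1))"
    using f[of "x + of_int (m - 1)"] by (simp add: algebra_simps)
  then have "\<rho> * f (x + of_int (m - 1)) = \<rho> * (\<rho> powi (m - 1) * f x)"
    using step2 \<rho> by (simp add: power_int_diff)
  then show ?case using \<rho> by simp
qed simp

lemma has_integral_shift_real:
  fixes f :: "real \<Rightarrow> 'a::banach"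
  assumes "(f has_integral i) {a..b}"
  shows "((\<lambda>x. f (x - c)) has_integral i) {a + c..b + c}"
  using has_integral_affinity'[of f i a b 1 "- c"] assms by simp

lemma quasi_periodic_abs_integrable:
  fixes f :: "real \<Rightarrow> complex"
  assumes f: "\<And>x. f (x + 1) = \<rho> * f x" and \<rho>: "\<rho> \<noteq> 0" and L: "L1 f"
  shows "f absolutely_integrable_on {a..b}"
proof -
  have unit: "f absolutely_integrable_on {of_int m..of_int m + 1}" for m :: int
  proof -
    have eq: "f x = \<rho> powi m * f (x - of_int m)" for x
      using quasi_periodic_shift[of f \<rho>, OF f \<rho>, of "x - of_int m" m] by simp
    have i1: "(\<lambda>x. \<rho> powi m * f (x - of_int m)) integrable_on {of_int m..of_int m + 1}"
      using has_integral_shift_real[OF integrable_integral[OF L1_integrable[OF L]], of "of_int m"]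
      by (intro integrable_on_mult_right) (auto simp: add.commute)
    have i2: "(\<lambda>x. cmod (\<rho> powi m) * cmod (f (x - of_int m))) integrable_on {of_int m..of_int m + 1}"
      using has_integral_shift_real[OF integrable_integral[OF L1_norm_integrable[OF L]], of "of_int m"]
      by (intro integrable_on_mult_right) (auto simp: add.commute)
    show ?thesis
      unfolding absolutely_integrable_on_def
      using i1 i2 by (subst (1 2) eq[abs_def]) (auto simp: norm_mult)
  qed
  have "f absolutely_integrable_on {- real n..real n}" for n :: nat
  proof (induction n)
    case 0
    show ?case using absolutely_integrable_on_null[of "0::real" 0 f] by simp
  next
    case (Suc n)
    have 1: "f absolutely_integrable_on {- real (Suc n)..- real n}"
      using unit[of "- int (Suc n)"] by (simp add: algebra_simps)
    have 2: "f absolutely_integrable_on {real n..real (Suc n)}"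
      using unit[of "int n"] by (simp add: add.commute)
    have "f absolutely_integrable_on {- real (Suc n)..real n}"
      by (rule absolutely_integrable_on_combine[OF 1 Suc]) auto
    from absolutely_integrable_on_combine[OF this 2] show ?case by auto
  qed
  moreover obtain n :: nat where "max \<bar>a\<bar> \<bar>b\<bar> \<le> real n" using real_arch_simple by blast
  then have "{a..b} \<subseteq> {- real n..real n}" by auto
  ultimately show ?thesis by (rule absolutely_integrable_on_subinterval)
qed

text \<open>\<open>F\<close> minus the primitive of \<open>f\<close> is constant on each unit cell,
  by shifting the identity from \<open>{0..1}\<close> and multiplying by a power of
  \<open>\<rho>\<close>. Neighbouring cells share an endpoint, so the constant is the same on the
  whole line.\<close>

lemma quasi_periodic_prim:
  fixes f F :: "real \<Rightarrow> complex"
  assumes f: "\<And>x. f (x + 1) = \<rho> * f x" and F: "\<And>x. F (x + 1) = \<rho> * F x" and \<rho>: "\<rho> \<noteq> 0"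
    and p: "prim f F" and xy: "x \<le> y"
  shows "F y - F x = integral {x..y} f"
proof -
  have int: "f integrable_on {a..b}" for a b
    using quasi_periodic_abs_integrable[of f \<rho>, OF f \<rho> prim_L1[OF p]] absolutely_integrable_on_def by blast
  define G where "G x = F x - primitive f x" for x
  have cell: "G x = G (of_int m)" if x: "of_int m \<le> x" "x \<le> of_int m + 1" for x and m :: int
  proof -
    have x': "0 \<le> x - of_int m" "x - of_int m \<le> 1" using x by auto
    have "(f has_integral F (x - of_int m) - F 0) {0..x - of_int m}"
      using p x' L1_subinterval[OF prim_L1[OF p], of 0 "x - of_int m"] by (auto simp: prim_def has_integral_iff)
    then have "((\<lambda>t. f (t - of_int m)) has_integral F (x - of_int m) - F 0) {of_int m..x}"
      using has_integral_shift_real[of f _ 0 "x - of_int m" "of_int m"] by simp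
    then have "((\<lambda>t. \<rho> powi m * f (t - of_int m)) has_integral \<rho> powi m * (F (x - of_int m) - F 0)) {of_int m..x}"
      by (rule has_integral_mult_right)
    moreover have "\<rho> powi m * f (t - of_int m) = f t" for t
      using quasi_periodic_shift[of f \<rho>, OF f \<rho>, of "t - of_int m" m] by simp
    moreover have "\<rho> powi m * (F (x - of_int m) - F 0) = F x - F (of_int m)"
      using quasi_periodic_shift[of F \<rho>, OF F \<rho>, of "x - of_int m" m] quasi_periodic_shift[of F \<rho>, OF F \<rho>, of 0 m]
      by (simp add: right_diff_distrib)
    ultimately have "integral {of_int m..x} f = F x - F (of_int m)" by (auto intro: integral_unique)
    then show ?thesis
      using primitive_diff[OF int x(1)] by (simp add: G_def algebra_simps)
  qed
  have "G (of_int m) = G 0" for m :: int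
  proof (induction m rule: int_induct[where k = 0])
    case (step1 i)
    then show ?case using cell[of i "of_int i + 1"] by simp
  next
    case (step2 i)
    then show ?case using cell[of "i - 1" "of_int i"] by simp
  qed simp
  then have G0: "G x = G 0" for x
    using cell[of "\<lfloor>x\<rfloor>" x] by (metis of_int_floor_le floor_correct less_imp_le of_int_1 of_int_add)
  have "G x = G y" by (rule trans[OF G0 G0[symmetric]])
  then show ?thesis
    using primitive_diff[OF int xy] by (simp add: G_def algebra_simps)
qed

text \<open>The integral identities survive the extension, so \<open>\<psi>'\<close> is continuous
  as an indefinite integral, and differentiability across the integers follows without matching
  one-sided derivatives. Boundedness is where \<open>cmod \<rho> = 1\<close> enters.\<close>

lemma bloch_extension:
  assumes q: "L1 q" "\<And>x. q (x + 1) = q x" and sol: "psol q k A B" and k: "k \<ge> 2"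
    and nz: "A 0 \<noteq> 0 \<or> B 0 \<noteq> 0" and \<rho>: "cmod \<rho> = 1"
    and per: "A 1 * cis k = \<rho> * A 0" "B 1 * cis (- k) = \<rho> * B 0"
  obtains \<psi> \<psi>' C where "\<And>x. (\<psi> has_vector_derivative \<psi>' x) (at x)" "continuous_on UNIV \<psi>'"
    "locally_abs_continuous \<psi>'" "AE x in lebesgue. (\<psi>' has_vector_derivative (q x - (of_real k)\<^sup>2) * \<psi> x) (at x)"
    "\<And>x. cmod (\<psi> x) \<le> C" "\<And>x. cmod (\<psi>' x) \<le> C" "\<exists>x\<in>{0..1}. \<psi> x \<noteq> 0"
proof -
  define Y Y1 where "Y = ycomb k A B" and "Y1 = ycomb' k A B"
  have pY: "prim Y1 Y" and pY1: "prim (\<lambda>x. (q x - (of_real k)\<^sup>2) * Y x) Y1"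
    unfolding Y_def Y1_def using psol_ode[OF sol] k by auto
  have Y01: "Y 1 = \<rho> * Y 0" "Y1 1 = \<rho> * Y1 0"
    using per by (simp_all add: Y_def Y1_def ycomb_def ycomb'_def algebra_simps)
  have \<rho>0: "\<rho> \<noteq> 0" using \<rho> by auto
  \<comment> \<open>At the integers the jump of the floor is compensated by
    \<open>h 1 = \<rho> * h 0\<close>.\<close>
  define ext where "ext h x = \<rho> powi \<lfloor>x\<rfloor> * h (frac x)" for h :: "real \<Rightarrow> complex" and x
  have ext1: "ext h (x + 1) = \<rho> * ext h x" for h x
    using \<rho>0 by (simp add: ext_def frac_1_eq power_int_add mult.commute[of _ \<rho>])
  have ext01: "ext h x = h x" if "x \<in> {0..1}" "h 1 = \<rho> * h 0" for h x
  proof (cases "x = 1")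
    case False
    then have "\<lfloor>x\<rfloor> = 0" using that by (simp add: floor_eq_iff)
    then show ?thesis by (simp add: ext_def frac_def)
  qed (use that in \<open>simp add: ext_def\<close>)
  define \<psi> \<psi>' where "\<psi> = ext Y" and "\<psi>' = ext Y1"
  define g where "g x = (q x - (of_real k)\<^sup>2) * \<psi> x" for x
  have g1: "g (x + 1) = \<rho> * g x" for x by (simp add: g_def \<psi>_def ext1 q(2))
  have p: "prim \<psi>' \<psi>"
    by (rule prim_cong[OF pY]) (auto simp: \<psi>_def \<psi>'_def ext01 Y01)
  have p1: "prim g \<psi>'"
    by (rule prim_cong[OF pY1]) (auto simp: \<psi>_def \<psi>'_def g_def ext01 Y01)
  have i: "\<psi> y - \<psi> x = integral {x..y} \<psi>'" if "x \<le> y" for x y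
    by (rule quasi_periodic_prim[OF _ _ \<rho>0 p that]) (simp_all add: \<psi>_def \<psi>'_def ext1)
  have i1: "\<psi>' y - \<psi>' x = integral {x..y} g" if "x \<le> y" for x y
    by (rule quasi_periodic_prim[OF _ _ \<rho>0 p1 that]) (simp_all add: \<psi>'_def ext1 g1)
  have ga: "g absolutely_integrable_on {a..b}" for a b
    by (rule quasi_periodic_abs_integrable[OF g1 \<rho>0 prim_L1[OF p1]])
  have ac: "locally_abs_continuous \<psi>'"
    unfolding locally_abs_continuous_def using abs_continuous_on_integral[OF ga i1] by blast
  have c1: "continuous_on {a..b} \<psi>'" for a b
    using ac abs_continuous_on_imp_continuous_on unfolding locally_abs_continuous_def by blast
  have c1': "continuous_on UNIV \<psi>'"
  proof -
    have "isCont \<psi>' x" for x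
      using continuous_on_interior[OF c1[of "x - 1" "x + 1"], of x] by simp
    then show ?thesis by (simp add: continuous_at_imp_continuous_on)
  qed
  have der: "(\<psi> has_vector_derivative \<psi>' x) (at x)" for x
  proof -
    have "((\<lambda>y. integral {x - 1..y} \<psi>') has_vector_derivative \<psi>' x) (at x within {x - 1..x + 1})"
      by (rule integral_has_vector_derivative[OF c1]) auto
    then have "((\<lambda>y. \<psi> (x - 1) + integral {x - 1..y} \<psi>') has_vector_derivative 0 + \<psi>' x) (at x within {x - 1..x + 1})"
      by (intro has_vector_derivative_add has_vector_derivative_const)
    then have "(\<psi> has_vector_derivative 0 + \<psi>' x) (at x within {x - 1..x + 1})"
    proof (rule has_vector_derivative_transform[rotated 2])
      show "\<psi> y = \<psi> (x - 1) + integral {x - 1..y} \<psi>'" if "y \<in> {x - 1..x + 1}" for y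
        using i[of "x - 1" y] that by (metis add.commute atLeastAtMost_iff diff_add_cancel)
    qed auto
    then show ?thesis by (simp add: at_within_Icc_at)
  qed
  have ae: "AE x in lebesgue. (\<psi>' has_vector_derivative g x) (at x)"
    using ga absolutely_integrable_on_def by (intro indefinite_integral_has_vector_derivative_AE i1) blast
  have "bounded (Y ` {0..1})" "bounded (Y1 ` {0..1})"
    by (intro compact_imp_bounded compact_continuous_image prim_continuous_on[OF pY] prim_continuous_on[OF pY1]; simp)+
  then obtain C1 C2 where C: "\<And>x. x \<in> {0..1} \<Longrightarrow> cmod (Y x) \<le> C1" "\<And>x. x \<in> {0..1} \<Longrightarrow> cmod (Y1 x) \<le> C2"
    by (meson bounded_iff imageI)
  have fr: "frac x \<in> {0..1}" for x :: real using frac_lt_1[of x] by (simp add: less_imp_le)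
  have n: "cmod (ext h x) = cmod (h (frac x))" for h x
    by (simp add: ext_def norm_mult norm_power_int \<rho>)
  show thesis
  proof (rule that[OF der c1' ac ae[unfolded g_def]])
    show "cmod (\<psi> x) \<le> max C1 C2" "cmod (\<psi>' x) \<le> max C1 C2" for x
      using C(1)[OF fr[of x]] C(2)[OF fr[of x]] by (auto simp: \<psi>_def \<psi>'_def n)
    show "\<exists>x\<in>{0..1}. \<psi> x \<noteq> 0"
      using ycomb_nonzero[OF sol k nz] by (metis Y_def Y01(1) \<psi>_def ext01)
  qed
qed

section \<open>Weyl sequences and the theorem\<close>

lemma locally_abs_continuous_C1:
  assumes "\<And>x. (g has_vector_derivative g' x) (at x)" "continuous_on UNIV g'"
  shows "locally_abs_continuous g"
  unfolding locally_abs_continuous_def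
proof (intro allI)
  fix a b :: real
  show "abs_continuous_on a b g"
  proof (rule abs_continuous_on_integral)
    show "g' absolutely_integrable_on {a..b}"
      by (rule absolutely_integrable_continuous_real) (rule continuous_on_subset[OF assms(2)], simp)
    show "g y - g x = integral {x..y} g'" if "x \<le> y" for x y
      using fundamental_theorem_of_calculus[OF that has_vector_derivative_at_within[OF assms(1)]]
      by (simp add: integral_unique)
  qed
qed

lemma locally_abs_continuous_mult:
  "locally_abs_continuous f \<Longrightarrow> locally_abs_continuous g \<Longrightarrow> locally_abs_continuous (\<lambda>x. f x * g x)"
  by (simp add: locally_abs_continuous_def abs_continuous_on_mult)

lemma locally_abs_continuous_add:
  "locally_abs_continuous f \<Longrightarrow> locally_abs_continuous g \<Longrightarrow> locally_abs_continuous (\<lambda>x. f x + g x)"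
  by (simp add: locally_abs_continuous_def abs_continuous_on_add)

lemma borel_measurable_lebesgueI: "f \<in> borel_measurable borel \<Longrightarrow> f \<in> borel_measurable lebesgue"
  by (rule measurable_completion) simp

text \<open>On the half-line the primitive \<open>arctan\<close> is bounded; the other half is the
  reflection, and the sum of both dominates the density.\<close>

lemma integrable_cauchy_density: "integrable lebesgue (\<lambda>x::real. 1 / (1 + x\<^sup>2))"
proof -
  define f where "f x = indicator {0..} x * (1 / (1 + x\<^sup>2))" for x :: real
  have nn: "(\<integral>\<^sup>+x. ennreal (1 / (1 + x\<^sup>2)) * indicator {0..} x \<partial>lborel) = ennreal (pi / 2 - arctan 0)"
  proof (rule nn_integral_FTC_atLeast)
    show "(\<lambda>x::real. 1 / (1 + x\<^sup>2)) \<in> borel_measurable borel" by measurable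
    show "DERIV arctan x :> 1 / (1 + x\<^sup>2)" for x
      using DERIV_arctan[of x] by (simp add: divide_inverse)
    show "(arctan \<longlongrightarrow> pi / 2) at_top" by (rule tendsto_arctan_at_top)
  qed simp
  have "integrable lborel f"
  proof (rule integrableI_bounded)
    show "f \<in> borel_measurable lborel" unfolding f_def[abs_def] by measurable
    have "(\<integral>\<^sup>+x. ennreal (norm (f x)) \<partial>lborel) = (\<integral>\<^sup>+x. ennreal (1 / (1 + x\<^sup>2)) * indicator {0..} x \<partial>lborel)"
      by (intro nn_integral_cong) (auto simp: f_def indicator_def)
    then show "(\<integral>\<^sup>+x. ennreal (norm (f x)) \<partial>lborel) < \<infinity>" by (simp add: nn)
  qed
  moreover have "f \<in> borel_measurable lborel" unfolding f_def[abs_def] by measurable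
  ultimately have f: "integrable lebesgue f" by (simp add: integrable_completion)
  then have f': "integrable lebesgue (\<lambda>x. f (0 + (-1) * x))" by (subst lebesgue_integrable_real_affine_iff) auto
  show ?thesis
  proof (rule Bochner_Integration.integrable_bound[OF Bochner_Integration.integrable_add[OF f f']])
    show "AE x in lebesgue. norm (1 / (1 + x\<^sup>2)) \<le> norm (f x + f (0 + - 1 * x))" for x :: real
      by (intro AE_I2) (auto simp: f_def indicator_def)
    have "(\<lambda>x::real. 1 / (1 + x\<^sup>2)) \<in> borel_measurable borel" by measurable
    then show "(\<lambda>x::real. 1 / (1 + x\<^sup>2)) \<in> borel_measurable lebesgue"
      by (rule borel_measurable_lebesgueI)
  qed
qed

text \<open>Applying the operator minus \<open>\<mu>\<close> to \<open>p * \<psi>\<close> leaves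
  only terms with derivatives of the cutoff \<open>p\<close>. For this rational cutoff both
  derivatives are at most a multiple of \<open>\<epsilon> * p\<close>, so the image has squared norm
  of order \<open>\<epsilon>^2 / \<epsilon>\<close>, while \<open>p * \<psi>\<close> keeps a fixed
  mass on \<open>{0..1}\<close>. No bounded inverse survives \<open>\<epsilon>\<close> tending to
  0.\<close>

lemma weyl_sequence:
  assumes der: "\<And>x. (\<psi> has_vector_derivative \<psi>' x) (at x)" and c: "continuous_on UNIV \<psi>'"
    and ac: "locally_abs_continuous \<psi>'"
    and ae: "AE x in lebesgue. (\<psi>' has_vector_derivative (q x - \<mu>) * \<psi> x) (at x)"
    and b: "\<And>x. cmod (\<psi> x) \<le> C" "\<And>x. cmod (\<psi>' x) \<le> C" and nz: "\<exists>x\<in>{0..1}. \<psi> x \<noteq> 0"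
  shows "\<mu> \<notin> resolvent_set (schroedinger_op q)"
proof
  assume "\<mu> \<in> resolvent_set (schroedinger_op q)"
  then obtain R where R: "\<And>y f. (y, f) \<in> schroedinger_op q \<Longrightarrow> L2_norm y \<le> R * L2_norm (\<lambda>x. f x - \<mu> * y x)"
    unfolding resolvent_set_def by blast
  have C0: "0 \<le> C" using b(1)[of 0] norm_ge_zero by (rule order_trans[rotated])
  have \<psi>c: "continuous_on UNIV \<psi>"
    using der by (meson continuous_at_imp_continuous_on has_vector_derivative_continuous)
  define I where "I = (LINT x|lebesgue. 1 / (1 + x\<^sup>2) :: real)"
  define w where "w = (LINT x|lebesgue. indicator {0..1} x * (cmod (\<psi> x))\<^sup>2 :: real)"
  have wi: "integrable lebesgue (\<lambda>x. indicator {0..1} x * (cmod (\<psi> x))\<^sup>2 :: real)"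
  proof -
    have "(\<lambda>x. (cmod (\<psi> x))\<^sup>2) absolutely_integrable_on {0..1}"
      by (intro absolutely_integrable_continuous_real continuous_intros continuous_on_subset[OF \<psi>c]) auto
    then show ?thesis unfolding set_integrable_def real_scaleR_def .
  qed
  have w: "w > 0"
  proof -
    have "w = integral {0..1} (\<lambda>x. (cmod (\<psi> x))\<^sup>2)"
    proof -
      have "(\<lambda>x. (cmod (\<psi> x))\<^sup>2) absolutely_integrable_on {0..1}"
        by (intro absolutely_integrable_continuous_real continuous_intros continuous_on_subset[OF \<psi>c]) auto
      from set_lebesgue_integral_eq_integral(2)[OF this] show ?thesis
        unfolding w_def set_lebesgue_integral_def real_scaleR_def .
    qed
    moreover have "integral {0..1} (\<lambda>x. (cmod (\<psi> x))\<^sup>2) \<noteq> 0"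
    proof
      assume *: "integral {0..1} (\<lambda>x. (cmod (\<psi> x))\<^sup>2) = 0"
      have "continuous_on {0..1} (\<lambda>x. (cmod (\<psi> x))\<^sup>2)"
        by (intro continuous_intros continuous_on_subset[OF \<psi>c]) simp
      then have "\<forall>x\<in>{0..1}. (cmod (\<psi> x))\<^sup>2 = 0"
        using integral_eq_0_iff[of 0 1 "\<lambda>x. (cmod (\<psi> x))\<^sup>2"] * by simp
      then show False using nz by auto
    qed
    moreover have "integral {0..1} (\<lambda>x. (cmod (\<psi> x))\<^sup>2) \<ge> 0"
      by (rule Henstock_Kurzweil_Integration.integral_nonneg)
        (auto intro!: integrable_continuous_real continuous_intros continuous_on_subset[OF \<psi>c])
    ultimately show ?thesis by simp
  qed
  \<comment> \<open>144 is the square of \<open>12 = 10 + 2\<close>, from the bound on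
    \<open>p2\<close> and twice that on \<open>p1\<close>; \<open>1 / 4\<close> is the square of the
    lower bound \<open>1 / 2\<close> for the cutoff on \<open>{0..1}\<close>;
    \<open>I / \<epsilon>\<close> is its integral.\<close>
  have key: "w / 4 \<le> R\<^sup>2 * (144 * C\<^sup>2 * I) * \<epsilon>" if \<epsilon>: "0 < \<epsilon>" "\<epsilon> \<le> 1" for \<epsilon> :: real
  proof -
    define p where "p x = 1 / (1 + (\<epsilon> * x)\<^sup>2)" for x :: real
    define p1 where "p1 x = - 2 * \<epsilon>\<^sup>2 * x * (p x)\<^sup>2" for x
    define p2 where "p2 x = - 2 * \<epsilon>\<^sup>2 * (p x)\<^sup>2 + 8 * \<epsilon> ^ 4 * x\<^sup>2 * (p x) ^ 3" for x
    have D: "1 + (\<epsilon> * x)\<^sup>2 > 0" for x by (rule add_pos_nonneg) auto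
    have p0: "0 < p x" "p x \<le> 1" for x using D[of x] by (auto simp: p_def)
    have dp: "(p has_vector_derivative p1 x) (at x)" for x
      unfolding p_def[abs_def] has_real_derivative_iff_has_vector_derivative[symmetric]
      using D[of x] by (auto intro!: derivative_eq_intros simp: p1_def p_def power2_eq_square field_simps)
    have dp1: "(p1 has_vector_derivative p2 x) (at x)" for x
      unfolding p1_def[abs_def]
      using dp[of x] unfolding has_real_derivative_iff_has_vector_derivative[symmetric]
      by (auto intro!: derivative_eq_intros simp: p1_def p2_def power2_eq_square power3_eq_cube power4_eq_xxxx algebra_simps)
    have cp: "continuous_on UNIV p" unfolding p_def by (intro continuous_intros ballI) (metis D less_irrefl)
    have cp1: "continuous_on UNIV p1" unfolding p1_def by (intro continuous_intros cp)
    have cp2: "continuous_on UNIV p2" unfolding p2_def by (intro continuous_intros cp)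
    have pp: "(\<epsilon> * x)\<^sup>2 * p x \<le> 1" for x using D[of x] by (simp add: p_def field_simps)
    have b1: "\<bar>p1 x\<bar> \<le> \<epsilon> * p x" for x
    proof -
      have "2 * \<bar>\<epsilon> * x\<bar> \<le> 1 + (\<epsilon> * x)\<^sup>2"
        using zero_le_power2[of "\<bar>\<epsilon> * x\<bar> - 1"] by (simp add: power2_diff)
      then have "2 * \<bar>\<epsilon> * x\<bar> * p x \<le> 1" using D[of x] by (simp add: p_def field_simps)
      then have "(\<epsilon> * p x) * (2 * \<bar>\<epsilon> * x\<bar> * p x) \<le> (\<epsilon> * p x) * 1"
        using p0[of x] \<epsilon> by (intro mult_left_mono) auto
      then show ?thesis using \<epsilon> p0[of x]
        by (simp add: p1_def abs_mult power2_eq_square mult_ac)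
    qed
    \<comment> \<open>Since \<open>(\<epsilon> * x)^2 * p x\<close> lies between 0 and 1, the
      bracket lies between -2 and 6, so 10 is a comfortable bound; one factor
      \<open>\<epsilon>\<close> and one \<open>p x\<close> are then given away.\<close>
    have b2: "\<bar>p2 x\<bar> \<le> 10 * \<epsilon> * p x" for x
    proof -
      have "p2 x = \<epsilon>\<^sup>2 * (p x)\<^sup>2 * (8 * ((\<epsilon> * x)\<^sup>2 * p x) - 2)"
        by (simp add: p2_def algebra_simps power2_eq_square power3_eq_cube power4_eq_xxxx)
      then have "\<bar>p2 x\<bar> = \<epsilon>\<^sup>2 * (p x)\<^sup>2 * \<bar>8 * ((\<epsilon> * x)\<^sup>2 * p x) - 2\<bar>"
        by (simp add: abs_mult)
      also have "\<dots> \<le> \<epsilon>\<^sup>2 * (p x)\<^sup>2 * 10"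
      proof (rule mult_left_mono)
        have "0 \<le> (\<epsilon> * x)\<^sup>2 * p x" using p0[of x] by simp
        then show "\<bar>8 * ((\<epsilon> * x)\<^sup>2 * p x) - 2\<bar> \<le> 10" using pp[of x] by linarith
      qed simp
      also have "\<dots> \<le> (\<epsilon> * 1) * (p x * 1) * 10"
        unfolding power2_eq_square using p0[of x] \<epsilon> by (intro mult_right_mono mult_mono mult_left_mono) auto
      finally show ?thesis by simp
    qed
    define P P1 P2 where "P x = complex_of_real (p x)" and "P1 x = complex_of_real (p1 x)" and "P2 x = complex_of_real (p2 x)" for x
    have cP: "continuous_on UNIV P" "continuous_on UNIV P1" "continuous_on UNIV P2"
      unfolding P_def P1_def P2_def by (intro continuous_intros cp cp1 cp2)+
    have dP: "(P has_vector_derivative P1 x) (at x)" "(P1 has_vector_derivative P2 x) (at x)" for x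
      unfolding P_def[abs_def] P1_def[abs_def] P2_def
      by (rule has_vector_derivative_of_real, unfold has_real_derivative_iff_has_vector_derivative, rule dp dp1)+
    have acP: "locally_abs_continuous P" "locally_abs_continuous P1" "locally_abs_continuous \<psi>"
      by (rule locally_abs_continuous_C1, rule dP, rule cP)+ (rule locally_abs_continuous_C1[OF der c])
    define y where "y x = P x * \<psi> x" for x
    define h where "h x = - (P2 x * \<psi> x + 2 * P1 x * \<psi>' x)" for x
    define f where "f x = \<mu> * y x + h x" for x
    have yc: "continuous_on UNIV y" and hc: "continuous_on UNIV h" and fc: "continuous_on UNIV f"
      unfolding y_def h_def f_def by (intro continuous_intros cP c \<psi>c)+
    have pint: "integrable lebesgue p" and pI: "(LINT x|lebesgue. p x) = I / \<epsilon>"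
    proof -
      have p': "p = (\<lambda>x. 1 / (1 + (0 + \<epsilon> * x)\<^sup>2))" by (simp add: p_def fun_eq_iff)
      show "integrable lebesgue p"
        unfolding p' using \<epsilon> integrable_cauchy_density
        by (subst lebesgue_integrable_real_affine_iff[where f = "\<lambda>x. 1 / (1 + x\<^sup>2)"]) auto
      show "(LINT x|lebesgue. p x) = I / \<epsilon>"
        unfolding p' I_def using lebesgue_integral_real_affine[of \<epsilon> "\<lambda>x. 1 / (1 + x\<^sup>2)" 0] \<epsilon> by simp
    qed
    have L2: "g \<in> L2_fun \<and> (LINT x|lebesgue. (cmod (g x))\<^sup>2) \<le> M\<^sup>2 * (I / \<epsilon>)"
      if g: "continuous_on UNIV g" "\<And>x. cmod (g x) \<le> M * p x" for g :: "real \<Rightarrow> complex" and M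
    proof -
      have m: "g \<in> borel_measurable lebesgue"
        by (intro borel_measurable_lebesgueI borel_measurable_continuous_onI g)
      have le: "(cmod (g x))\<^sup>2 \<le> M\<^sup>2 * p x" for x
      proof -
        have "(cmod (g x))\<^sup>2 \<le> (M * p x)\<^sup>2" using g(2) by (intro power_mono) auto
        also have "\<dots> = M\<^sup>2 * (p x * p x)" by (simp add: power2_eq_square)
        also have "\<dots> \<le> M\<^sup>2 * (p x * 1)" using p0[of x] by (intro mult_left_mono) auto
        finally show ?thesis by simp
      qed
      have pM: "integrable lebesgue (\<lambda>x. M\<^sup>2 * p x)" using pint by simp
      have gi: "integrable lebesgue (\<lambda>x. (cmod (g x))\<^sup>2)"
        by (rule Bochner_Integration.integrable_bound[OF pM]) (use m le in \<open>auto intro!: AE_I2 order_trans[OF le abs_ge_self]\<close>)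
      have "(LINT x|lebesgue. (cmod (g x))\<^sup>2) \<le> (LINT x|lebesgue. M\<^sup>2 * p x)"
        by (intro integral_mono gi pM le)
      then show ?thesis using m gi by (simp add: L2_fun_def pI)
    qed
    have yb: "cmod (y x) \<le> C * p x" for x
      using mult_right_mono[OF b(1)[of x], of "p x"] p0[of x] by (simp add: y_def P_def norm_mult mult.commute)
    have hb: "cmod (h x) \<le> (12 * \<epsilon> * C) * p x" for x
    proof -
      have "cmod (h x) \<le> \<bar>p2 x\<bar> * cmod (\<psi> x) + 2 * \<bar>p1 x\<bar> * cmod (\<psi>' x)"
        unfolding h_def norm_minus_cancel by (rule order_trans[OF norm_triangle_ineq]) (simp add: norm_mult P1_def P2_def)
      also have "\<dots> \<le> (10 * \<epsilon> * p x) * C + 2 * (\<epsilon> * p x) * C"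
        using \<epsilon> p0[of x] by (intro add_mono mult_mono b b1 b2) auto
      finally show ?thesis by (simp add: algebra_simps)
    qed
    have fb: "cmod (f x) \<le> (cmod \<mu> * C + 12 * \<epsilon> * C) * p x" for x
    proof -
      have "cmod (f x) \<le> cmod \<mu> * cmod (y x) + cmod (h x)"
        unfolding f_def by (rule order_trans[OF norm_triangle_ineq]) (simp add: norm_mult)
      also have "\<dots> \<le> cmod \<mu> * (C * p x) + (12 * \<epsilon> * C) * p x"
        by (intro add_mono mult_left_mono yb hb) auto
      finally show ?thesis by (simp add: algebra_simps)
    qed
    have "(y, f) \<in> schroedinger_op q"
      unfolding schroedinger_op_def
    proof (clarify, intro conjI)
      show "y \<in> L2_fun" "f \<in> L2_fun" using L2[OF yc yb] L2[OF fc fb] by auto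
      show "locally_abs_continuous y" unfolding y_def[abs_def] by (intro locally_abs_continuous_mult acP)
      show "\<exists>y' y''. (\<forall>x. (y has_vector_derivative y' x) (at x)) \<and> locally_abs_continuous y' \<and>
         (AE x in lebesgue. (y' has_vector_derivative y'' x) (at x)) \<and> (AE x in lebesgue. f x = - y'' x + q x * y x)"
      proof (intro exI conjI allI)
        show "(y has_vector_derivative P x * \<psi>' x + P1 x * \<psi> x) (at x)" for x
          unfolding y_def[abs_def] by (intro has_vector_derivative_mult dP der)
        show "locally_abs_continuous (\<lambda>x. P x * \<psi>' x + P1 x * \<psi> x)"
          by (intro locally_abs_continuous_add locally_abs_continuous_mult acP ac)
        show "AE x in lebesgue. ((\<lambda>x. P x * \<psi>' x + P1 x * \<psi> x) has_vector_derivative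
            (P x * ((q x - \<mu>) * \<psi> x) + P1 x * \<psi>' x) + (P1 x * \<psi>' x + P2 x * \<psi> x)) (at x)"
          using ae by eventually_elim (intro has_vector_derivative_add has_vector_derivative_mult dP der)
        show "AE x in lebesgue. f x = - ((P x * ((q x - \<mu>) * \<psi> x) + P1 x * \<psi>' x) + (P1 x * \<psi>' x + P2 x * \<psi> x)) + q x * y x"
          by (intro AE_I2) (simp add: f_def h_def y_def algebra_simps)
      qed
    qed
    from R[OF this] have "L2_norm y \<le> R * L2_norm h" by (simp add: f_def)
    moreover have "0 \<le> L2_norm y" by (simp add: L2_norm_def)
    ultimately have "(L2_norm y)\<^sup>2 \<le> (R * L2_norm h)\<^sup>2" by (rule power_mono)
    moreover have "(L2_norm g)\<^sup>2 = (LINT x|lebesgue. (cmod (g x))\<^sup>2)" for g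
      by (simp add: L2_norm_def)
    ultimately have 1: "(LINT x|lebesgue. (cmod (y x))\<^sup>2) \<le> R\<^sup>2 * (LINT x|lebesgue. (cmod (h x))\<^sup>2)"
      by (simp add: power_mult_distrib)
    have "w / 4 = (LINT x|lebesgue. (1 / 4) * (indicator {0..1} x * (cmod (\<psi> x))\<^sup>2))"
      unfolding w_def by simp
    also have "\<dots> \<le> (LINT x|lebesgue. (cmod (y x))\<^sup>2)"
    proof (rule integral_mono)
      show "integrable lebesgue (\<lambda>x. (1 / 4) * (indicator {0..1} x * (cmod (\<psi> x))\<^sup>2) :: real)" using wi by simp
      show "integrable lebesgue (\<lambda>x. (cmod (y x))\<^sup>2)" using L2[OF yc yb] by (simp add: L2_fun_def)
      fix x :: real
      show "1 / 4 * (indicator {0..1} x * (cmod (\<psi> x))\<^sup>2) \<le> (cmod (y x))\<^sup>2"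
      proof (cases "x \<in> {0..1}")
        case True
        have "(\<epsilon> * x)\<^sup>2 \<le> 1" using \<epsilon> True by (intro power_le_one mult_le_one mult_nonneg_nonneg) auto
        then have "1 / 2 \<le> p x" using D[of x] by (simp add: p_def field_simps)
        then have "(1 / 2)\<^sup>2 \<le> (p x)\<^sup>2" by (intro power_mono) auto
        then have "1 / 4 * (cmod (\<psi> x))\<^sup>2 \<le> (p x)\<^sup>2 * (cmod (\<psi> x))\<^sup>2"
          by (intro mult_right_mono) (auto simp: power2_eq_square)
        then show ?thesis using True p0[of x] by (simp add: y_def P_def norm_mult power_mult_distrib)
      qed simp
    qed
    also note 1
    also have "R\<^sup>2 * (LINT x|lebesgue. (cmod (h x))\<^sup>2) \<le> R\<^sup>2 * ((12 * \<epsilon> * C)\<^sup>2 * (I / \<epsilon>))"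
      using L2[OF hc hb] by (intro mult_left_mono) auto
    also have "\<dots> = R\<^sup>2 * (144 * C\<^sup>2 * I) * \<epsilon>"
      using \<epsilon> by (simp add: power2_eq_square field_simps)
    finally show ?thesis .
  qed
  \<comment> \<open>The absolute value and the added 1 give a positive majorant, so
    \<open>\<epsilon>\<close> can be chosen by division; the right side drops to
    \<open>w / 8\<close>.\<close>
  define T where "T = \<bar>R\<^sup>2 * (144 * C\<^sup>2 * I)\<bar> + 1"
  define \<epsilon> where "\<epsilon> = min 1 (w / (8 * T))"
  have T: "T > 0" by (simp add: T_def)
  have \<epsilon>: "0 < \<epsilon>" "\<epsilon> \<le> 1" using w T by (auto simp: \<epsilon>_def)
  have "R\<^sup>2 * (144 * C\<^sup>2 * I) * \<epsilon> \<le> T * \<epsilon>" using \<epsilon> by (intro mult_right_mono) (auto simp: T_def)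
  also have "\<dots> \<le> T * (w / (8 * T))" using T by (intro mult_left_mono) (auto simp: \<epsilon>_def)
  also have "\<dots> = w / 8" using T by simp
  finally show False using key[OF \<epsilon>] w by linarith
qed

section \<open>From the Sobolev condition to periodic regularity\<close>

lemma AE_lebesgue_shift:
  assumes "AE x in lebesgue. P (x::real)"
  shows "AE x in lebesgue. P (x + c)"
proof -
  obtain N where N: "negligible N" "{x. \<not> P x} \<subseteq> N"
    using assms unfolding eventually_ae_filter_negligible by blast
  have "negligible ((+) (- c) ` N)" using N(1) by (rule negligible_translation)
  moreover have "{x. \<not> P (x + c)} \<subseteq> (+) (- c) ` N"
    using N(2) by (auto simp: image_iff intro!: bexI[of _ "_ + c"])
  ultimately show ?thesis unfolding eventually_ae_filter_negligible by blast
qed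

lemma AE_eq_continuous_imp_eq:
  fixes f g :: "real \<Rightarrow> complex"
  assumes "AE x in lebesgue. f x = g x" "continuous_on UNIV f" "continuous_on UNIV g"
  shows "f x = g x"
proof (rule ccontr)
  assume "f x \<noteq> g x"
  have "open {x. f x - g x \<noteq> 0}"
    using open_Collect_neq[of "\<lambda>x. f x - g x" "\<lambda>x. 0"] assms(2,3) by (auto intro!: continuous_intros)
  moreover obtain N where "negligible N" "{x. \<not> f x = g x} \<subseteq> N"
    using assms(1) unfolding eventually_ae_filter_negligible by blast
  then have "negligible {x. f x - g x \<noteq> 0}" by (auto intro: negligible_subset)
  ultimately show False using open_not_negligible \<open>f x \<noteq> g x\<close> by force
qed

lemma locally_abs_continuous_imp_continuous:
  assumes "locally_abs_continuous f"
  shows "continuous_on UNIV f"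
proof -
  have "isCont f x" for x
    using continuous_on_interior[OF abs_continuous_on_imp_continuous_on[of "x - 1" "x + 1" f], of x] assms
    by (simp add: locally_abs_continuous_def)
  then show ?thesis by (simp add: continuous_at_imp_continuous_on)
qed

text \<open>The witness \<open>v\<close> inherits periodicity: its shift is also a derivative of
  \<open>f\<close>, so the two agree almost everywhere, and everywhere once \<open>v\<close> is
  continuous. At order 0 a witness is determined only almost everywhere, which is why periodicity is
  asked at positive order.\<close>

lemma sobolev_W1_imp_psob:
  "sobolev_W1 s f \<Longrightarrow> (s > 0 \<Longrightarrow> \<forall>x. f (x + 1) = f x) \<Longrightarrow> psob s f"
proof (induction s arbitrary: f)
  case 0
  then show ?case by (simp add: L1_def)
next
  case (Suc s)
  then have per: "f (x + 1) = f x" for x by simp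
  from Suc.prems(1) obtain v where ac: "locally_abs_continuous f"
    and v: "AE x in lebesgue. (f has_vector_derivative v x) (at x)" "sobolev_W1 s v" by auto
  have "\<forall>x. v (x + 1) = v x" if s: "s > 0"
  proof
    fix x
    have vc: "continuous_on UNIV v"
      using v(2) s by (cases s) (auto intro: locally_abs_continuous_imp_continuous)
    have "AE x in lebesgue. v (x + 1) = v x"
      using v(1) AE_lebesgue_shift[OF v(1), of 1]
    proof eventually_elim
      case (elim x)
      have "((\<lambda>y::real. y + 1) has_real_derivative 1) (at x)" by (auto intro!: derivative_eq_intros)
      then have "((\<lambda>y. f (y + 1)) has_vector_derivative v (x + 1)) (at x)"
        using vector_diff_chain_at[of "\<lambda>y. y + 1" 1 x f "v (x + 1)"] elim(2)
        by (simp add: has_real_derivative_iff_has_vector_derivative o_def)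
      then have "(f has_vector_derivative v (x + 1)) (at x)" by (simp add: per)
      then show ?case using elim(1) by (rule vector_derivative_unique_at)
    qed
    then show "v (x + 1) = v x"
      by (rule AE_eq_continuous_imp_eq)
        (auto intro!: continuous_on_compose2[OF vc] continuous_intros vc)
  qed
  then have pv: "psob s v" by (rule Suc.IH[OF v(2)])
  have "prim v f"
    unfolding prim_def
  proof (intro conjI ballI)
    show "L1 v" by (rule psob_L1[OF pv])
    fix x :: real assume x: "x \<in> {0..1}"
    have "abs_continuous_on 0 x f" using ac by (simp add: locally_abs_continuous_def)
    from fundamental_theorem_abs_continuous[OF _ this v(1)] x
    show "integral {0..x} v = f x - f 0" by (auto intro: integral_unique)
  qed
  then show ?case using pv per[of 0] by (auto simp: psob.simps(2))
qed

theorem theorem5: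
  fixes q :: "real \<Rightarrow> complex" and s :: nat and m \<alpha> :: real
  assumes "q absolutely_integrable_on {0..1}"
    and "integral {0..1} q = 0"
    and "\<And>x. q (x + 1) = q x"
    and "\<And>x. cnj (q (- x)) = q x"
    and "sobolev_W1 s q"
    and "m > 0" and "\<alpha> > 0"
    and "\<And>n::int. real_of_int n > m \<Longrightarrow>
           Re (P_coeff q n) < - \<alpha> * real_of_int n powi (- 2 * int s - 2)"
  shows "finite_zone q"
proof -
  have psob: "psob s q" using sobolev_W1_imp_psob[OF assms(5)] assms(3) by simp
  have mean: "mean q = 0" using assms(2) by (simp add: mean_def)
  \<comment> \<open>Translation by one period turns the reflection about 0 into the reflection about
    the midpoint of the unit interval.\<close>
  have psym: "psym q"
    unfolding psym_def
  proof
    fix x :: real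
    have "cnj (q (1 - x)) = q (x - 1)" using assms(4)[of "x - 1"] by simp
    also have "\<dots> = q x" using assms(3)[of "x - 1"] by simp
    finally show "cnj (q (1 - x)) = q x" .
  qed
  obtain K where K: "K \<ge> 2" "\<And>k. k \<ge> K \<Longrightarrow> \<exists>A B \<rho>. psol q k A B \<and> (A 0 \<noteq> 0 \<or> B 0 \<noteq> 0) \<and> cmod \<rho> = 1 \<and>
    A 1 * cis k = \<rho> * A 0 \<and> B 1 * cis (- k) = \<rho> * B 0"
    using bloch_solution[OF psob mean psym assms(7) assms(8)] by blast
  show ?thesis
    unfolding finite_zone_def
  proof (intro exI[of _ "K\<^sup>2"] subsetI)
    fix \<mu> assume "\<mu> \<in> complex_of_real ` {K\<^sup>2..}"
    then obtain t where t: "\<mu> = of_real t" "K\<^sup>2 \<le> t" by auto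
    define k where "k = sqrt t"
    have k: "k \<ge> K" using t(2) K(1) by (simp add: k_def real_le_rsqrt)
    have "0 \<le> t" using t(2) by (rule order_trans[OF zero_le_power2])
    then have \<mu>: "\<mu> = (of_real k)\<^sup>2" unfolding t(1) k_def of_real_power[symmetric] by simp
    obtain A B \<rho> where AB: "psol q k A B" "A 0 \<noteq> 0 \<or> B 0 \<noteq> 0" "cmod \<rho> = 1"
      "A 1 * cis k = \<rho> * A 0" "B 1 * cis (- k) = \<rho> * B 0"
      using K(2)[OF k] by blast
    have k2: "k \<ge> 2" using k K(1) by linarith
    obtain \<psi> \<psi>' C where \<psi>: "\<And>x. (\<psi> has_vector_derivative \<psi>' x) (at x)" "continuous_on UNIV \<psi>'"
      "locally_abs_continuous \<psi>'" "AE x in lebesgue. (\<psi>' has_vector_derivative (q x - (of_real k)\<^sup>2) * \<psi> x) (at x)"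
      "\<And>x. cmod (\<psi> x) \<le> C" "\<And>x. cmod (\<psi>' x) \<le> C" "\<exists>x\<in>{0..1}. \<psi> x \<noteq> 0"
      by (rule bloch_extension[OF psob_L1[OF psob] assms(3) AB(1) k2 AB(2,3,4,5)]) (rule that)
    have "\<mu> \<notin> resolvent_set (schroedinger_op q)"
      unfolding \<mu> by (rule weyl_sequence[OF \<psi>])
    then show "\<mu> \<in> real_spectrum q"
      by (simp add: real_spectrum_def op_spectrum_def t(1))
  qed
qed

end
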